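(* Let $S$ be the $(4,6)$-spectrum and let $A=\{n : n\text{ even},\ n\ge 26\}\cup\{35\}\cup\{n : n\text{ odd},\ n\ge 39\}$, that is, $A=\{26,28,30,32,34,35,36,38,39,40,41,\dots\}$. Then $A\subseteq S\subseteq A\cup\{37\}$. In particular $N(4,6)\le 38$.
   Context: Graphs are finite and simple. For integers $k\ge 3$, $g\ge 3$, a $(k,g)$-graph is a $k$-regular graph of girth exactly $g$. The $(k,g)$-spectrum is the set of all integers $n$ such that there exists a connected $(k,g)$-graph of order $n$. For even $k$, $N(k,g)$ denotes the smallest integer $N$ such that all integers $n\ge N$ belong to the $(k,g)$-spectrum. *)

theory Defs
  imports "Graph_Theory.Digraph_Component" "HOL-Library.Extended_Nat"
begin

(* Finite simple graphs are pair_graph from the Graph_Theory entry: every edge {u,v} is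
   represented by the two arcs (u,v) and (v,u). *)

(* pre_digraph.cycle also accepts the back-and-forth walk u,v,u along a single edge;
   the length bound excludes it. *)
definition graph_cycle :: "'a pair_pre_digraph \<Rightarrow> ('a \<times> 'a) awalk \<Rightarrow> bool" where
  "graph_cycle G p \<longleftrightarrow> pre_digraph.cycle (with_proj G) p \<and> 3 \<le> length p"

(* The infimum over the empty set is \<infinity>, so an acyclic graph has girth \<infinity>. *)
definition girth :: "'a pair_pre_digraph \<Rightarrow> enat" where
  "girth G = (INF p \<in> {p. graph_cycle G p}. enat (length p))"

definition regular :: "nat \<Rightarrow> 'a pair_pre_digraph \<Rightarrow> bool" where
  "regular k G \<longleftrightarrow> (\<forall>v \<in> pverts G. out_degree (with_proj G) v = k)"

definition kg_graph :: "nat \<Rightarrow> nat \<Rightarrow> 'a pair_pre_digraph \<Rightarrow> bool" where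
  "kg_graph k g G \<longleftrightarrow> pair_graph G \<and> regular k G \<and> girth G = enat g"

(* Every finite graph is isomorphic to one whose vertices are natural numbers. *)
definition kg_spectrum :: "nat \<Rightarrow> nat \<Rightarrow> nat set" where
  "kg_spectrum k g = {n. \<exists>G :: nat pair_pre_digraph.
     kg_graph k g G \<and> Digraph_Component.connected (with_proj G) \<and> card (pverts G) = n}"

(* Meant for even k. LEAST is unspecified if no such N exists. *)
definition spectrum_threshold :: "nat \<Rightarrow> nat \<Rightarrow> nat" where
  "spectrum_threshold k g = (LEAST N. \<forall>n \<ge> N. n \<in> kg_spectrum k g)"

end

theory Submission
  imports Defs
begin

text \<open>
Existence. The Golomb ruler \<open>{0, 1, 4, 6}\<close> gives bipartite graphs with a cyclic
symmetry of every even order from 26 on (\<open>even_spectrum\<close>): a square would be a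
coincidence between differences of marks. If two edges of a graph of girth 6 are far enough from
each other, they can be removed and their four ends joined to a new vertex without creating a
short cycle; in the bipartite graphs with at least 40 vertices such edges exist, so all odd orders
from 41 on occur (\<open>odd_spectrum\<close>). Orders 35 and 39 are shown by explicit graphs.

Non-existence. The Moore bound excludes orders below 26. A graph of odd order is not bipartite, as
the two classes of a regular bipartite graph have equal size. So consider a shortest odd cycle, of
length \<open>g\<close>. Its vertices have \<open>2 * g\<close> distinct neighbours off the cycle,
whence \<open>3 * g \<le> n\<close>; for \<open>n \<le> 33\<close> this leaves \<open>g = 7, 9,
11\<close>. By minimality, edges between these outer neighbours join only those of cycle vertices
at distance 3.

For \<open>g = 9\<close> and \<open>g = 11\<close> this information, with the degrees and the
girth, is contradictory (\<open>nine_or_eleven\<close>). For \<open>g = 7\<close> two local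
configurations are shown to be impossible (\<open>no_wide\<close>, \<open>no_split\<close>).
Without them there are at most three edges between outer neighbours. Then so many edges leave the
outer neighbours that at least twelve further vertices are needed to absorb them, and \<open>n =
33\<close> holds with equality in all estimates (\<open>tight_counts\<close>). This determines the
edges between outer neighbours up to rotation and makes the twelve vertices span a perfect
matching; that last configuration is impossible too (\<open>no_seven\<close>). Order 37 is the
only one that neither this argument nor the constructions settle.

The impossibility of each configuration is a finite case distinction, too large for a readable
proof. It is recorded as a certificate: a sequence of forced deductions and of branchings modulo
automorphisms of the partial graph. A checker for certificates is defined as a function and proved
sound (\<open>refutes_sound\<close>), and its runs are evaluated inside the logic.
\<close>

section \<open>Quartic graphs of girth at least 6\<close>

text \<open>
The combinatorial content of a $(4,6)$-graph: regularity of degree 4 together with the absence of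
closed walks of length 3, 4, 5 other than degenerate ones. Connectedness and the existence of a
hexagon are left out: they are irrelevant for the impossibility proofs. In
\<open>no_square\<close> the alternatives exclude walks that turn back; the odd lengths need no
such exception, since an odd closed walk that turns back contains a shorter one.
\<close>
locale girth6_quartic =
  fixes V :: "'a set" and adj :: "'a \<Rightarrow> 'a \<Rightarrow> bool"
  assumes finite_V: "finite V"
    and adj_in: "adj x y \<Longrightarrow> x \<in> V"
    and sym: "adj x y \<Longrightarrow> adj y x"
    and irrefl: "\<not> adj x x"
    and degree: "x \<in> V \<Longrightarrow> card {y. adj x y} = 4"
    and no_triangle: "adj a b \<Longrightarrow> adj b c \<Longrightarrow> adj c a \<Longrightarrow> False"
    and no_square: "adj a b \<Longrightarrow> adj b c \<Longrightarrow> adj c d \<Longrightarrow> adj d a \<Longrightarrow> a = c \<or> b = d"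
    and no_pentagon: "adj a b \<Longrightarrow> adj b c \<Longrightarrow> adj c d \<Longrightarrow> adj d e \<Longrightarrow> adj e a \<Longrightarrow> False"

lemma graph_cycle_iff:
  "graph_cycle G p \<longleftrightarrow> 3 \<le> length p \<and> (\<exists>u. u \<in> pverts G \<and> set p \<subseteq> parcs G \<and> pcas u p u
     \<and> distinct (tl (pawalk_verts u p)))"
  unfolding graph_cycle_def pre_digraph.cycle_def pre_digraph.awalk_def
    cas_with_proj_eq awalk_verts_with_proj_eq with_proj_simps by auto

lemma out_degree_pair: "out_degree (with_proj G) v = card {y. (v, y) \<in> parcs G}"
proof -
  have "out_arcs (with_proj G) v = Pair v ` {y. (v, y) \<in> parcs G}"
    by (auto simp: out_arcs_def)
  then show ?thesis by (simp add: out_degree_def card_image[of "Pair v"] inj_on_def)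
qed

text \<open>
The library defines connectedness through the symmetric closure, which for a pair graph is the
graph itself.
\<close>
lemma connected_pair:
  assumes "pair_graph G"
  shows "Digraph_Component.connected (with_proj G) \<longleftrightarrow>
    pverts G \<noteq> {} \<and> (\<forall>u\<in>pverts G. \<forall>v\<in>pverts G. (u, v) \<in> (parcs G)\<^sup>*)"
proof -
  interpret pair_graph G by fact
  have s: "symmetric (with_proj G)" by (rule sym_arcs)
  have r: "u \<rightarrow>\<^sup>*\<^bsub>with_proj (mk_symmetric (with_proj G))\<^esub> v \<longleftrightarrow> u \<rightarrow>\<^sup>*\<^bsub>with_proj G\<^esub> v" for u v
    using reachable_mk_symmetric_eq[OF s] by simp
  have c: "u \<rightarrow>\<^sup>*\<^bsub>with_proj G\<^esub> v \<longleftrightarrow> (u,v) \<in> (parcs G)\<^sup>* \<inter> (pverts G \<times> pverts G)" for u v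
    using reachable_conv by simp
  show ?thesis
    unfolding connected_def strongly_connected_def r c by (auto simp: mk_symmetric_def)
qed

lemma kg_graph_girth6_quartic:
  assumes "kg_graph 4 6 G"
  shows "girth6_quartic (pverts G) (\<lambda>x y. (x, y) \<in> parcs G)"
proof -
  have pg: "pair_graph G" and reg: "regular 4 G" and gi: "girth G = enat 6"
    using assms by (auto simp: kg_graph_def)
  interpret pair_graph G by fact
  have ar: "x \<in> pverts G" "y \<in> pverts G" "x \<noteq> y" if "(x, y) \<in> parcs G" for x y
    using that arc_fst_in_verts arc_snd_in_verts pair_no_loops by force+
  have sy: "(y, x) \<in> parcs G" if "(x, y) \<in> parcs G" for x y
    using that sym_arcs by (auto simp: symmetric_def elim: symE)
  have no: False if "graph_cycle G p" "length p < 6" for p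
  proof -
    have "girth G \<le> enat (length p)"
      unfolding girth_def using that(1) by (intro INF_lower) simp
    with that(2) gi show False by simp
  qed
  have tri: False if "(a, b) \<in> parcs G" "(b, c) \<in> parcs G" "(c, a) \<in> parcs G" for a b c
    by (rule no[of "[(a,b),(b,c),(c,a)]"]) (use that ar in \<open>auto simp: graph_cycle_iff dest: ar\<close>)
  have sq: "a = c \<or> b = d"
    if "(a, b) \<in> parcs G" "(b, c) \<in> parcs G" "(c, d) \<in> parcs G" "(d, a) \<in> parcs G" for a b c d
  proof (rule ccontr)
    assume "\<not> ?thesis"
    with that show False
      by (intro no[of "[(a,b),(b,c),(c,d),(d,a)]"]) (auto simp: graph_cycle_iff dest: ar)
  qed
  show ?thesis
  proof
    show "finite (pverts G)" by (rule pair_finite_verts)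
    show "x \<in> pverts G" if "(x, y) \<in> parcs G" for x y using ar that by blast
    show "(x, x) \<notin> parcs G" for x using ar by blast
    show "card {y. (x, y) \<in> parcs G} = 4" if "x \<in> pverts G" for x
      using reg that by (simp add: regular_def out_degree_pair)
    show False if e: "(a, b) \<in> parcs G" "(b, c) \<in> parcs G" "(c, d) \<in> parcs G" "(d, e) \<in> parcs G"
      "(e, a) \<in> parcs G" for a b c d e
    proof -
      have "a \<noteq> c" "b \<noteq> d" "c \<noteq> e" "d \<noteq> a" "e \<noteq> b" using tri e by blast+
      with e show False
        by (intro no[of "[(a,b),(b,c),(c,d),(d,e),(e,a)]"]) (auto simp: graph_cycle_iff dest: ar)
    qed
  qed (use sy tri sq in blast)+
qed

lemma length_345:
  "length xs = 3 \<longleftrightarrow> (\<exists>a b c. xs = [a,b,c])"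
  "length xs = 4 \<longleftrightarrow> (\<exists>a b c d. xs = [a,b,c,d])"
  "length xs = 5 \<longleftrightarrow> (\<exists>a b c d e. xs = [a,b,c,d,e])"
  by (auto simp: length_Suc_conv eval_nat_numeral)

text \<open>
The converse passage back to graphs on natural numbers. A hexagon must be exhibited, since the
locale bounds the girth only from below.
\<close>
lemma (in girth6_quartic) card_in_spectrum:
  assumes conn: "\<And>x y. x \<in> V \<Longrightarrow> y \<in> V \<Longrightarrow> adj\<^sup>*\<^sup>* x y"
    and hex: "adj a b" "adj b c" "adj c d" "adj d e" "adj e f" "adj f a" "distinct [a,b,c,d,e,f]"
  shows "card V \<in> kg_spectrum 4 6"
proof -
  obtain h :: "'a \<Rightarrow> nat" where h: "inj_on h V"
    using finite_imp_inj_to_nat_seg[OF finite_V] by blast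
  define G where "G = \<lparr>pverts = h ` V, parcs = {(h x, h y) |x y. adj x y}\<rparr>"
  have ain: "x \<in> V" "y \<in> V" if "adj x y" for x y using that adj_in sym by blast+
  have arc: "(h x, h y) \<in> parcs G \<longleftrightarrow> adj x y" if "x \<in> V" "y \<in> V" for x y
    using that h ain by (auto simp: G_def inj_on_eq_iff)
  have arcE: "\<exists>x y. x \<in> V \<and> y \<in> V \<and> p = (h x, h y) \<and> adj x y" if "p \<in> parcs G" for p
    using that ain unfolding G_def by simp blast
  have fin: "finite (parcs G)"
    by (rule finite_subset[of _ "h ` V \<times> h ` V"]) (use ain finite_V in \<open>auto simp: G_def\<close>)
  have pg: "pair_graph G"
  proof
    show "symmetric (with_proj G)" by (auto simp: symmetric_def sym_def G_def intro: sym)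
    show "fst p \<noteq> snd p" if "p \<in> parcs G" for p
      using arcE[OF that] h irrefl by (auto simp: inj_on_eq_iff)
  qed (use fin finite_V ain in \<open>auto simp: G_def\<close>)
  have reg: "regular 4 G"
    unfolding regular_def out_degree_pair
  proof
    fix v assume "v \<in> pverts G"
    then obtain x where x: "x \<in> V" "v = h x" by (auto simp: G_def)
    have "{y. (v, y) \<in> parcs G} = h ` {y. adj x y}" using x h ain by (auto simp: G_def inj_on_eq_iff)
    moreover have "inj_on h {y. adj x y}" by (rule inj_on_subset[OF h]) (use ain in auto)
    ultimately show "card {y. (v, y) \<in> parcs G} = 4" by (simp add: card_image degree x)
  qed
  have V6: "{a,b,c,d,e,f} \<subseteq> V" using hex ain by blast
  have "enat 6 \<le> girth G"
    unfolding girth_def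
  proof (rule INF_greatest, rule ccontr)
    fix p assume "p \<in> {p. graph_cycle G p}" and n: "\<not> enat 6 \<le> enat (length p)"
    then obtain u where p: "3 \<le> length p" "set p \<subseteq> parcs G" "pcas u p u" "distinct (tl (pawalk_verts u p))"
      by (auto simp: graph_cycle_iff)
    from n p(1) consider "length p = 3" | "length p = 4" | "length p = 5" by fastforce
    then show False
    proof cases
      case 1
      then obtain p1 p2 p3 where P: "p = [p1,p2,p3]" by (auto simp: length_345)
      with p arcE[of p1] arcE[of p2] arcE[of p3] h show False
        by (auto simp: inj_on_eq_iff dest: no_triangle)
    next
      case 2
      then obtain p1 p2 p3 p4 where P: "p = [p1,p2,p3,p4]" by (auto simp: length_345)
      with p arcE[of p1] arcE[of p2] arcE[of p3] arcE[of p4] h show False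
        by (auto simp: inj_on_eq_iff dest: no_square)
    next
      case 3
      then obtain p1 p2 p3 p4 p5 where P: "p = [p1,p2,p3,p4,p5]" by (auto simp: length_345)
      with p arcE[of p1] arcE[of p2] arcE[of p3] arcE[of p4] arcE[of p5] h show False
        by (auto simp: inj_on_eq_iff dest: no_pentagon)
    qed
  qed
  moreover have "girth G \<le> enat 6"
  proof -
    let ?p = "[(h a, h b), (h b, h c), (h c, h d), (h d, h e), (h e, h f), (h f, h a)]"
    have "graph_cycle G ?p"
      using hex V6 h by (auto simp: graph_cycle_iff arc inj_on_eq_iff) (auto simp: G_def)
    then have "girth G \<le> enat (length ?p)" unfolding girth_def by (intro INF_lower) simp
    then show ?thesis by (simp add: eval_nat_numeral)
  qed
  ultimately have "kg_graph 4 6 G" using pg reg by (auto simp: kg_graph_def)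
  moreover have "Digraph_Component.connected (with_proj G)"
  proof -
    have "(h x, h y) \<in> (parcs G)\<^sup>*" if "adj\<^sup>*\<^sup>* x y" for x y
      using that
    proof induction
      case (step y z)
      then have "(h y, h z) \<in> parcs G" by (auto simp: G_def)
      with step.IH show ?case by (rule rtrancl_into_rtrancl)
    qed simp
    with conn V6 show ?thesis by (auto simp: connected_pair[OF pg]) (auto simp: G_def)
  qed
  moreover have "card (pverts G) = card V" by (simp add: G_def card_image h)
  ultimately show ?thesis unfolding kg_spectrum_def by blast
qed

section \<open>Two explicit graphs, of orders 35 and 39\<close>


text \<open>
A test on lists of neighbours that is local enough to be evaluated by rewriting. If
\<open>n2\<close> lists the ends of the walks of length 2 from \<open>v\<close> that do not return
to \<open>v\<close>, then distinctness of \<open>v # n1 @ n2\<close> excludes triangles and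
squares through \<open>v\<close>, and independence of \<open>n2\<close> excludes pentagons through
\<open>v\<close>. The last conjunct gives every vertex except 0 a smaller neighbour, whence
connectedness by descent to 0.
\<close>
definition nbs_ok :: "nat list list \<Rightarrow> bool" where
  "nbs_ok ns \<longleftrightarrow> (\<forall>v\<in>set [0..<length ns].
     let n1 = ns ! v; n2 = concat (map (\<lambda>u. removeAll v (ns ! u)) n1) in
     length n1 = 4 \<and> list_all (\<lambda>u. u < length ns \<and> List.member (ns ! u) v) n1 \<and> distinct (v # n1 @ n2)
     \<and> list_all (\<lambda>c. list_all (\<lambda>d. \<not> List.member n2 d) (ns ! c)) n2
     \<and> (v = 0 \<or> list_ex (\<lambda>u. u < v) n1))"

definition nbs_adj :: "nat list list \<Rightarrow> nat \<Rightarrow> nat \<Rightarrow> bool" where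
  "nbs_adj ns v u \<longleftrightarrow> v < length ns \<and> u \<in> set (ns ! v)"

lemma distinct_concat_mapD:
  "distinct (concat (map f xs)) \<Longrightarrow> x \<in> set xs \<Longrightarrow> y \<in> set xs \<Longrightarrow> x \<noteq> y \<Longrightarrow> set (f x) \<inter> set (f y) = {}"
  by (induction xs) auto

lemma nbs_okD:
  assumes "nbs_ok ns"
  shows "girth6_quartic {..<length ns} (nbs_adj ns)"
    and "v < length ns \<Longrightarrow> w < length ns \<Longrightarrow> (nbs_adj ns)\<^sup>*\<^sup>* v w"
proof -
  let ?A = "nbs_adj ns"
  define n2 where "n2 v = concat (map (\<lambda>u. removeAll v (ns ! u)) (ns ! v))" for v
  have K: "length (ns ! v) = 4 \<and> (\<forall>u\<in>set (ns ! v). u < length ns \<and> v \<in> set (ns ! u)) \<and>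
      distinct (v # ns ! v @ n2 v) \<and> (\<forall>c\<in>set (n2 v). \<forall>d\<in>set (ns ! c). d \<notin> set (n2 v)) \<and>
      (v = 0 \<or> (\<exists>u\<in>set (ns ! v). u < v))" if "v < length ns" for v
  proof -
    have "v \<in> set [0..<length ns]" using that by simp
    from bspec[OF assms[unfolded nbs_ok_def] this] show ?thesis
      unfolding Let_def n2_def[symmetric] list_all_iff list_ex_iff List.member_iff .
  qed
  note L = K[THEN conjunct1] K[THEN conjunct2, THEN conjunct1, rule_format]
    K[THEN conjunct2, THEN conjunct2, THEN conjunct1]
    K[THEN conjunct2, THEN conjunct2, THEN conjunct2, THEN conjunct1, rule_format]
    K[THEN conjunct2, THEN conjunct2, THEN conjunct2, THEN conjunct2]
  have sy: "?A w v" if "?A v w" for v w using that L(2) by (auto simp: nbs_adj_def)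
  have ir: "\<not> ?A v v" for v using L(3) by (auto simp: nbs_adj_def)
  have n2I: "w \<in> set (n2 v)" if "?A v u" "?A u w" "w \<noteq> v" for u v w
    using that by (auto simp: n2_def nbs_adj_def)
  have tri: False if "?A a b" "?A b c" "?A c a" for a b c
  proof -
    have "c \<in> set (n2 a)" using n2I[OF that(1,2)] that(3) ir by blast
    moreover have "c \<in> set (ns ! a)" "a < length ns" using sy[OF that(3)] by (auto simp: nbs_adj_def)
    ultimately show False using L(3)[of a] by auto
  qed
  show "girth6_quartic {..<length ns} ?A"
  proof
    show "card {y. ?A x y} = 4" if "x \<in> {..<length ns}" for x
    proof -
      have "{y. ?A x y} = set (ns ! x)" using that by (auto simp: nbs_adj_def)
      then show ?thesis using L(1,3)[of x] that by (simp add: distinct_card)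
    qed
    show "a = c \<or> b = d" if "?A a b" "?A b c" "?A c d" "?A d a" for a b c d
    proof (rule ccontr)
      assume ne: "\<not> ?thesis"
      have a: "a < length ns" "b \<in> set (ns ! a)" "d \<in> set (ns ! a)"
        using that(1) sy[OF that(4)] by (auto simp: nbs_adj_def)
      have c: "c \<in> set (removeAll a (ns ! b))" "c \<in> set (removeAll a (ns ! d))"
        using that(2) sy[OF that(3)] ne by (auto simp: nbs_adj_def)
      have "distinct (n2 a)" using L(3)[OF a(1)] by simp
      then have "set (removeAll a (ns ! b)) \<inter> set (removeAll a (ns ! d)) = {}"
        unfolding n2_def using a ne by (intro distinct_concat_mapD) auto
      with c show False by blast
    qed
    show False if e: "?A a b" "?A b c" "?A c d" "?A d e" "?A e a" for a b c d e
    proof -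
      have "c \<noteq> a" "d \<noteq> a" using e tri ir by blast+
      then have "c \<in> set (n2 a)" "d \<in> set (n2 a)" using n2I[OF e(1,2)] n2I[OF sy[OF e(5)] sy[OF e(4)]] by auto
      then show False using L(4)[of a c d] e(1,3) by (auto simp: nbs_adj_def)
    qed
  qed (fact sy ir tri | simp add: nbs_adj_def)+
  have zero: "?A\<^sup>*\<^sup>* v 0" if "v < length ns" for v
    using that
  proof (induction v rule: less_induct)
    case (less v)
    show ?case
    proof (cases "v = 0")
      case False
      then obtain u where u: "u \<in> set (ns ! v)" "u < v" using L(5) less.prems by blast
      then have "?A v u" using less.prems by (auto simp: nbs_adj_def)
      moreover have "?A\<^sup>*\<^sup>* u 0" using less.IH u less.prems by simp
      ultimately show ?thesis by (rule converse_rtranclp_into_rtranclp)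
    qed simp
  qed
  have "symp ?A\<^sup>*\<^sup>*" by (rule symp_rtranclp) (use sy in \<open>auto intro: sympI\<close>)
  then show "?A\<^sup>*\<^sup>* v w" if "v < length ns" "w < length ns" for v w
    using zero[OF that(1)] zero[OF that(2)] by (meson rtranclp_trans sympD)
qed

lemma nbs_in_spectrum:
  assumes "nbs_ok ns" and "nbs_adj ns a b" "nbs_adj ns b c" "nbs_adj ns c d" "nbs_adj ns d e"
    "nbs_adj ns e f" "nbs_adj ns f a" "distinct [a,b,c,d,e,f]"
  shows "length ns \<in> kg_spectrum 4 6"
proof -
  interpret girth6_quartic "{..<length ns}" "nbs_adj ns" by (rule nbs_okD(1)[OF assms(1)])
  show ?thesis using card_in_spectrum[OF _ assms(2-)] nbs_okD(2)[OF assms(1)] by simp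
qed

text \<open>
Sporadic graphs for two odd orders that are too small for the construction by insertion below,
which starts at 41.
\<close>
definition nbs35 :: "nat list list" where
  "nbs35 =
    [[1,2,3,4], [0,5,6,7], [0,8,9,10], [0,11,12,13], [0,14,15,16], [1,17,18,19], 
     [1,20,21,22], [1,23,24,25], [2,20,26,27], [2,22,23,28], [2,21,29,30], [3,27,28,29], 
     [3,20,30,31], [3,19,21,23], [4,18,23,32], [4,19,20,28], [4,17,22,25], [5,16,27,30], 
     [5,14,29,31], [5,13,15,33], [6,8,12,15], [6,10,13,34], [6,9,16,33], [7,9,13,14], 
     [7,27,31,33], [7,16,26,29], [8,25,32,34], [8,11,17,24], [9,11,15,34], [10,11,18,25], 
     [10,12,17,32], [12,18,24,34], [14,26,30,33], [19,22,24,32], [21,26,28,31]]"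

lemma spectrum_35: "35 \<in> kg_spectrum 4 6"
proof -
  have "nbs_ok nbs35" by code_simp
  then have "length nbs35 \<in> kg_spectrum 4 6"
    by (rule nbs_in_spectrum[of _ 0 1 5 17 16 4]) (simp_all add: nbs_adj_def nbs35_def)
  moreover have "length nbs35 = 35" by code_simp
  ultimately show ?thesis by simp
qed

definition nbs39 :: "nat list list" where
  "nbs39 =
    [[1,2,3,4], [0,5,6,7], [0,8,9,10], [0,11,12,13], [0,14,15,16], [1,17,18,19], 
     [1,20,21,22], [1,23,24,25], [2,19,20,26], [2,21,27,28], [2,17,22,24], [3,20,27,29], 
     [3,19,24,28], [3,22,26,30], [4,17,23,31], [4,19,21,25], [4,18,22,32], [5,10,14,33], 
     [5,16,34,35], [5,8,12,15], [6,8,11,36], [6,9,15,37], [6,10,13,16], [7,14,29,34], 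
     [7,10,12,35], [7,15,30,33], [8,13,37,38], [9,11,31,38], [9,12,32,36], [11,23,32,37], 
     [13,25,31,36], [14,27,30,35], [16,28,29,33], [17,25,32,38], [18,23,36,38], 
     [18,24,31,37], [20,28,30,34], [21,26,29,35], [26,27,33,34]]"

lemma spectrum_39: "39 \<in> kg_spectrum 4 6"
proof -
  have "nbs_ok nbs39" by code_simp
  then have "length nbs39 \<in> kg_spectrum 4 6"
    by (rule nbs_in_spectrum[of _ 0 1 5 17 10 2]) (simp_all add: nbs_adj_def nbs39_def)
  moreover have "length nbs39 = 39" by code_simp
  ultimately show ?thesis by simp
qed

section \<open>Bipartite graphs from a Golomb ruler\<close>


text \<open>
The Haar graph of \<open>{0, 1, 4, 6}\<close> over the integers modulo \<open>m\<close>: two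
copies of the residues, where \<open>i\<close> in the first copy is joined to \<open>i + s\<close>
in the second for each mark \<open>s\<close> of the ruler. Its marks have pairwise different
differences, and none of these exceeds 6; hence a square would give a sum of two differences that
vanishes modulo \<open>m\<close>, and for \<open>m \<ge> 13\<close> it would vanish in the
integers.
\<close>
definition haar :: "int \<Rightarrow> bool \<times> int \<Rightarrow> bool \<times> int \<Rightarrow> bool" where
  "haar m p q \<longleftrightarrow> snd p \<in> {0..<m} \<and> snd q \<in> {0..<m} \<and> fst p \<noteq> fst q \<and>
     (if fst p then snd p - snd q else snd q - snd p) mod m \<in> {0, 1, 4, 6}"

lemma haar_sym: "haar m p q \<Longrightarrow> haar m q p"
  by (auto simp: haar_def split: if_splits)

lemma haar_FT: "haar m (False, i) (True, j) \<longleftrightarrow> i \<in> {0..<m} \<and> j \<in> {0..<m} \<and> (j - i) mod m \<in> {0, 1, 4, 6}"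
  by (simp add: haar_def)

lemma dvd_small: "m dvd x \<Longrightarrow> \<bar>x\<bar> < m \<Longrightarrow> x = 0" for x m :: int
  using dvd_imp_le_int[of x m] by force

lemma mod_ruler:
  assumes "(x::int) mod m \<in> {0, 1, 4, 6}"
  obtains s where "s \<in> {0, 1, 4, 6}" "m dvd x - s"
  using assms by (metis mod_eq_dvd_iff mod_mod_trivial)

lemma haar_ruler:
  assumes "haar m (False, i) (True, j)"
  obtains s where "s \<in> {0, 1, 4, 6}" "m dvd j - i - s"
  using assms mod_ruler[of "j - i" m] by (auto simp: haar_def)

lemma eq_if_dvd: "m dvd i - j \<Longrightarrow> i \<in> {0..<m} \<Longrightarrow> j \<in> {0..<m} \<Longrightarrow> i = j" for i j m :: int
  using dvd_small[of m "i - j"] by auto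

lemma ruler_bounds: "s \<in> {0, 1, 4, 6::int} \<Longrightarrow> 0 \<le> s \<and> s \<le> 6"
  by auto

text \<open>The Golomb property, in the form that a closed walk of length 4 produces.\<close>
lemma ruler_sums:
  "\<forall>s1\<in>{0,1,4,6::int}. \<forall>s2\<in>{0,1,4,6}. \<forall>s3\<in>{0,1,4,6}. \<forall>s4\<in>{0,1,4,6}.
     s2 + s4 - s1 - s3 = 0 \<longrightarrow> s1 = s2 \<or> s1 = s4"
  by simp

lemma haar_no_square:
  assumes "13 \<le> m" "haar m (False, a) (True, b)" "haar m (False, c) (True, b)"
    "haar m (False, c) (True, d)" "haar m (False, a) (True, d)"
  shows "a = c \<or> b = d"
proof -
  have r: "a \<in> {0..<m}" "b \<in> {0..<m}" "c \<in> {0..<m}" "d \<in> {0..<m}" using assms by (auto simp: haar_FT)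
  obtain s1 where s1: "s1 \<in> {0,1,4,6}" "m dvd b - a - s1" by (rule haar_ruler[OF assms(2)])
  obtain s2 where s2: "s2 \<in> {0,1,4,6}" "m dvd b - c - s2" by (rule haar_ruler[OF assms(3)])
  obtain s3 where s3: "s3 \<in> {0,1,4,6}" "m dvd d - c - s3" by (rule haar_ruler[OF assms(4)])
  obtain s4 where s4: "s4 \<in> {0,1,4,6}" "m dvd d - a - s4" by (rule haar_ruler[OF assms(5)])
  note s = s1 s2 s3 s4
  have "m dvd (b - a - s1) - (b - c - s2) + (d - c - s3) - (d - a - s4)"
    by (intro dvd_diff dvd_add s)
  then have "m dvd s2 + s4 - s1 - s3" by (simp add: algebra_simps)
  moreover have "\<bar>s2 + s4 - s1 - s3\<bar> < m"
  proof -
    from assms(1) ruler_bounds[OF s1(1)] ruler_bounds[OF s2(1)] ruler_bounds[OF s3(1)] ruler_bounds[OF s4(1)]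
    show ?thesis by linarith
  qed
  ultimately have "s2 + s4 - s1 - s3 = 0" by (rule dvd_small)
  then have "s1 = s2 \<or> s1 = s4" using s1(1) s2(1) s3(1) s4(1) ruler_sums by blast
  then show ?thesis
  proof
    assume "s1 = s2"
    with dvd_diff[OF s(4) s(2)] have "m dvd a - c" by (simp add: algebra_simps)
    then show ?thesis using eq_if_dvd r by blast
  next
    assume "s1 = s4"
    with dvd_diff[OF s(2) s(8)] have "m dvd b - d" by (simp add: algebra_simps)
    then show ?thesis using eq_if_dvd r by blast
  qed
qed

lemma haar_degree:
  assumes "13 \<le> m" "snd p \<in> {0..<m}"
  shows "card {q. haar m p q} = 4"
proof -
  obtain b i where p: "p = (b, i)" by (cases p)
  define f where "f s = (\<not> b, (if b then i - s else i + s) mod m)" for s :: int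
  have m0: "0 < m" using assms by simp
  have "{q. haar m p q} = f ` {0, 1, 4, 6}"
  proof (intro set_eqI iffI)
    fix q assume "q \<in> {q. haar m p q}"
    then have h: "haar m p q" by simp
    then obtain c j where q: "q = (c, j)" "c = (\<not> b)" "j \<in> {0..<m}" by (cases q) (auto simp: haar_def p)
    have "(if b then i - j else j - i) mod m \<in> {0,1,4,6}" using h by (auto simp: haar_def p q)
    then obtain s where s: "s \<in> {0,1,4,6}" "m dvd (if b then i - j else j - i) - s" by (rule mod_ruler)
    have "j = (if b then i - s else i + s) mod m"
    proof (rule eq_if_dvd)
      have "m dvd j - (if b then i - s else i + s)"
        using s(2) by (cases b) (auto simp: algebra_simps dvd_diff_commute)
      then show "m dvd j - (if b then i - s else i + s) mod m"
        by (metis dvd_eq_mod_eq_0 mod_diff_right_eq)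
    qed (use q m0 in auto)
    then show "q \<in> f ` {0,1,4,6}" using s(1) q by (auto simp: f_def)
  next
    fix q assume "q \<in> f ` {0,1,4,6}"
    then obtain s where s: "s \<in> {0,1,4,6}" "q = f s" by blast
    have "s mod m = s" using s assms by auto
    then show "q \<in> {q. haar m p q}"
      using s assms p m0 by (auto simp: haar_def f_def mod_simps)
  qed
  moreover have "inj_on f {0,1,4,6}"
  proof (rule inj_onI)
    fix s t assume st: "s \<in> {0,1,4,6::int}" "t \<in> {0,1,4,6}" "f s = f t"
    then have "m dvd (if b then i - s else i + s) - (if b then i - t else i + t)"
      by (auto simp: f_def mod_eq_dvd_iff split: if_splits)
    then have "m dvd s - t" by (cases b) (auto simp: dvd_diff_commute)
    then show "s = t" using dvd_small[of m "s - t"] st assms by auto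
  qed
  ultimately show ?thesis by (simp add: card_image)
qed

text \<open>Odd cycles are absent because every edge changes the copy, so only squares need the ruler.\<close>
lemma haar_quartic:
  assumes "13 \<le> m"
  shows "girth6_quartic (UNIV \<times> {0..<m}) (haar m)"
proof
  show "card {q. haar m p q} = 4" if "p \<in> UNIV \<times> {0..<m}" for p using haar_degree assms that by auto
  show "a = c \<or> b = d" if h: "haar m a b" "haar m b c" "haar m c d" "haar m d a" for a b c d
  proof -
    obtain x i where a: "a = (x, i)" by (cases a)
    obtain j where b: "b = (\<not> x, j)" using h a by (cases b) (auto simp: haar_def)
    obtain k where c: "c = (x, k)" using h b by (cases c) (auto simp: haar_def)
    obtain l where d: "d = (\<not> x, l)" using h c by (cases d) (auto simp: haar_def)
    show ?thesis
      using haar_no_square[OF assms, of i j k l] haar_no_square[OF assms, of j i l k] h a b c d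
      by (cases x) (auto dest: haar_sym)
  qed
qed (auto dest: haar_sym simp: haar_def)

lemma haar_connected:
  assumes "13 \<le> m" "p \<in> UNIV \<times> {0..<m}" "q \<in> UNIV \<times> {0..<m}"
  shows "(haar m)\<^sup>*\<^sup>* p q"
proof -
  have root: "(haar m)\<^sup>*\<^sup>* (False, int i) (False, 0)" if "int i < m" for i
    using that
  proof (induction i)
    case (Suc i)
    have "haar m (False, int (Suc i)) (True, int (Suc i))" "haar m (True, int (Suc i)) (False, int i)"
      using Suc.prems assms(1) by (auto simp: haar_def)
    then show ?case using Suc by (meson converse_rtranclp_into_rtranclp less_trans lessI of_nat_less_iff)
  qed simp
  have rt: "(haar m)\<^sup>*\<^sup>* p (False, 0)" if h: "p \<in> UNIV \<times> {0..<m}" for p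
  proof -
    obtain b i where p: "p = (b, i)" "0 \<le> i" "i < m" using h by (cases p) auto
    have F: "(haar m)\<^sup>*\<^sup>* (False, i) (False, 0)" using root[of "nat i"] p by simp
    have "haar m (True, i) (False, i)" using p by (auto simp: haar_def)
    with F p show ?thesis by (cases b) (auto intro: converse_rtranclp_into_rtranclp)
  qed
  have "symp (haar m)\<^sup>*\<^sup>*" by (rule symp_rtranclp) (auto intro: sympI haar_sym)
  then show ?thesis using rt[OF assms(2)] rt[OF assms(3)] by (meson rtranclp_trans sympD)
qed

text \<open>
The hexagon alternately adds and subtracts the marks 0, 1, 4, 0, 1, 4, each of which occurs once
with either sign.
\<close>
lemma even_spectrum:
  assumes "13 \<le> (k::nat)"
  shows "2 * k \<in> kg_spectrum 4 6"
proof -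
  let ?m = "int k"
  have m: "13 \<le> ?m" using assms by simp
  interpret girth6_quartic "UNIV \<times> {0..<?m}" "haar ?m" by (rule haar_quartic[OF m])
  have "card (UNIV \<times> {0..<?m} :: (bool \<times> int) set) \<in> kg_spectrum 4 6"
  proof (rule card_in_spectrum[of "(False, 1)" "(True, 1)" "(False, 0)" "(True, 4)" "(False, 4)" "(True, 5)"])
  qed (use m in \<open>auto simp: haar_def intro: haar_connected\<close>)
  then show ?thesis by (simp add: card_cartesian_product mult.commute)
qed

section \<open>Inserting a vertex on two distant edges\<close>

text \<open>
The edges \<open>a b\<close> and \<open>c d\<close> are removed and a new vertex, here
\<open>None\<close>, is joined to their four ends. All degrees stay 4, and the order grows by one.
\<close>
definition insert_vertex :: "('a \<Rightarrow> 'a \<Rightarrow> bool) \<Rightarrow> 'a \<Rightarrow> 'a \<Rightarrow> 'a \<Rightarrow> 'a \<Rightarrow> 'a option \<Rightarrow> 'a option \<Rightarrow> bool" where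
  "insert_vertex adj a b c d x y = (case (x, y) of
     (Some u, Some v) \<Rightarrow> adj u v \<and> {u, v} \<noteq> {a, b} \<and> {u, v} \<noteq> {c, d}
   | (None, Some v) \<Rightarrow> v \<in> {a, b, c, d}
   | (Some u, None) \<Rightarrow> u \<in> {a, b, c, d}
   | (None, None) \<Rightarrow> False)"

text \<open>
A cycle through the new vertex is a path between two of the four ends, extended by two edges. Ends
of different edges are at distance at least 4 by assumption. Ends of the same edge are at distance
at least 5 once that edge is gone, because the graph had girth 6. So the new cycles have length at
least 6.
\<close>
lemma (in girth6_quartic) insert_vertex:
  assumes ab: "adj a b" and cd: "adj c d"
    and far: "\<forall>p\<in>{a, b}. \<forall>q\<in>{c, d}.
      p \<noteq> q \<and> \<not> adj p q \<and> (\<forall>x. adj p x \<longrightarrow> \<not> adj x q) \<and> (\<forall>x y. adj p x \<longrightarrow> adj x y \<longrightarrow> \<not> adj y q)"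
  shows "girth6_quartic (insert None (Some ` V)) (insert_vertex adj a b c d)" (is "girth6_quartic ?W ?adj")
    and "(\<And>x y. x \<in> V \<Longrightarrow> y \<in> V \<Longrightarrow> adj\<^sup>*\<^sup>* x y) \<Longrightarrow> u \<in> insert None (Some ` V) \<Longrightarrow>
      v \<in> insert None (Some ` V) \<Longrightarrow> (insert_vertex adj a b c d)\<^sup>*\<^sup>* u v"
proof -
  let ?T = "{a, b, c, d}"
  have S: "?adj (Some u) (Some v) \<longleftrightarrow> adj u v \<and> {u, v} \<noteq> {a, b} \<and> {u, v} \<noteq> {c, d}"
    "?adj None (Some v) \<longleftrightarrow> v \<in> ?T" "?adj (Some u) None \<longleftrightarrow> u \<in> ?T" "\<not> ?adj None None" for u v
    by (auto simp: insert_vertex_def)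
  have V: "a \<in> V" "b \<in> V" "c \<in> V" "d \<in> V" using ab cd sym adj_in by blast+
  have far1: "p \<noteq> q" and far2: "\<not> adj p q" and far3: "adj p x \<Longrightarrow> \<not> adj x q"
    and far4: "adj p x \<Longrightarrow> adj x y \<Longrightarrow> \<not> adj y q" if "p \<in> {a, b}" "q \<in> {c, d}" for p q x y
    using bspec[OF bspec[OF far that(1)] that(2)] by blast+
  have ne1: "a \<noteq> b" "c \<noteq> d" using ab cd irrefl by blast+
  have ne2: "a \<noteq> c" "a \<noteq> d" "b \<noteq> c" "b \<noteq> d" using far1 by blast+
  note ne = ne1 ne2
  have pairs: "p \<in> {a, b} \<and> q \<in> {c, d} \<or> q \<in> {a, b} \<and> p \<in> {c, d} \<or> {p, q} = {a, b} \<or> {p, q} = {c, d}"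
    if "p \<in> ?T" "q \<in> ?T" "p \<noteq> q" for p q using that by blast
  have pairs_adj: "adj p q" "adj q p" if "{p, q} = {a, b} \<or> {p, q} = {c, d}" for p q
    using that ab cd sym[OF ab] sym[OF cd] by (auto simp: doubleton_eq_iff)
  have sy: "?adj y x" if "?adj x y" for x y
    using that by (cases x; cases y) (auto simp: S insert_commute sym)
  \<comment> \<open>paths between two of the four ends have length at least 4 once the two edges are gone\<close>
  have end1: "\<not> ?adj (Some p) (Some q)" if pq: "p \<in> ?T" "q \<in> ?T" for p q
  proof (cases "p = q")
    case True then show ?thesis using irrefl by (simp add: S)
  next
    case False
    from pairs[OF pq this] show ?thesis unfolding S using far2 sym by blast
  qed
  have end2: "\<not> adj x q" if pq: "p \<in> ?T" "q \<in> ?T" "p \<noteq> q" and px: "adj p x" for p q x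
  proof
    assume xq: "adj x q"
    from pairs[OF pq] consider "p \<in> {a, b} \<and> q \<in> {c, d}" | "q \<in> {a, b} \<and> p \<in> {c, d}" | "adj p q"
      using pairs_adj by blast
    then show False
    proof cases
      case 1 then show False using far3 px xq by blast
    next
      case 2 then show False using far3 sym[OF px] sym[OF xq] by blast
    next
      case 3 then show False using no_triangle[OF px xq] sym by blast
    qed
  qed
  have end3: "\<not> adj y q" if pq: "p \<in> ?T" "q \<in> ?T" "p \<noteq> q"
    and px: "?adj (Some p) (Some x)" and xy: "adj x y" and yq': "?adj (Some y) (Some q)" for p q x y
  proof
    assume yq: "adj y q"
    have px': "adj p x" using px by (simp add: S)
    consider "p \<in> {a, b} \<and> q \<in> {c, d}" | "q \<in> {a, b} \<and> p \<in> {c, d}" | "{p, q} = {a, b} \<or> {p, q} = {c, d}"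
      using pairs[OF pq] by metis
    then show False
    proof cases
      case 1 then show False using far4 px' xy yq by blast
    next
      case 2 then show False using far4 sym[OF px'] sym[OF xy] sym[OF yq] by blast
    next
      case 3
      from no_square[OF px' xy yq pairs_adj(2)[OF 3]] have "y = p \<or> x = q" by blast
      then show False
      proof
        assume "y = p"
        then show False using yq' end1[OF pq(1,2)] by simp
      next
        assume "x = q"
        then show False using px end1[OF pq(1,2)] by simp
      qed
    qed
  qed
  show "girth6_quartic ?W ?adj"
  proof
    show "finite ?W" using finite_V by simp
    show "x \<in> ?W" if "?adj x y" for x y using that V adj_in by (cases x; cases y) (auto simp: S)
    show "?adj y x" if "?adj x y" for x y using sy that .
    show "\<not> ?adj x x" for x using irrefl by (cases x) (auto simp: S)
    show "card {y. ?adj x y} = 4" if "x \<in> ?W" for x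
    proof (cases x)
      case None
      have "?adj None y \<longleftrightarrow> y \<in> Some ` ?T" for y by (cases y) (auto simp: S)
      then have "{y. ?adj None y} = Some ` ?T" by blast
      then show ?thesis using None ne by (simp add: card_image)
    next
      case (Some u)
      then have u: "u \<in> V" using that by auto
      have fin: "finite {v. adj u v}" using degree[OF u] by (metis card.infinite zero_neq_numeral)
      have ex: "card {y. ?adj (Some u) y} = 4" if w: "adj u w" "{u, w} = {a, b} \<or> {u, w} = {c, d}" for w
      proof -
        have uT: "u \<in> ?T" using w(2) by (auto simp: doubleton_eq_iff)
        have "?adj (Some u) (Some v) \<longleftrightarrow> adj u v \<and> v \<noteq> w" for v
          using w ne unfolding S by (auto simp: doubleton_eq_iff)
        then have "?adj (Some u) y \<longleftrightarrow> y \<in> insert None (Some ` ({v. adj u v} - {w}))" for y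
          using uT by (cases y) (simp_all add: S(3) image_iff)
        then have "{y. ?adj (Some u) y} = insert None (Some ` ({v. adj u v} - {w}))" by blast
        then show ?thesis using fin w degree[OF u] by (simp add: card_image)
      qed
      show ?thesis
      proof (cases "u \<in> ?T")
        case True
        then consider "u = a" | "u = b" | "u = c" | "u = d" by blast
        then show ?thesis
        proof cases
          case 1 then show ?thesis using ex[of b] ab Some by simp
        next
          case 2 then show ?thesis using ex[of a] sym[OF ab] Some by (simp add: insert_commute)
        next
          case 3 then show ?thesis using ex[of d] cd Some by simp
        next
          case 4 then show ?thesis using ex[of c] sym[OF cd] Some by (simp add: insert_commute)
        qed
      next
        case False
        then have "?adj (Some u) y \<longleftrightarrow> y \<in> Some ` {v. adj u v}" for y
          by (cases y) (auto simp: S doubleton_eq_iff)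
        then have "{y. ?adj (Some u) y} = Some ` {v. adj u v}" by blast
        then show ?thesis using Some degree[OF u] by (simp add: card_image)
      qed
    qed
    show tri: False if xyz: "?adj x y" "?adj y z" "?adj z x" for x y z
    proof -
      have *: False if "?adj None y" "?adj y z" "?adj z None" for y z
      proof -
        obtain p where p: "y = Some p" "p \<in> ?T" using \<open>?adj None y\<close> by (cases y) (auto simp: S)
        obtain q where q: "z = Some q" "q \<in> ?T" using \<open>?adj z None\<close> by (cases z) (auto simp: S)
        show False using end1[OF p(2) q(2)] \<open>?adj y z\<close> p q by simp
      qed
      consider "x = None" | "y = None" | "z = None" | p q r where "x = Some p" "y = Some q" "z = Some r"
        by (cases x; cases y; cases z) auto
      then show False
      proof cases
        case 1 then show False using *[of y z] xyz by simp
      next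
        case 2 then show False using *[of z x] xyz by simp
      next
        case 3 then show False using *[of x y] xyz by simp
      next
        case (4 p q r) then show False using no_triangle[of p q r] xyz by (simp add: S(1))
      qed
    qed
    show "x = z \<or> y = w" if xyzw: "?adj x y" "?adj y z" "?adj z w" "?adj w x" for x y z w
    proof -
      have *: "z = None \<or> y = w" if "?adj None y" "?adj y z" "?adj z w" "?adj w None" for y z w
      proof (cases z)
        case (Some r)
        obtain p where p: "y = Some p" "p \<in> ?T" using \<open>?adj None y\<close> by (cases y) (auto simp: S)
        obtain q where q: "w = Some q" "q \<in> ?T" using \<open>?adj w None\<close> by (cases w) (auto simp: S)
        have "adj p r" "adj r q" using \<open>?adj y z\<close> \<open>?adj z w\<close> p q Some by (auto simp: S)
        then show ?thesis using end2[OF p(2) q(2)] p q by auto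
      qed simp
      consider "x = None" | "y = None" | "z = None" | "w = None"
        | p q r t where "x = Some p" "y = Some q" "z = Some r" "w = Some t"
        by (cases x; cases y; cases z; cases w) auto
      then show ?thesis
      proof cases
        case 1 then show ?thesis using *[of y z w] xyzw by auto
      next
        case 2 then show ?thesis using *[of z w x] xyzw by auto
      next
        case 3 then show ?thesis using *[of w x y] xyzw by auto
      next
        case 4 then show ?thesis using *[of x y z] xyzw by auto
      next
        case (5 p q r t) then show ?thesis using no_square[of p q r t] xyzw by (simp add: S(1))
      qed
    qed
    show False if xyz: "?adj x y" "?adj y z" "?adj z w" "?adj w v" "?adj v x" for x y z w v
    proof -
      have *: False if h: "?adj None y" "?adj y z" "?adj z w" "?adj w v" "?adj v None" for y z w v
      proof -
        obtain p where p: "y = Some p" "p \<in> ?T" using h(1) by (cases y) (auto simp: S)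
        obtain q where q: "v = Some q" "q \<in> ?T" using h(5) by (cases v) (auto simp: S)
        consider "z = None" | "w = None" | s t where "z = Some s" "w = Some t"
          by (cases z; cases w) auto
        then show False
        proof cases
          case 1
          then have "?adj w None" using sy h(3) by blast
          then obtain t where "w = Some t" "t \<in> ?T" by (cases w) (auto simp: S)
          then show False using end1[of t q] h(4) q by simp
        next
          case 2
          then have "?adj z None" using h(3) by blast
          then obtain t where "z = Some t" "t \<in> ?T" by (cases z) (auto simp: S)
          then show False using end1[of p t] h(2) p by simp
        next
          case (3 s t)
          then have st: "adj s t" "adj p s" "adj t q" using h p q by (auto simp: S(1))
          then have "p \<noteq> q" using no_triangle by blast
          then show False using end3[OF p(2) q(2), of s t] h 3 p q st by simp
        qed
      qed
      consider "x = None" | "y = None" | "z = None" | "w = None" | "v = None"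
        | p q r t u where "x = Some p" "y = Some q" "z = Some r" "w = Some t" "v = Some u"
        by (cases x; cases y; cases z; cases w; cases v) auto
      then show False
      proof cases
        case 1 then show False using *[of y z w v] xyz by simp
      next
        case 2 then show False using *[of z w v x] xyz by simp
      next
        case 3 then show False using *[of w v x y] xyz by simp
      next
        case 4 then show False using *[of v x y z] xyz by simp
      next
        case 5 then show False using *[of x y z w] xyz by simp
      next
        case (6 p q r t u) then show False using no_pentagon[of p q r t u] xyz by (simp add: S(1))
      qed
    qed
  qed
  show "?adj\<^sup>*\<^sup>* u v" if conn: "\<And>x y. x \<in> V \<Longrightarrow> y \<in> V \<Longrightarrow> adj\<^sup>*\<^sup>* x y" and uv: "u \<in> ?W" "v \<in> ?W"
  proof -
    have e: "?adj\<^sup>*\<^sup>* (Some x) (Some y)" if "adj x y" for x y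
    proof (cases "?adj (Some x) (Some y)")
      case False
      then have "?adj (Some x) None" "?adj None (Some y)" using that by (auto simp: S doubleton_eq_iff)
      then show ?thesis by (meson converse_rtranclp_into_rtranclp r_into_rtranclp)
    qed auto
    have l: "?adj\<^sup>*\<^sup>* (Some x) (Some y)" if "adj\<^sup>*\<^sup>* x y" for x y
      using that by induction (auto intro: rtranclp_trans e)
    have a: "?adj\<^sup>*\<^sup>* u (Some a) \<and> ?adj\<^sup>*\<^sup>* (Some a) u" if "u \<in> ?W" for u
    proof (cases u)
      case None then show ?thesis by (auto simp: S intro!: r_into_rtranclp)
    next
      case (Some x) then show ?thesis using that conn[of x a] conn[of a x] V l by auto
    qed
    show ?thesis using a uv by (meson rtranclp_trans)
  qed
qed

text \<open>
The edges joining \<open>0\<close> to \<open>0\<close> and \<open>7\<close> to \<open>13\<close>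
are far apart. Walks of length 2 change a residue by a difference of marks, hence by at most 6,
while the ends in the same copy differ by 7 and by 13. Walks of length 3 from the first copy to
the second change it by \<open>s1 - s2 + s3\<close>, between \<open>-6\<close> and
\<open>12\<close>, while the ends in different copies differ by 13 and by \<open>-7\<close>. All
quantities that would have to vanish modulo \<open>m\<close> lie strictly between 0 and 20, which
is where \<open>m \<ge> 20\<close> is used.
\<close>
lemma odd_spectrum:
  assumes "20 \<le> (k::nat)"
  shows "2 * k + 1 \<in> kg_spectrum 4 6"
proof -
  let ?m = "int k" and ?a = "(False, 0::int)" and ?b = "(True, 0::int)" and ?c = "(False, 7::int)" and ?d = "(True, 13::int)"
  have m: "13 \<le> ?m" "20 \<le> ?m" using assms by simp_all
  interpret h: girth6_quartic "UNIV \<times> {0..<?m}" "haar ?m" by (rule haar_quartic[OF m(1)])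
  have e: "\<exists>s. ?m dvd j - i - s \<and> 0 \<le> s \<and> s \<le> 6" if "haar ?m (False, i) (True, j) \<or> haar ?m (True, j) (False, i)" for i j
  proof -
    have "haar ?m (False, i) (True, j)" using that haar_sym by blast
    then obtain s where "s \<in> {0,1,4,6}" "?m dvd j - i - s" by (rule haar_ruler)
    then show ?thesis using ruler_bounds by blast
  qed
  have no: False if "?m dvd x" "0 < x" "x < 20" for x
    using dvd_small[OF that(1)] that m by simp
  have adj: "\<not> haar ?m ?a ?d" "\<not> haar ?m ?b ?c"
    using m by (auto simp: haar_def mod_pos_pos_trivial zmod_minus1 zmod_zminus1_eq_if)
  have two: False if h: "haar ?m p x" "haar ?m x q" "(p, q) = (?a, ?c) \<or> (p, q) = (?b, ?d)" for p q x
  proof -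
    obtain t j where x: "x = (t, j)" by (cases x)
    from h(3) show False
    proof
      assume pq: "(p, q) = (?a, ?c)"
      then have t: "t = True" using h x by (auto simp: haar_def)
      obtain s1 s2 where "?m dvd j - 0 - s1" "?m dvd j - 7 - s2" "0 \<le> s1" "s1 \<le> 6" "0 \<le> s2" "s2 \<le> 6"
        using e[of 0 j] e[of 7 j] h(1,2) x t pq by blast
      then show False using no[of "7 + s2 - s1"] dvd_diff[of ?m "j - 0 - s1" "j - 7 - s2"] by (simp add: algebra_simps)
    next
      assume pq: "(p, q) = (?b, ?d)"
      then have t: "t = False" using h x by (auto simp: haar_def)
      obtain s1 s2 where "?m dvd 0 - j - s1" "?m dvd 13 - j - s2" "0 \<le> s1" "s1 \<le> 6" "0 \<le> s2" "s2 \<le> 6"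
        using e[of j 0] e[of j 13] h(1,2) x t pq by blast
      then show False using no[of "13 + s1 - s2"] dvd_diff[of ?m "13 - j - s2" "0 - j - s1"] by (simp add: algebra_simps)
    qed
  qed
  have three: False if h: "haar ?m p x" "haar ?m x y" "haar ?m y q" "(p, q) = (?a, ?d) \<or> (p, q) = (?b, ?c)" for p q x y
  proof -
    obtain t j u l where xy: "x = (t, j)" "y = (u, l)" by (cases x; cases y)
    from h(4) show False
    proof
      assume pq: "(p, q) = (?a, ?d)"
      then have t: "t = True" "u = False" using h xy by (auto simp: haar_def)
      obtain s1 s2 s3 where s: "?m dvd j - 0 - s1" "?m dvd j - l - s2" "?m dvd 13 - l - s3"
        "0 \<le> s1" "s1 \<le> 6" "0 \<le> s2" "s2 \<le> 6" "0 \<le> s3" "s3 \<le> 6"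
        using e[of 0 j] e[of l j] e[of l 13] h(1-3) xy t pq by blast
      have "?m dvd (13 - l - s3) + (j - 0 - s1) - (j - l - s2)" by (intro dvd_diff dvd_add s)
      then show False using no[of "13 + s2 - s1 - s3"] s by (simp add: algebra_simps)
    next
      assume pq: "(p, q) = (?b, ?c)"
      then have t: "t = False" "u = True" using h xy by (auto simp: haar_def)
      obtain s1 s2 s3 where s: "?m dvd 0 - j - s1" "?m dvd l - j - s2" "?m dvd l - 7 - s3"
        "0 \<le> s1" "s1 \<le> 6" "0 \<le> s2" "s2 \<le> 6" "0 \<le> s3" "s3 \<le> 6"
        using e[of j 0] e[of j l] e[of 7 l] h(1-3) xy t pq by blast
      have "?m dvd (l - j - s2) - (0 - j - s1) - (l - 7 - s3)" by (intro dvd_diff s)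
      then show False using no[of "7 + s1 + s3 - s2"] s by (simp add: algebra_simps)
    qed
  qed
  have par: "fst q \<noteq> fst p" if "haar ?m p q" for p q using that by (auto simp: haar_def)
  have far: "\<forall>p\<in>{?a, ?b}. \<forall>q\<in>{?c, ?d}. p \<noteq> q \<and> \<not> haar ?m p q \<and> (\<forall>x. haar ?m p x \<longrightarrow> \<not> haar ?m x q) \<and>
      (\<forall>x y. haar ?m p x \<longrightarrow> haar ?m x y \<longrightarrow> \<not> haar ?m y q)" 
  proof (intro ballI)
    fix p q assume pq: "p \<in> {?a, ?b}" "q \<in> {?c, ?d}"
    consider "fst p = fst q" "(p, q) = (?a, ?c) \<or> (p, q) = (?b, ?d)"
      | "fst p \<noteq> fst q" "(p, q) = (?a, ?d) \<or> (p, q) = (?b, ?c)" using pq by auto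
    then show "p \<noteq> q \<and> \<not> haar ?m p q \<and> (\<forall>x. haar ?m p x \<longrightarrow> \<not> haar ?m x q) \<and>
      (\<forall>x y. haar ?m p x \<longrightarrow> haar ?m x y \<longrightarrow> \<not> haar ?m y q)"
    proof cases
      case 1 then show ?thesis using two par by (metis prod.inject zero_neq_numeral)
    next
      case 2 then show ?thesis using three adj par by (metis prod.inject)
    qed
  qed
  have ed: "haar ?m ?a ?b" "haar ?m ?c ?d" using m by (auto simp: haar_def)
  note ins = h.insert_vertex[OF ed far]
  let ?W = "insert None (Some ` (UNIV \<times> {0..<?m})) :: (bool \<times> int) option set"
  interpret o: girth6_quartic ?W "insert_vertex (haar ?m) ?a ?b ?c ?d" by (rule ins(1))
  have "card ?W \<in> kg_spectrum 4 6"
  proof (rule o.card_in_spectrum[of "Some (False, 1)" "Some (True, 1)" "Some (False, 0)" "Some (True, 4)" "Some (False, 4)" "Some (True, 5)"])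
    show "(insert_vertex (haar ?m) ?a ?b ?c ?d)\<^sup>*\<^sup>* u v" if "u \<in> ?W" "v \<in> ?W" for u v
      by (rule ins(2)[OF haar_connected[OF m(1)] that])
  qed (use m in \<open>auto simp: insert_vertex_def haar_def doubleton_eq_iff\<close>)
  moreover have "card ?W = 2 * k + 1" by (simp add: card_image card_cartesian_product)
  ultimately show ?thesis by simp
qed

section \<open>A proof system for the impossibility of completing a partial graph\<close>


text \<open>
Everything in this section is evaluated by rewriting. Vertices are therefore pairs of digits to
base six and the state is a table indexed by them: comparison and lookup become pattern matching,
with no arithmetic. A table has room for 36 vertices, and \<open>Hidden\<close> marks the numbers
that are not vertices. For the others the state records the neighbours found so far and the
vertices already known not to be adjacent.
\<close>
datatype digit = D0 | D1 | D2 | D3 | D4 | D5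
datatype vtx = Vtx digit digit
datatype 'a six = Six 'a 'a 'a 'a 'a 'a
datatype entry = Hidden | Entry (nbrs: "vtx list") (bars: "vtx list")
  where "nbrs Hidden = []" | "bars Hidden = []"
type_synonym state = "entry six six"

fun nth6 :: "digit \<Rightarrow> 'a six \<Rightarrow> 'a" where
  "nth6 D0 (Six a b c d e f) = a" | "nth6 D1 (Six a b c d e f) = b" | "nth6 D2 (Six a b c d e f) = c"
| "nth6 D3 (Six a b c d e f) = d" | "nth6 D4 (Six a b c d e f) = e" | "nth6 D5 (Six a b c d e f) = f"

fun upd6 :: "digit \<Rightarrow> 'a \<Rightarrow> 'a six \<Rightarrow> 'a six" where
  "upd6 D0 x (Six a b c d e f) = Six x b c d e f" | "upd6 D1 x (Six a b c d e f) = Six a x c d e f"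
| "upd6 D2 x (Six a b c d e f) = Six a b x d e f" | "upd6 D3 x (Six a b c d e f) = Six a b c x e f"
| "upd6 D4 x (Six a b c d e f) = Six a b c d x f" | "upd6 D5 x (Six a b c d e f) = Six a b c d e x"

fun get :: "vtx \<Rightarrow> state \<Rightarrow> entry" where
  "get (Vtx i j) s = nth6 j (nth6 i s)"

fun put :: "vtx \<Rightarrow> entry \<Rightarrow> state \<Rightarrow> state" where
  "put (Vtx i j) x s = upd6 i (upd6 j x (nth6 i s)) s"

fun add_nbr :: "vtx \<Rightarrow> entry \<Rightarrow> entry" where
  "add_nbr b Hidden = Hidden"
| "add_nbr b (Entry as fs) = Entry (if b \<in> set as then as else b # as) fs"

fun add_bar :: "vtx \<Rightarrow> entry \<Rightarrow> entry" where
  "add_bar b Hidden = Hidden"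
| "add_bar b (Entry as fs) = Entry as (b # fs)"

definition arc :: "vtx \<Rightarrow> vtx \<Rightarrow> state \<Rightarrow> state" where
  "arc a b s = put a (add_nbr b (get a s)) s"
definition bar_arc :: "vtx \<Rightarrow> vtx \<Rightarrow> state \<Rightarrow> state" where
  "bar_arc a b s = put a (add_bar b (get a s)) s"
definition link :: "vtx \<Rightarrow> vtx \<Rightarrow> state \<Rightarrow> state" where
  "link a b s = arc b a (arc a b s)"
definition forbid :: "vtx \<Rightarrow> vtx \<Rightarrow> state \<Rightarrow> state" where
  "forbid a b s = bar_arc b a (bar_arc a b s)"

fun link_all :: "vtx \<Rightarrow> vtx list \<Rightarrow> state \<Rightarrow> state" where
  "link_all w [] s = s"
| "link_all w (c # cs) s = link_all w cs (link w c s)"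

text \<open>
Breadth-first search by erasure. A visited vertex is replaced by \<open>Hidden\<close>, so what
remains of the table after four rounds is the complement of a ball of radius 4, and no set of
visited vertices is carried along. The second component is the queue, a list of neighbour lists.
\<close>
datatype search = Search state "vtx list list"

fun visit' :: "vtx \<Rightarrow> entry \<Rightarrow> state \<Rightarrow> vtx list list \<Rightarrow> search" where
  "visit' v Hidden s q = Search s q"
| "visit' v (Entry as fs) s q = Search (put v Hidden s) (as # q)"
fun visit :: "vtx \<Rightarrow> search \<Rightarrow> search" where
  "visit v (Search s q) = visit' v (get v s) s q"
fun visits :: "vtx list \<Rightarrow> search \<Rightarrow> search" where
  "visits [] b = b"
| "visits (v # vs) b = visits vs (visit v b)"
fun layer :: "vtx list list \<Rightarrow> search \<Rightarrow> search" where
  "layer [] b = b"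
| "layer (vs # q) b = layer q (visits vs b)"
fun grow :: "search \<Rightarrow> search" where
  "grow (Search s q) = layer q (Search s [])"
fun search_state :: "search \<Rightarrow> state" where
  "search_state (Search s q) = s"

definition hide_ball :: "vtx \<Rightarrow> state \<Rightarrow> state" where
  "hide_ball w s = search_state (grow (grow (grow (grow (visit w (Search s []))))))"

fun hide :: "vtx list \<Rightarrow> state \<Rightarrow> state" where
  "hide [] s = s"
| "hide (v # vs) s = hide vs (put v Hidden s)"

fun collect' :: "vtx \<Rightarrow> vtx list \<Rightarrow> vtx list \<Rightarrow> vtx list" where
  "collect' v (a # b # c # d # as) vs = vs"
| "collect' v as vs = v # vs"
fun collect :: "vtx \<Rightarrow> entry \<Rightarrow> vtx list \<Rightarrow> vtx list" where
  "collect v Hidden vs = vs"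
| "collect v (Entry as fs) vs = collect' v as vs"
fun open_row :: "digit \<Rightarrow> entry six \<Rightarrow> vtx list \<Rightarrow> vtx list" where
  "open_row i (Six a b c d e f) vs = collect (Vtx i D0) a (collect (Vtx i D1) b (collect (Vtx i D2) c
     (collect (Vtx i D3) d (collect (Vtx i D4) e (collect (Vtx i D5) f vs)))))"
fun open_vertices :: "state \<Rightarrow> vtx list" where
  "open_vertices (Six a b c d e f) =
     open_row D0 a (open_row D1 b (open_row D2 c (open_row D3 d (open_row D4 e (open_row D5 f [])))))"

text \<open>
The deduction rule. A further neighbour of \<open>w\<close> must be a vertex that has fewer than
four known neighbours, is not barred, and has distance at least 5 from \<open>w\<close> in the
known part: otherwise a cycle shorter than 6 would close. Fewer than four known and possible
neighbours together are a contradiction, and exactly four must all be neighbours.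
\<close>
datatype verdict = Closed | Forced state | Unclear

fun decide' :: "vtx \<Rightarrow> vtx list \<Rightarrow> state \<Rightarrow> vtx list \<Rightarrow> verdict" where
  "decide' w cs s [a, b, c, d] = Forced (link_all w cs s)"
| "decide' w cs s (a # b # c # d # e # xs) = Unclear"
| "decide' w cs s xs = Closed"
definition decide :: "vtx \<Rightarrow> vtx list \<Rightarrow> state \<Rightarrow> vtx list \<Rightarrow> verdict" where
  "decide w as s cs = decide' w cs s (as @ cs)"
fun step' :: "vtx \<Rightarrow> state \<Rightarrow> entry \<Rightarrow> verdict" where
  "step' w s Hidden = Unclear"
| "step' w s (Entry as fs) = decide w as s (open_vertices (hide fs (hide_ball w s)))"
definition step :: "vtx \<Rightarrow> state \<Rightarrow> verdict" where
  "step w s = step' w s (get w s)"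

text \<open>
Permutations are written as products of transpositions, so bijectivity needs no check. An
automorphism of the state is tested only at the vertices that it moves: by symmetry of the state,
this also covers their entries at the fixed vertices.
\<close>
definition swap :: "vtx \<Rightarrow> vtx \<Rightarrow> vtx \<Rightarrow> vtx" where
  "swap a b v = (if v = a then b else if v = b then a else v)"
fun perm :: "(vtx \<times> vtx) list \<Rightarrow> vtx \<Rightarrow> vtx" where
  "perm [] v = v"
| "perm ((a, b) # p) v = perm p (swap a b v)"
fun maps_into :: "(vtx \<times> vtx) list \<Rightarrow> vtx list \<Rightarrow> vtx list \<Rightarrow> bool" where
  "maps_into p [] ws \<longleftrightarrow> True"
| "maps_into p (v # vs) ws \<longleftrightarrow> perm p v \<in> set ws \<and> maps_into p vs ws"
fun entry_maps :: "(vtx \<times> vtx) list \<Rightarrow> entry \<Rightarrow> entry \<Rightarrow> bool" where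
  "entry_maps p (Entry as fs) (Entry as' fs') \<longleftrightarrow> maps_into p as as' \<and> maps_into p fs fs'"
| "entry_maps p _ _ \<longleftrightarrow> False"
definition vertex_maps :: "(vtx \<times> vtx) list \<Rightarrow> state \<Rightarrow> vtx \<Rightarrow> bool" where
  "vertex_maps p s v \<longleftrightarrow> entry_maps p (get v s) (get (perm p v) s)"
fun automorphism :: "(vtx \<times> vtx) list \<Rightarrow> state \<Rightarrow> (vtx \<times> vtx) list \<Rightarrow> bool" where
  "automorphism p s [] \<longleftrightarrow> True"
| "automorphism p s ((a, b) # q) \<longleftrightarrow> vertex_maps p s a \<and> vertex_maps p s b \<and> automorphism p s q"

text \<open>
A certificate is a list of commands for a stack of states that are to be refuted. \<open>Step
w\<close> applies the deduction rule at \<open>w\<close>. \<open>Branch w c ps\<close>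
distinguishes whether some completion contains the edge \<open>w c\<close>. If none does, none
contains an image of it under the automorphisms \<open>ps\<close> of the state either, because a
completion can be pulled back along an automorphism. So the second branch may forbid the whole
orbit.
\<close>
datatype cmd = Step vtx | Branch vtx vtx "(vtx \<times> vtx) list list"

fun forbid_images :: "vtx \<Rightarrow> vtx \<Rightarrow> state \<Rightarrow> (vtx \<times> vtx) list list \<Rightarrow> state \<Rightarrow> state option" where
  "forbid_images w c s [] t = Some t"
| "forbid_images w c s (p # ps) t = (if automorphism p s p
     then forbid_images w c s ps (forbid (perm p w) (perm p c) t) else None)"
fun push :: "state option \<Rightarrow> state \<Rightarrow> state list \<Rightarrow> state list option" where
  "push None t ss = None"
| "push (Some s) t ss = Some (t # s # ss)"
fun after :: "verdict \<Rightarrow> state list \<Rightarrow> state list option" where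
  "after Closed ss = Some ss"
| "after (Forced s) ss = Some (s # ss)"
| "after Unclear ss = None"
fun exec :: "cmd \<Rightarrow> state \<Rightarrow> state list \<Rightarrow> state list option" where
  "exec (Step w) s ss = after (step w s) ss"
| "exec (Branch w c ps) s ss = push (forbid_images w c s ps (forbid w c s)) (link w c s) ss"
fun run and run' where
  "run cs [] \<longleftrightarrow> True"
| "run [] (s # ss) \<longleftrightarrow> False"
| "run (c # cs) (s # ss) \<longleftrightarrow> run' cs (exec c s ss)"
| "run' cs None \<longleftrightarrow> False"
| "run' cs (Some ss) \<longleftrightarrow> run cs ss"

datatype token = Vx vtx | Eq | Tilde | Dot | Semi

text \<open>
Certificates are strings. A vertex is one of the 36 characters \<open>0..9a..z\<close>; on its own
it means a deduction step. A branch on \<open>w c\<close> is written \<open>=wc\<close>, or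
\<open>~wc\<close> followed by automorphisms, each ended by a dot, and a semicolon. An
automorphism is a sequence of transpositions \<open>ab\<close>, of which the last is applied
first.
\<close>
fun parse :: "token list \<Rightarrow> cmd list" and parse_perms where
  "parse [] = []"
| "parse (Vx w # ts) = Step w # parse ts"
| "parse (Eq # Vx w # Vx c # ts) = Branch w c [] # parse ts"
| "parse (Tilde # Vx w # Vx c # ts) = parse_perms w c [] [] ts"
| "parse _ = []"
| "parse_perms w c ps p (Semi # ts) = Branch w c ps # parse ts"
| "parse_perms w c ps p (Dot # ts) = parse_perms w c (p # ps) [] ts"
| "parse_perms w c ps p (Vx a # Vx b # ts) = parse_perms w c ps ((a, b) # p) ts"
| "parse_perms w c ps p _ = []"

definition vertices :: "vtx list" where
  "vertices = concat (map (\<lambda>i. map (Vtx i) [D0, D1, D2, D3, D4, D5]) [D0, D1, D2, D3, D4, D5])"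

definition token :: "char \<Rightarrow> token" where
  "token x = the (map_of (zip ''=~.;0123456789abcdefghijklmnopqrstuvwxyz''
     (Eq # Tilde # Dot # Semi # map Vx vertices)) x)"
text \<open>Evaluation by table, which avoids the linear search of the definition.\<close>
lemma token_code [code]:
  "token (CHR ''0'') = Vx (Vtx D0 D0)"
  "token (CHR ''1'') = Vx (Vtx D0 D1)"
  "token (CHR ''2'') = Vx (Vtx D0 D2)"
  "token (CHR ''3'') = Vx (Vtx D0 D3)"
  "token (CHR ''4'') = Vx (Vtx D0 D4)"
  "token (CHR ''5'') = Vx (Vtx D0 D5)"
  "token (CHR ''6'') = Vx (Vtx D1 D0)"
  "token (CHR ''7'') = Vx (Vtx D1 D1)"
  "token (CHR ''8'') = Vx (Vtx D1 D2)"
  "token (CHR ''9'') = Vx (Vtx D1 D3)"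
  "token (CHR ''a'') = Vx (Vtx D1 D4)"
  "token (CHR ''b'') = Vx (Vtx D1 D5)"
  "token (CHR ''c'') = Vx (Vtx D2 D0)"
  "token (CHR ''d'') = Vx (Vtx D2 D1)"
  "token (CHR ''e'') = Vx (Vtx D2 D2)"
  "token (CHR ''f'') = Vx (Vtx D2 D3)"
  "token (CHR ''g'') = Vx (Vtx D2 D4)"
  "token (CHR ''h'') = Vx (Vtx D2 D5)"
  "token (CHR ''i'') = Vx (Vtx D3 D0)"
  "token (CHR ''j'') = Vx (Vtx D3 D1)"
  "token (CHR ''k'') = Vx (Vtx D3 D2)"
  "token (CHR ''l'') = Vx (Vtx D3 D3)"
  "token (CHR ''m'') = Vx (Vtx D3 D4)"
  "token (CHR ''n'') = Vx (Vtx D3 D5)"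
  "token (CHR ''o'') = Vx (Vtx D4 D0)"
  "token (CHR ''p'') = Vx (Vtx D4 D1)"
  "token (CHR ''q'') = Vx (Vtx D4 D2)"
  "token (CHR ''r'') = Vx (Vtx D4 D3)"
  "token (CHR ''s'') = Vx (Vtx D4 D4)"
  "token (CHR ''t'') = Vx (Vtx D4 D5)"
  "token (CHR ''u'') = Vx (Vtx D5 D0)"
  "token (CHR ''v'') = Vx (Vtx D5 D1)"
  "token (CHR ''w'') = Vx (Vtx D5 D2)"
  "token (CHR ''x'') = Vx (Vtx D5 D3)"
  "token (CHR ''y'') = Vx (Vtx D5 D4)"
  "token (CHR ''z'') = Vx (Vtx D5 D5)"
  "token (CHR ''='') = Eq"
  "token (CHR ''~'') = Tilde"
  "token (CHR ''.'') = Dot"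
  "token (CHR '';'') = Semi"
  by (simp_all add: token_def vertices_def del: One_nat_def)

definition commands :: "char list \<Rightarrow> cmd list" where
  "commands xs = parse (map token xs)"

definition blank :: "nat \<Rightarrow> state" where
  "blank n = (let e = (\<lambda>k. if k < n then Entry [] [] else Hidden);
      r = (\<lambda>k. Six (e k) (e (k+1)) (e (k+2)) (e (k+3)) (e (k+4)) (e (k+5)))
    in Six (r 0) (r 6) (r 12) (r 18) (r 24) (r 30))"
fun link_pairs :: "(nat \<times> nat) list \<Rightarrow> state \<Rightarrow> state" where
  "link_pairs [] s = s"
| "link_pairs ((a, b) # es) s = link_pairs es (link (vertices ! a) (vertices ! b) s)"
fun forbid_pairs :: "(nat \<times> nat) list \<Rightarrow> state \<Rightarrow> state" where
  "forbid_pairs [] s = s"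
| "forbid_pairs ((a, b) # es) s = forbid_pairs es (forbid (vertices ! a) (vertices ! b) s)"

definition refutes :: "char list \<Rightarrow> nat \<Rightarrow> (nat \<times> nat) list \<Rightarrow> (nat \<times> nat) list \<Rightarrow> bool" where
  "refutes xs n es fs \<longleftrightarrow> run (commands xs) [forbid_pairs fs (link_pairs es (blank n))]"

text \<open>
The labelling of a neighbourhood of a \<open>g\<close>-cycle: vertex \<open>i < g\<close> is on
the cycle, and its two further neighbours are \<open>g + 2 * i\<close> and \<open>g + 2 * i +
1\<close>.
\<close>
definition frame :: "nat \<Rightarrow> (nat \<times> nat) list" where
  "frame g = concat (map (\<lambda>i. [(i, if Suc i = g then 0 else Suc i), (i, g + 2 * i), (i, g + 2 * i + 1)]) [0..<g])"
text \<open>All pairs of further neighbours whose cycle vertices are \<open>d\<close> apart.\<close>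
definition bars_at :: "nat \<Rightarrow> nat \<Rightarrow> (nat \<times> nat) list" where
  "bars_at g d = concat (map (\<lambda>i. let j = (if i + d < g then i + d else i + d - g) in
     [(g + 2 * i, g + 2 * j), (g + 2 * i, g + 2 * j + 1), (g + 2 * i + 1, g + 2 * j), (g + 2 * i + 1, g + 2 * j + 1)]) [0..<g])"
text \<open>
The extremal configuration around a 7-cycle in a graph of order 33. Labels 7 to 20 are the further
neighbours of the cycle, and the three pairs among them are the only edges that they span. Labels
21 to 32 are the vertices at greater distance; they span the perfect matching 21 22, ..., 31 32.
Vertices 15 and 16, at cycle vertex 4, are not on any of the three edges, so each of them has
three neighbours among the last twelve. The odd labels 21 to 31 are those six neighbours; they lie
in different pairs of the matching.
\<close>
definition tight_edges :: "(nat \<times> nat) list" where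
  "tight_edges = [(7,13),(11,19),(9,17),(21,22),(23,24),(25,26),(27,28),(29,30),(31,32),
     (15,21),(15,23),(15,25),(16,27),(16,29),(16,31)]"
definition tight_bars :: "(nat \<times> nat) list" where
  "tight_bars = filter (\<lambda>p. p \<notin> set tight_edges)
     (concat (map (\<lambda>a. map (Pair a) [a+1..<21]) [7..<21] @ map (\<lambda>a. map (Pair a) [a+1..<33]) [21..<33]))"

section \<open>Soundness of the proof system\<close>


lemma (in girth6_quartic) pullback:
  assumes "bij_betw f W V"
  shows "girth6_quartic W (\<lambda>a b. a \<in> W \<and> b \<in> W \<and> adj (f a) (f b))"
proof
  have inj: "inj_on f W" and img: "f ` W = V" using assms by (auto simp: bij_betw_def)
  show "finite W" using assms finite_V bij_betw_finite by blast
  show "card {b. a \<in> W \<and> b \<in> W \<and> adj (f a) (f b)} = 4" if a: "a \<in> W" for a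
  proof -
    have img2: "f ` {b. a \<in> W \<and> b \<in> W \<and> adj (f a) (f b)} = {y. adj (f a) y}"
    proof (intro set_eqI iffI)
      fix y assume "y \<in> {y. adj (f a) y}"
      then have y: "adj (f a) y" by simp
      then have "y \<in> f ` W" using adj_in[OF sym[OF y]] img by simp
      then show "y \<in> f ` {b. a \<in> W \<and> b \<in> W \<and> adj (f a) (f b)}" using a y by blast
    qed auto
    have "inj_on f {b. a \<in> W \<and> b \<in> W \<and> adj (f a) (f b)}"
      by (rule inj_on_subset[OF inj]) auto
    from card_image[OF this] have "card {b. a \<in> W \<and> b \<in> W \<and> adj (f a) (f b)} = card {y. adj (f a) y}"
      unfolding img2 by simp
    moreover have "f a \<in> V" using a img by blast
    ultimately show ?thesis using degree by simp
  qed
  show "a = c \<or> b = d"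
    if "a \<in> W \<and> b \<in> W \<and> adj (f a) (f b)" "b \<in> W \<and> c \<in> W \<and> adj (f b) (f c)"
      "c \<in> W \<and> d \<in> W \<and> adj (f c) (f d)" "d \<in> W \<and> a \<in> W \<and> adj (f d) (f a)" for a b c d
    using no_square[of "f a" "f b" "f c" "f d"] that inj by (simp add: inj_on_eq_iff)
qed (use sym irrefl no_triangle no_pentagon in blast)+

lemma nth6_upd6: "nth6 i (upd6 j x s) = (if i = j then x else nth6 i s)"
  by (cases i; cases j; cases s) auto

lemma get_put: "get v (put w x s) = (if v = w then x else get v s)"
  by (cases v; cases w) (auto simp: nth6_upd6)

text \<open>
Symmetry of the two relations in the state, demanded only where the partner is visible, because
updates ignore hidden vertices.
\<close>
definition coherent :: "state \<Rightarrow> bool" where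
  "coherent s \<longleftrightarrow> (\<forall>a b. get b s \<noteq> Hidden \<longrightarrow>
       (b \<in> set (nbrs (get a s)) \<longrightarrow> a \<in> set (nbrs (get b s))) \<and>
       (b \<in> set (bars (get a s)) \<longrightarrow> a \<in> set (bars (get b s))))
     \<and> (\<forall>a. distinct (nbrs (get a s)))"

text \<open>
The relation \<open>R\<close> is a quartic graph of girth at least 6 on the visible vertices that
agrees with everything recorded in the state. Refuting a state means that no such \<open>R\<close>
exists.
\<close>
definition completes :: "(vtx \<Rightarrow> vtx \<Rightarrow> bool) \<Rightarrow> state \<Rightarrow> bool" where
  "completes R s \<longleftrightarrow> girth6_quartic {v. get v s \<noteq> Hidden} R
     \<and> (\<forall>a. \<forall>b\<in>set (nbrs (get a s)). R a b) \<and> (\<forall>a. \<forall>b\<in>set (bars (get a s)). \<not> R a b)"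

lemma entry_simps:
  "set (nbrs (add_nbr b e)) = (if e = Hidden then {} else insert b (set (nbrs e)))"
  "bars (add_nbr b e) = bars e" "add_nbr b e = Hidden \<longleftrightarrow> e = Hidden"
  "distinct (nbrs e) \<Longrightarrow> distinct (nbrs (add_nbr b e))"
  "set (bars (add_bar b e)) = (if e = Hidden then {} else insert b (set (bars e)))"
  "nbrs (add_bar b e) = nbrs e" "add_bar b e = Hidden \<longleftrightarrow> e = Hidden"
  by (cases e; auto)+

lemma link_simps:
  "x \<in> set (nbrs (get v (link a b s))) \<longleftrightarrow>
     x \<in> set (nbrs (get v s)) \<or> get v s \<noteq> Hidden \<and> (v = a \<and> x = b \<or> v = b \<and> x = a)"
  "bars (get v (link a b s)) = bars (get v s)"
  "get v (link a b s) = Hidden \<longleftrightarrow> get v s = Hidden"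
  "distinct (nbrs (get v s)) \<Longrightarrow> distinct (nbrs (get v (link a b s)))"
  by (auto simp: link_def arc_def get_put entry_simps)

lemma forbid_simps:
  "x \<in> set (bars (get v (forbid a b s))) \<longleftrightarrow>
     x \<in> set (bars (get v s)) \<or> get v s \<noteq> Hidden \<and> (v = a \<and> x = b \<or> v = b \<and> x = a)"
  "nbrs (get v (forbid a b s)) = nbrs (get v s)"
  "get v (forbid a b s) = Hidden \<longleftrightarrow> get v s = Hidden"
  by (auto simp: forbid_def bar_arc_def get_put entry_simps)

lemma coherent_link: "coherent s \<Longrightarrow> coherent (link a b s)"
  unfolding coherent_def link_simps(1-3) using link_simps(4) by auto

lemma coherent_forbid: "coherent s \<Longrightarrow> coherent (forbid a b s)"
  unfolding coherent_def forbid_simps by auto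

lemma completes_sym: "completes R s \<Longrightarrow> R a b \<Longrightarrow> R b a"
  unfolding completes_def girth6_quartic_def by blast

lemma completes_link: "completes R s \<Longrightarrow> R a b \<Longrightarrow> completes R (link a b s)"
  using completes_sym[of R s a b] unfolding completes_def Ball_def link_simps by blast

lemma completes_forbid: "completes R s \<Longrightarrow> \<not> R a b \<Longrightarrow> completes R (forbid a b s)"
  using completes_sym[of R s b a] unfolding completes_def Ball_def forbid_simps by blast

lemma link_all:
  "coherent s \<Longrightarrow> coherent (link_all w cs s)"
  "completes R s \<Longrightarrow> \<forall>c\<in>set cs. R w c \<Longrightarrow> completes R (link_all w cs s)"
  by (induction cs arbitrary: s) (auto simp: coherent_link completes_link)

definition known :: "state \<Rightarrow> (vtx \<times> vtx) set" where
  "known s = {(a, b). b \<in> set (nbrs (get a s))}"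

fun ball :: "state \<Rightarrow> vtx \<Rightarrow> nat \<Rightarrow> vtx set" where
  "ball s w 0 = {w}"
| "ball s w (Suc k) = ball s w k \<union> (\<Union>v\<in>ball s w k. set (nbrs (get v s)))"

lemma ball_walk: "y \<in> ball s w k \<Longrightarrow> \<exists>j\<le>k. (w, y) \<in> known s ^^ j"
proof (induction k arbitrary: y)
  case (Suc k)
  show ?case
  proof (cases "y \<in> ball s w k")
    case True then show ?thesis using Suc.IH le_Suc_eq by blast
  next
    case False
    then obtain v where v: "v \<in> ball s w k" "y \<in> set (nbrs (get v s))" using Suc.prems by auto
    then obtain j where "j \<le> k" "(w, v) \<in> known s ^^ j" using Suc.IH by blast
    moreover have "(v, y) \<in> known s" using v by (simp add: known_def)
    ultimately have "(w, y) \<in> known s ^^ Suc j" "Suc j \<le> Suc k" by (auto intro: relpow_Suc_I)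
    then show ?thesis by blast
  qed
qed auto

text \<open>
A walk of length at most 4 in the known part from \<open>w\<close> to an actual neighbour of
\<open>w\<close> would close a short cycle, unless it runs along the edge itself, which is then
known.
\<close>
lemma ball_nbr:
  assumes c: "completes R s" and y: "y \<in> ball s w 4" and wy: "R w y"
  shows "y \<in> set (nbrs (get w s))"
proof -
  interpret girth6_quartic "{v. get v s \<noteq> Hidden}" R using c by (simp add: completes_def)
  have k: "R a b" if "(a, b) \<in> known s" for a b using c that by (auto simp: completes_def known_def)
  have yw: "R y w" using sym[OF wy] .
  obtain j where j: "j \<le> 4" "(w, y) \<in> known s ^^ j" using ball_walk[OF y] by blast
  from j(1) consider "j = 0" | "j = 1" | "j = 2" | "j = 3" | "j = 4" by linarith
  then have "(w, y) \<in> known s"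
  proof cases
    case 1 then show ?thesis using j irrefl wy by auto
  next
    case 2 then show ?thesis using j by simp
  next
    case 3
    then obtain a where "(w, a) \<in> known s" "(a, y) \<in> known s"
      using j by (auto simp: eval_nat_numeral relcomp_unfold)
    then show ?thesis using no_triangle[OF k k yw] by blast
  next
    case 4
    then obtain a b where e: "(w, a) \<in> known s" "(a, b) \<in> known s" "(b, y) \<in> known s"
      using j by (auto simp: eval_nat_numeral relcomp_unfold)
    then have "w = b \<or> a = y" using no_square[OF k k k yw] by blast
    then show ?thesis using e by auto
  next
    case 5
    then obtain a b d where "(w, a) \<in> known s" "(a, b) \<in> known s" "(b, d) \<in> known s" "(d, y) \<in> known s"
      using j by (auto simp: eval_nat_numeral relcomp_unfold)
    then show ?thesis using no_pentagon[OF k k k k yw] by blast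
  qed
  then show ?thesis by (simp add: known_def)
qed

text \<open>
Invariant of the search by erasure: only vertices of \<open>H\<close> have been hidden, and the
queue contains only vertices of \<open>Q\<close>. Nothing is claimed about how much of the ball is
erased, since keeping a vertex can only weaken the deductions.
\<close>
fun confined :: "state \<Rightarrow> vtx set \<Rightarrow> vtx set \<Rightarrow> search \<Rightarrow> bool" where
  "confined s H Q (Search t q) \<longleftrightarrow>
     (\<forall>v. get v t = get v s \<or> get v t = Hidden \<and> v \<in> H) \<and> (\<forall>vs\<in>set q. set vs \<subseteq> Q)"

lemma confined_visit:
  assumes "confined s H Q b" "v \<in> H" "set (nbrs (get v s)) \<subseteq> Q"
  shows "confined s H Q (visit v b)"
proof (cases b)
  case (Search t q)
  show ?thesis
  proof (cases "get v t")
    case Hidden then show ?thesis using assms Search by simp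
  next
    case (Entry as fs)
    then have "get v s = Entry as fs" using assms(1) Search by (metis entry.distinct(1) confined.simps)
    then show ?thesis using assms Search Entry by (auto simp: get_put)
  qed
qed

lemma confined_visits:
  "confined s H Q b \<Longrightarrow> set vs \<subseteq> H \<Longrightarrow> (\<Union>v\<in>H. set (nbrs (get v s))) \<subseteq> Q \<Longrightarrow> confined s H Q (visits vs b)"
  by (induction vs arbitrary: b) (auto intro!: confined_visit simp: UN_subset_iff)

lemma confined_layer:
  "confined s H Q b \<Longrightarrow> \<forall>vs\<in>set q. set vs \<subseteq> H \<Longrightarrow> (\<Union>v\<in>H. set (nbrs (get v s))) \<subseteq> Q \<Longrightarrow>
   confined s H Q (layer q b)"
  by (induction q arbitrary: b) (auto intro!: confined_visits)

lemma confined_grow: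
  assumes "confined s (ball s w k) (ball s w (Suc k)) b"
  shows "confined s (ball s w (Suc k)) (ball s w (Suc (Suc k))) (grow b)"
proof (cases b)
  case (Search t q)
  have "confined s (ball s w (Suc k)) (ball s w (Suc (Suc k))) (layer q (Search t []))"
    by (rule confined_layer) (use assms Search in auto)
  then show ?thesis using Search by simp
qed

lemma get_hide_ball:
  assumes "v \<notin> ball s w 4"
  shows "get v (hide_ball w s) = get v s"
proof -
  have "confined s (ball s w 0) (ball s w (Suc 0)) (visit w (Search s []))"
    by (rule confined_visit) auto
  from this[THEN confined_grow, THEN confined_grow, THEN confined_grow, THEN confined_grow]
  have "confined s (ball s w 4) (ball s w (Suc 4)) (grow (grow (grow (grow (visit w (Search s []))))))"
    by (simp only: eval_nat_numeral BitM.simps)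
  then obtain t q where "grow (grow (grow (grow (visit w (Search s []))))) = Search t q"
    "get v t = get v s"
    using assms by (cases "grow (grow (grow (grow (visit w (Search s [])))))") auto
  then show ?thesis unfolding hide_ball_def by simp
qed

lemma get_hide: "get v (hide fs s) = (if v \<in> set fs then Hidden else get v s)"
  by (induction fs arbitrary: s) (auto simp: get_put)

lemma set_collect: "v \<in> set (collect u e vs) \<longleftrightarrow> v \<in> set vs \<or> v = u \<and> e \<noteq> Hidden \<and> length (nbrs e) < 4"
proof (cases e)
  case (Entry as fs)
  have "v \<in> set (collect' u as vs) \<longleftrightarrow> v \<in> set vs \<or> v = u \<and> length as < 4"
    by (induction u as vs rule: collect'.induct) auto
  then show ?thesis using Entry by simp
qed simp

lemma ex_digit: "(\<exists>i. P i) \<longleftrightarrow> P D0 \<or> P D1 \<or> P D2 \<or> P D3 \<or> P D4 \<or> P D5"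
  by (metis digit.exhaust)

lemma set_open_row: "v \<in> set (open_row i r vs) \<longleftrightarrow>
  v \<in> set vs \<or> (\<exists>j. v = Vtx i j \<and> nth6 j r \<noteq> Hidden \<and> length (nbrs (nth6 j r)) < 4)"
  by (cases r) (simp add: set_collect ex_digit disj_ac)

lemma set_open_vertices: "v \<in> set (open_vertices s) \<longleftrightarrow> get v s \<noteq> Hidden \<and> length (nbrs (get v s)) < 4"
proof -
  obtain i j where v: "v = Vtx i j" by (cases v)
  show ?thesis unfolding v by (cases s; cases i) (simp_all add: set_open_row)
qed

lemma decide'_cases:
  "decide' w cs s xs = Closed \<Longrightarrow> length xs < 4"
  "decide' w cs s xs = Forced t \<Longrightarrow> length xs = 4 \<and> t = link_all w cs s"
  by (induction w cs s xs rule: decide'.induct) auto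

text \<open>
The candidates contain all actual neighbours, and there are four of these; so too few candidates
are impossible, and if there are four then all of them are neighbours.
\<close>
lemma step_sound:
  assumes coh: "coherent s" and com: "completes R s"
  shows "step w s \<noteq> Closed" and "step w s = Forced t \<Longrightarrow> coherent t \<and> completes R t"
proof -
  interpret girth6_quartic "{v. get v s \<noteq> Hidden}" R using com by (simp add: completes_def)
  have "step w s \<noteq> Closed \<and> (step w s = Forced t \<longrightarrow> coherent t \<and> completes R t)"
  proof (cases "get w s")
    case Hidden then show ?thesis by (simp add: step_def)
  next
    case (Entry as fs)
    define cs where "cs = open_vertices (hide fs (hide_ball w s))"
    have st: "step w s = decide' w cs s (as @ cs)"
      by (simp add: step_def Entry decide_def cs_def)
    have sub: "{y. R w y} \<subseteq> set (as @ cs)"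
    proof
      fix y assume "y \<in> {y. R w y}"
      then have wy: "R w y" by simp
      have "y \<in> set cs" if "y \<notin> set as"
      proof -
        have yn: "y \<notin> set (nbrs (get w s))" using that Entry by simp
        have py: "get y s \<noteq> Hidden" using adj_in[OF sym[OF wy]] by simp
        have "y \<notin> set (bars (get w s))" using com wy by (auto simp: completes_def)
        then have "y \<notin> set fs" using Entry by simp
        moreover have "y \<notin> ball s w 4" using ball_nbr[OF com _ wy] yn by blast
        ultimately have g: "get y (hide fs (hide_ball w s)) = get y s" by (simp add: get_hide get_hide_ball)
        have "w \<notin> set (nbrs (get y s))"
        proof -
          have "get w s \<noteq> Hidden" using Entry by simp
          then show ?thesis using yn coh unfolding coherent_def by blast
        qed
        moreover have "set (nbrs (get y s)) \<subseteq> {z. R y z}" using com by (auto simp: completes_def)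
        ultimately have "set (nbrs (get y s)) \<subseteq> {z. R y z} - {w}" by blast
        moreover have d: "card {z. R y z} = 4" using degree py by simp
        then have "finite {z. R y z}" by (metis card.infinite zero_neq_numeral)
        moreover have "card ({z. R y z} - {w}) = 3" using d sym[OF wy] by simp
        ultimately have "card (set (nbrs (get y s))) \<le> 3" by (metis card_mono finite_Diff)
        then have "length (nbrs (get y s)) < 4"
          using coh by (simp add: coherent_def distinct_card)
        then show ?thesis unfolding cs_def set_open_vertices g using py by simp
      qed
      then show "y \<in> set (as @ cs)" by auto
    qed
    have d: "card {y. R w y} = 4" using degree Entry by simp
    have le: "4 \<le> length (as @ cs)"
      using card_mono[OF _ sub] d card_length[of "as @ cs"] by simp
    then have "step w s \<noteq> Closed" using decide'_cases(1)[of w cs s "as @ cs"] st by auto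
    moreover have "coherent t \<and> completes R t" if "step w s = Forced t"
    proof -
      have l: "length (as @ cs) = 4" "t = link_all w cs s"
        using decide'_cases(2)[of w cs s "as @ cs" t] that st by auto
      have "{y. R w y} = set (as @ cs)"
        by (rule card_seteq[OF _ sub]) (use d l(1) card_length[of "as @ cs"] in auto)
      then have "\<forall>c\<in>set cs. R w c" by auto
      then show ?thesis using link_all(1)[OF coh] link_all(2)[OF com] l(2) by blast
    qed
    ultimately show ?thesis by blast
  qed
  then show "step w s \<noteq> Closed" and "step w s = Forced t \<Longrightarrow> coherent t \<and> completes R t" by auto
qed

lemma bij_perm: "bij (perm p)"
proof (induction p)
  case Nil
  have "perm [] = id" by (rule ext) simp
  then show ?case by (metis bij_id)
next
  case (Cons x p)
  obtain a b where x: "x = (a, b)" by (cases x)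
  have "bij (swap a b)" by (rule o_bij[of "swap a b"]) (auto simp: swap_def fun_eq_iff)
  moreover have "perm (x # p) = perm p \<circ> swap a b" by (auto simp: x)
  ultimately show ?case using Cons.IH bij_comp by metis
qed

lemma perm_fixes: "v \<notin> fst ` set p \<Longrightarrow> v \<notin> snd ` set p \<Longrightarrow> perm p v = v"
  by (induction p v rule: perm.induct) (auto simp: swap_def)

lemma maps_into_iff: "maps_into p vs ws \<longleftrightarrow> (\<forall>v\<in>set vs. perm p v \<in> set ws)"
  by (induction vs) auto

lemma automorphism_iff: "automorphism p s q \<longleftrightarrow> (\<forall>v\<in>fst ` set q \<union> snd ` set q. vertex_maps p s v)"
  by (induction p s q rule: automorphism.induct) auto

lemma vertex_mapsD:
  assumes "vertex_maps p s v"
  shows "get v s \<noteq> Hidden" "get (perm p v) s \<noteq> Hidden"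
    "u \<in> set (nbrs (get v s)) \<Longrightarrow> perm p u \<in> set (nbrs (get (perm p v) s))"
    "u \<in> set (bars (get v s)) \<Longrightarrow> perm p u \<in> set (bars (get (perm p v) s))"
  using assms unfolding vertex_maps_def
  by (cases "get v s"; cases "get (perm p v) s"; auto simp: maps_into_iff)+

text \<open>
The new completion is the old one pulled back along the automorphism. An edge between a fixed and
a moved vertex is handled from the side of the moved one, by coherence.
\<close>
lemma automorphism_completes:
  assumes aut: "automorphism p s p" and coh: "coherent s" and com: "completes R s"
  shows "completes (\<lambda>a b. a \<in> {v. get v s \<noteq> Hidden} \<and> b \<in> {v. get v s \<noteq> Hidden} \<and> R (perm p a) (perm p b)) s"
proof -
  let ?U = "{v. get v s \<noteq> Hidden}" and ?f = "perm p" and ?M = "fst ` set p \<union> snd ` set p"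
  interpret girth6_quartic ?U R using com by (simp add: completes_def)
  have moved: "vertex_maps p s v" if "v \<in> ?M" for v using aut that by (simp add: automorphism_iff)
  have fixed: "?f v = v" if "v \<notin> ?M" for v using perm_fixes that by blast
  have "?f ` ?U \<subseteq> ?U"
  proof
    fix x assume "x \<in> ?f ` ?U"
    then obtain v where v: "v \<in> ?U" "x = ?f v" by blast
    show "x \<in> ?U" using v vertex_mapsD(2)[OF moved] fixed by (cases "v \<in> ?M") auto
  qed
  moreover have "inj_on ?f ?U" using bij_perm[of p] by (meson bij_is_inj inj_on_subset subset_UNIV)
  ultimately have bij: "bij_betw ?f ?U ?U"
    using endo_inj_surj[OF finite_V] by (simp add: bij_betw_def)
  have pres: "a \<in> ?U" if "?f a \<in> ?U" for a
  proof (cases "a \<in> ?M")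
    case True then show ?thesis using vertex_mapsD(1)[OF moved] by simp
  next
    case False then show ?thesis using fixed that by simp
  qed
  have nbr: "R (?f a) (?f b)" if ab: "b \<in> set (nbrs (get a s))" for a b
  proof -
    have R: "R a b" if "b \<in> set (nbrs (get a s))" for a b using com that by (auto simp: completes_def)
    consider "a \<in> ?M" | "a \<notin> ?M" "b \<in> ?M" | "a \<notin> ?M" "b \<notin> ?M" by blast
    then show ?thesis
    proof cases
      case 1 then show ?thesis using vertex_mapsD(3)[OF moved ab] R by blast
    next
      case 2
      then have "a \<in> set (nbrs (get b s))"
        using coh ab vertex_mapsD(1)[OF moved] unfolding coherent_def by blast
      then show ?thesis using vertex_mapsD(3)[OF moved[OF 2(2)]] R sym by blast
    next
      case 3 then show ?thesis using fixed R ab by simp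
    qed
  qed
  have bar: "\<not> R (?f a) (?f b)" if ab: "b \<in> set (bars (get a s))" for a b
  proof -
    have R: "\<not> R a b" if "b \<in> set (bars (get a s))" for a b using com that by (auto simp: completes_def)
    consider "a \<in> ?M" | "a \<notin> ?M" "b \<in> ?M" | "a \<notin> ?M" "b \<notin> ?M" by blast
    then show ?thesis
    proof cases
      case 1 then show ?thesis using vertex_mapsD(4)[OF moved ab] R by blast
    next
      case 2
      then have "a \<in> set (bars (get b s))"
        using coh ab vertex_mapsD(1)[OF moved] unfolding coherent_def by blast
      then show ?thesis using vertex_mapsD(4)[OF moved[OF 2(2)]] R sym by blast
    next
      case 3 then show ?thesis using fixed R ab by simp
    qed
  qed
  have "a \<in> ?U \<and> b \<in> ?U" if "b \<in> set (nbrs (get a s))" for a b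
    using nbr[OF that] adj_in sym pres by blast
  then show ?thesis using pullback[OF bij] nbr bar unfolding completes_def by blast
qed

lemma forbid_images_sound:
  assumes "forbid_images w c s ps t = Some u" and "coherent s" "completes R s"
    and "\<And>R. completes R s \<Longrightarrow> \<not> R w c" and "coherent t" "completes R t"
  shows "coherent u \<and> completes R u"
  using assms(1,5,6)
proof (induction ps arbitrary: t)
  case (Cons p ps)
  then have aut: "automorphism p s p" by (auto split: if_splits)
  interpret girth6_quartic "{v. get v s \<noteq> Hidden}" R using assms(3) by (simp add: completes_def)
  have "\<not> R (perm p w) (perm p c)"
  proof
    assume R: "R (perm p w) (perm p c)"
    have pres: "get v s \<noteq> Hidden" if "get (perm p v) s \<noteq> Hidden" for v
      using that aut perm_fixes[of v p] vertex_mapsD(1) unfolding automorphism_iff by (metis UnCI)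
    have "get w s \<noteq> Hidden" "get c s \<noteq> Hidden" using adj_in[OF R] adj_in[OF sym[OF R]] pres by auto
    then show False using assms(4)[OF automorphism_completes[OF aut assms(2,3)]] R by simp
  qed
  then show ?case using Cons aut by (auto intro: Cons.IH coherent_forbid completes_forbid)
qed simp

text \<open>
Some completable state survives every command. In a branch the completion may change: the question
is whether any completion of the state contains the edge, not whether the given one does.
\<close>
lemma exec_sound:
  assumes "exec c s ss = Some ts"
  shows "set ss \<subseteq> set ts"
    and "coherent s \<Longrightarrow> completes R s \<Longrightarrow> \<exists>t\<in>set ts. \<exists>R. coherent t \<and> completes R t"
proof -
  show "set ss \<subseteq> set ts"
    using assms by (cases c) (auto elim!: after.elims push.elims)
  assume coh: "coherent s" and com: "completes R s"
  show "\<exists>t\<in>set ts. \<exists>R. coherent t \<and> completes R t"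
  proof (cases c)
    case (Step w)
    show ?thesis
    proof (cases "step w s")
      case Closed then show ?thesis using step_sound(1)[OF coh com] by blast
    next
      case (Forced t)
      then have "coherent t \<and> completes R t" by (rule step_sound(2)[OF coh com])
      moreover have "t \<in> set ts" using Forced Step assms by auto
      ultimately show ?thesis by blast
    next
      case Unclear then show ?thesis using Step assms by simp
    qed
  next
    case (Branch w d ps)
    then obtain u where u: "forbid_images w d s ps (forbid w d s) = Some u" "ts = link w d s # u # ss"
      using assms by (cases "forbid_images w d s ps (forbid w d s)") auto
    show ?thesis
    proof (cases "\<exists>R'. completes R' s \<and> R' w d")
      case True
      then obtain R' where "completes R' s" "R' w d" by blast
      then have "completes R' (link w d s)" by (rule completes_link)
      then show ?thesis using u(2) coherent_link[OF coh, of w d] by (metis list.set_intros(1))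
    next
      case False
      then have "coherent u \<and> completes R u"
        by (intro forbid_images_sound[OF u(1) coh com]) (use coh com in \<open>auto intro: coherent_forbid completes_forbid\<close>)
      then show ?thesis using u(2) by auto
    qed
  qed
qed

lemma run_sound: "run cs ss \<Longrightarrow> s \<in> set ss \<Longrightarrow> coherent s \<Longrightarrow> \<not> completes R s"
proof (induction cs arbitrary: ss s R)
  case Nil then show ?case by (cases ss) auto
next
  case (Cons c cs)
  obtain s0 ss' where ss: "ss = s0 # ss'" using Cons.prems(2) by (cases ss) auto
  obtain ts where ts: "exec c s0 ss' = Some ts" "run cs ts"
    using Cons.prems(1) ss by (cases "exec c s0 ss'") auto
  show ?case
  proof
    assume com: "completes R s"
    show False
    proof (cases "s = s0")
      case True
      then show False using exec_sound(2)[OF ts(1)] Cons.prems(3) com Cons.IH[OF ts(2)] by blast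
    next
      case False
      then show False using exec_sound(1)[OF ts(1)] Cons.prems ss com Cons.IH[OF ts(2)] by auto
    qed
  qed
qed

fun digit_value :: "digit \<Rightarrow> nat" where
  "digit_value D0 = 0" | "digit_value D1 = 1" | "digit_value D2 = 2"
| "digit_value D3 = 3" | "digit_value D4 = 4" | "digit_value D5 = 5"
fun number :: "vtx \<Rightarrow> nat" where
  "number (Vtx i j) = 6 * digit_value i + digit_value j"

lemma inj_number: "inj number"
proof (rule injI)
  fix v w assume "number v = number w"
  moreover obtain i j k l where "v = Vtx i j" "w = Vtx k l" by (cases v; cases w)
  ultimately show "v = w" by (cases i; cases k; cases j; cases l) simp_all
qed

lemma number_vertices: "k < 36 \<Longrightarrow> number (vertices ! k) = k"
proof -
  have "\<forall>k\<in>set [0..<36]. number (vertices ! k) = k" by code_simp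
  then show "k < 36 \<Longrightarrow> number (vertices ! k) = k" by simp
qed

lemma get_blank: "get v (blank n) = (if number v < n then Entry [] [] else Hidden)"
proof -
  obtain i j where "v = Vtx i j" by (cases v)
  then show ?thesis by (cases i; cases j) (simp_all add: blank_def)
qed

lemma link_pairs_sound:
  "coherent s \<Longrightarrow> completes R s \<Longrightarrow> \<forall>(a, b)\<in>set es. R (vertices ! a) (vertices ! b) \<Longrightarrow>
    coherent (link_pairs es s) \<and> completes R (link_pairs es s)"
  by (induction es s rule: link_pairs.induct) (auto intro: coherent_link completes_link)

lemma forbid_pairs_sound:
  "coherent s \<Longrightarrow> completes R s \<Longrightarrow> \<forall>(a, b)\<in>set es. \<not> R (vertices ! a) (vertices ! b) \<Longrightarrow>
    coherent (forbid_pairs es s) \<and> completes R (forbid_pairs es s)"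
  by (induction es s rule: forbid_pairs.induct) (auto intro: coherent_forbid completes_forbid)

theorem refutes_sound:
  assumes "refutes xs n es fs" and "n \<le> 36" and "girth6_quartic {..<n} R"
    and es: "\<And>a b. (a, b) \<in> set es \<Longrightarrow> R a b"
    and fs: "\<And>a b. (a, b) \<in> set fs \<Longrightarrow> a < n \<and> b < n \<and> \<not> R a b"
  shows False
proof -
  interpret girth6_quartic "{..<n}" R by fact
  let ?U = "{v. number v < n}" and ?R = "\<lambda>a b. a \<in> {v. number v < n} \<and> b \<in> {v. number v < n} \<and> R (number a) (number b)"
  have nv: "number (vertices ! k) = k" if "k < n" for k using number_vertices that assms(2) by simp
  have "number ` ?U = {..<n}"
  proof (intro set_eqI iffI)
    fix k assume "k \<in> {..<n}"
    then have "k = number (vertices ! k)" "vertices ! k \<in> ?U" using nv by simp_all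
    then show "k \<in> number ` ?U" by blast
  qed auto
  then have bij: "bij_betw number ?U {..<n}"
    using inj_number by (auto simp: bij_betw_def intro: inj_on_subset)
  have hid: "{v. get v (blank n) \<noteq> Hidden} = ?U" by (auto simp: get_blank)
  have "completes ?R (blank n)"
    unfolding completes_def hid using pullback[OF bij] by (simp add: get_blank)
  moreover have "coherent (blank n)" by (auto simp: coherent_def get_blank)
  moreover have "\<forall>(a, b)\<in>set es. ?R (vertices ! a) (vertices ! b)"
  proof (clarify, goal_cases)
    case (1 a b)
    then have R: "R a b" by (rule es)
    then have "a < n" "b < n" using adj_in[OF R] adj_in[OF sym[OF R]] by auto
    then show ?case using R nv by simp
  qed
  ultimately have l: "coherent (link_pairs es (blank n)) \<and> completes ?R (link_pairs es (blank n))"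
    by (intro link_pairs_sound)
  have "\<forall>(a, b)\<in>set fs. \<not> ?R (vertices ! a) (vertices ! b)" using fs nv by auto
  then have "coherent (forbid_pairs fs (link_pairs es (blank n))) \<and> completes ?R (forbid_pairs fs (link_pairs es (blank n)))"
    using l by (intro forbid_pairs_sound) auto
  moreover have "run (commands xs) [forbid_pairs fs (link_pairs es (blank n))]"
    using assms(1) by (simp only: refutes_def)
  from run_sound[OF this, of "forbid_pairs fs (link_pairs es (blank n))"]
  have "coherent (forbid_pairs fs (link_pairs es (blank n))) \<Longrightarrow> \<not> completes ?R (forbid_pairs fs (link_pairs es (blank n)))"
    by simp
  ultimately show False by blast
qed

section \<open>The certificates\<close>

text \<open>
Each certificate is a complete case distinction. The names refer to the configurations of the next
sections. In \<open>wide\<close> and \<open>split\<close> the cycle has length 7; the former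
contains two disjoint edges between the outer neighbours of cycle vertices 0 and 3; the latter
joins the two outer neighbours of 0 to an outer neighbour of 3 and one of 4, respectively. For
\<open>nine\<close> and \<open>eleven\<close> the frame is refuted together with the non-edges
that minimality of the cycle forces. The number is the order of the graph.
\<close>
lemma wide_27: "refutes (
    ''~dllm.ln.lo.lp.lq.;~dmmn.mo.mp.mq.;~enno.np.nq.;~7oop.oq.;8e7edd'')
    27 (frame 7 @ [(7, 13), (8, 14)]) ([])"
  by code_simp

lemma split_27: "refutes (
    ''~7llm.ln.lo.lp.lq.;~7mmn.mo.mp.mq.;~8nno.np.nq.;~8oop.oq.;df8877'')
    27 (frame 7 @ [(7, 13), (8, 15)]) ([])"
  by code_simp

lemma nine_27: "refutes (
    ''~9ffg.;=9l99~9llm.;99'')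
    27 (frame 9) (bars_at 9 4)"
  by code_simp

lemma wide_29: "refutes (
    ''~dllm.ln.lo.lp.lq.lr.ls.;~dmmn.mo.mp.mq.mr.ms.;~enno.np.nq.nr.ns.;~eoop.oq.or.os.;~7ppq.'' @
    ''pr.ps.;~jqqr.qs.;87~kqqr.qs.;87~9qqr.qs.;87~aqqr.qs.;87~pqqr.qs.;87~7qqr.qs.;8~h99a.;~hl'' @
    ''lm.;=9n99~hnno.;=9l99=hp~hrrs.;fgh~hrrs.;hfgh~hbbc.;=hp=brbb=hq=brbb~hrrs.;=bpbb~hllm.;~'' @
    ''hnno.;jkh=hnhh~hllm.;~hnno.;h~hrrs.;hh~hnno.;=hphh=hp=hrhh=hq=hrhh~hrrs.;hh77eedd'')
    29 (frame 7 @ [(7, 13), (8, 14)]) ([])"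
  by code_simp

lemma split_29: "refutes (
    ''~7llm.ln.lo.lp.lq.lr.ls.;~7mmn.mo.mp.mq.mr.ms.;~8nno.np.nq.nr.ns.;~8oop.oq.or.os.;~fppq.'' @
    ''pr.ps.;~eqqr.qs.;df~ejjk.;=enee~enno.;eef8877'')
    29 (frame 7 @ [(7, 13), (8, 15)]) ([])"
  by code_simp

lemma nine_29: "refutes (
    ''~r99a.;~9ffg.;~allm.;af=asaa~9llm.;9=afaa=9s99~9ffg.;~9llm.;9a=9s99=9l99'')
    29 (frame 9) (bars_at 9 4)"
  by code_simp

lemma wide_31: "refutes (
    ''~7llm.ln.lo.lp.lq.lr.ls.lt.lu.;~7mmn.mo.mp.mq.mr.ms.mt.mu.;~8nno.np.nq.nr.ns.nt.nu.;~8oo'' @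
    ''p.oq.or.os.ot.ou.;~dppq.pr.ps.pt.pu.;~dqqr.qs.qt.qu.;~errs.rt.ru.;~esst.su.;~h99a.031246'' @
    ''7d8e9bacfjgklpmqnros.0312467d8e9cabfjgklpmqnros.172d9lambpcq.172d9malbpcq.182e9naobrcs.1'' @
    ''82e9oanbrcs.031d27468e9paqblcmfjgknros.031d27468e9qapblcmfjgknros.031e28467d9rasbncofjgk'' @
    ''lpmq.031e28467d9sarbncofjgklpmq.;~hllm.78delnmoprqs.78delomnprqs.;~hrrs.;r=9p99~hnno.;~i'' @
    ''a172d9lambpcq.;=fmgf=fofg~fttu.;ff~ibbc.172d9lambpcq.172d9lambqcp.;=io=fagf=fmfg~fttu.;f'' @
    ''f~ippq.;~irrs.;=9q~9ttu.;nb=cjcc9=lcnr=sjss~lttu.;lnl~bttu.;9=lcllb=parn=ofoo~pttu.;prp~'' @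
    ''bttu.;ip=uruub~ittu.;pti~irrs.;~bttu.;ir=upuub~ittu.;rtiib=fmff=ioif~irrs.;ir=faff~ittu.'' @
    '';ii~httu.;~ia172d9lambpcq.;=fm=gngg~fnno.;f=fuff~ibbc.172d9lambpcq.172d9lambqcp.;~inno.;'' @
    ''b=npnn~ippq.;~irrs.;=9sl=tntt=9u9lt9i~9rrs.;9lt9~irrs.;ilr=sjss=iuii~inno.;i~irrs.;i=iui'' @
    ''ih~hppq.78delnmoprqs.78delnmopsqr.;~hrrs.;9=pnpp~9ttu.;h=pnpp=9r99h=ia~fllm.78delnmoprqs'' @
    ''.78delomnprqs.;=fnfff~ibbc.;~illm.78delnmoprqs.78delomnprqs.;=bnbb~ippq.78delnmoprqs.78d'' @
    ''elnmopsqr.;~irrs.;9=jqjjii~illm.78delnmoprqs.78delomnprqs.;=fa=gngg=fm=fnff~fnno.;ff~ipp'' @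
    ''q.78delnmoprqs.78delnmopsqr.;=iriiiheedd8877'')
    31 (frame 7 @ [(7, 13), (8, 14)]) ([])"
  by code_simp

lemma split_31: "refutes (
    ''~7llm.ln.lo.lp.lq.lr.ls.lt.lu.;~7mmn.mo.mp.mq.mr.ms.mt.mu.;~8nno.np.nq.nr.ns.nt.nu.;~8oo'' @
    ''p.oq.or.os.ot.ou.;~fppq.pr.ps.pt.pu.;~fqqr.qs.qt.qu.;~drrs.rt.ru.;~dsst.su.;~ejjk.5f68hp'' @
    ''iqjnko.5f68hpiqjokn.;~enno.;~jttu.;e=nhnn=jpjje=jpjjeddff8877'')
    31 (frame 7 @ [(7, 13), (8, 15)]) ([])"
  by code_simp

lemma nine_31: "refutes (
    ''~bhhi.;~bnno.;~brrs.rt.ru.;~hsst.su.;n=oioohb~brrs.rt.ru.;~bsst.su.;~hnno.;nh~httu.;h=in'' @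
    ''iihbb~bnno.;~brrs.rt.ru.;~bsst.su.;~nhhi.;hn~nttu.;n=ohoonbb~brrs.rt.ru.;~bsst.su.;~bttu'' @
    ''.;~chhi.;~cnno.;ch=cucc=cnccbbb'')
    31 (frame 9) (bars_at 9 4)"
  by code_simp

lemma wide_33: "refutes (
    ''~7llm.ln.lo.lp.lq.lr.ls.lt.lu.lv.lw.;~7mmn.mo.mp.mq.mr.ms.mt.mu.mv.mw.;~8nno.np.nq.nr.ns'' @
    ''.nt.nu.nv.nw.;~8oop.oq.or.os.ot.ou.ov.ow.;~dppq.pr.ps.pt.pu.pv.pw.;~dqqr.qs.qt.qu.qv.qw.'' @
    '';~errs.rt.ru.rv.rw.;~esst.su.sv.sw.;~i99a.0312467d8e9bacfjgklpmqnros.0312467d8e9cabfjgkl'' @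
    ''pmqnros.172d9lambpcq.172d9malbpcq.182e9naobrcs.182e9oanbrcs.031d27468e9paqblcmfjgknros.0'' @
    ''31d27468e9qapblcmfjgknros.031e28467d9rasbncofjgklpmq.031e28467d9sarbncofjgklpmq.;~illm.7'' @
    ''8delnmoprqs.78delomnprqs.;~inno.;~ha172d9lambpcq.182e9naobrcs.;~hm78delnmoprqs.;=ho~fttu'' @
    ''.tv.tw.;gff~hrrs.;~rttu.tv.tw.;~ruuv.uw.;~appq.;~pvvw.;a=mbmm~qvvw.;a=mbmm~tvvw.;a=mbmm~'' @
    ''uvvw.;a=mbmm~avvw.;=lw=mbmm=vw=mbmm~mbbc.;m=s9~sjjk.;s=wfww=swss=sl~sjjk.;s=vfvv=svss=nv'' @
    ''=sjss=nw=sjss=sv~vjjk.;s=pn~jttu.;skpjnbcl=ufuu=pjs=jbjjpsj=nbbbn~cttu.;l=tfttc=9q=nbnn='' @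
    ''oq=nbnn~jttu.;skq=ufuu=pjs=jbjjpsj=bobbn~kttu.;q=ufuuk=sjssmaa=mbmmrr~httu.tv.tw.;=fogf~'' @
    ''fuuv.uw.;fgfh~hppq.78delnmoprqs.78delnmopsqr.;~hrrs.;~attu.tv.tw.;~auuv.uw.;~lvvw.;p=rmr'' @
    ''r~nvvw.;r=popp=qopr~ottu.;pr~ovvw.;r=popp=smrp~mttu.;rp~mvvw.;p=rmrr~tvvw.;pr~uvvw.;pr=p'' @
    ''o~pvvw.;r~9q78delnmoprqsvw.;=9w=qjqq9~vjjk.;q=sjss=jws=qjqq=wks=qkqq=sv~sjjk.;q~jttu.;~j'' @
    ''bbc.;k~vffg.;v=fmffvj=jbjjs=sjss9~bm78delnmoprqsvw.;=cn=cjcc=bo=cjcc~mffg.;=gv=gtgg=of=g'' @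
    ''tggo~lttu.;fgl=sjssl~cjjk.;b=vfvvcm~bjjk.;=blbb~bl78delnmoprqsvw.;bbppraa~httu.tv.tw.;=p'' @
    ''o~puuv.uw.;~arrs.;~avvw.;~offg.;=fmgf=fvfg=fwff=fmg=oboo=fufg=fvf=fwffaa=9q=qjqq=9u~urrs'' @
    ''.;9~uffg.;=fm=gvgg~fvvw.;ff=ujuu=9r99p~tuuv.uw.;p=araa~arrs.;~ruuv.uw.;pa~auuv.uw.;p=9q9'' @
    ''=qo~qjjk.;=ts=rm=tbtt~tbbc.;t=mfmm=tmtt~tbbc.;tb=tmt=tottq=qjqq=9s~svvw.;9~9vvw.;=qn~qjj'' @
    ''k.;q=ufuu=quqq~qjjk.;q=ufuu=qoq=quqq9=9v99a~auuv.uw.;paah~httu.tv.tw.;~huuv.uw.;~fm78del'' @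
    ''nmoprqs.;gf~fvvw.;ffhh~hbbc.172d9lambpcq.172d9lambqcp.182e9naobrcs.182e9naobscr.;~hppq.7'' @
    ''8delnmoprqs.78delnmopsqr.;~hrrs.;~9q78delnmoprqs.;=9s=nc~nttu.tv.tw.;~luuv.uw.;~lvvw.;=b'' @
    ''m=bw=cjccb=rap=cjcc=pw=rurrp=mw=cjcc=tw=cjcc~tffg.;=mff=cjcc=mgg=fuff=msmm=tjtt=bo~ouuv.'' @
    '';bp=rmrr~buuv.;=owp=rmrr=uwp=rmrr~uffg.;o=gwf=apaa=fa=gmggf~ujjk.;ju=ujuubp=rmr~ruuv.;rr'' @
    ''=pw=bubb=ra=popp=rmr=sjss~ruuv.;br=rw=bubbrlln~nttu.tv.tw.;~nuuv.uw.;=lc~lvvw.;=bm=bo=pa'' @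
    ''r=cjcc=rw=ptppr=ow=cjcc=vw=cjcc~vffg.;=off=cjcc=ogg=ftff=oqoo=vjvv~mttu.;br=popp~bttu.;='' @
    ''mwr=popp=twr=popp~tffg.;m=gwf=apaa=fa=goggf~tjjk.;jt=tjttbr=pop~pttu.;pp=bob=cjcc=rw=btb'' @
    ''b=pa=rmrr=pop=qjqq~pttu.;bp=pw=btbbpll=po=qjqq=ra=ptpp=rmr~rvvw.;rrnn~9ttu.tv.tw.;=nc~nu'' @
    ''uv.uw.;=ls~lvvw.;=ra=rw=poppr=bopb=afaa=bvb=popp=bwbb=bmrbp=mfmm=pobr=ofoo=sa~sjjk.;=jc='' @
    ''mucprbj=ktkk=jq=otqrb=ktkk=cm=qo=fa=aupruw=awbprt=uguua=pwbrt=vgvvp=bwrt=uguub=fwugkf=mt'' @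
    ''guv=mwgrtum=rwt=uguur=wt=tgg=kukk=tkgkg=kukkt=wgww=bwprat=ufuub=offvgk=pwort=vfvvp=rwaou'' @
    ''=vfvvr=mff=tga=fuff=mwtwfgm=awgt=ufuua=gwftug=wt=tff=kukk=tkfkf=kukkt=wfwwqkp~affg.;ugac'' @
    ''kqb~offg.;vgo=cwbjkpqc=bwjrb=pwqr=tfttp=awjr=qkkqq~affg.;u=vgvva=bwcpr=tfttb=rwp=jqjjr=q'' @
    ''kj=kckk=qwp=jqjjq=ckkcc=juk=ufuu=jwk=wfwwjsr=pwbp=afaap~affg.;fm~cjjk.;t=uguucbo~qjjk.;j'' @
    ''q=tjjk=jujja=rw=sjssr=mw=sjss=tw=sjss~tffg.;=mumpb=agaam~tjjk.;sjkqft=tjttll=po=qjqqp=bm'' @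
    ''b=cjcc=ot=qjqq~uffg.;=fm=cjcc=gt=fvff~tjjk.;qu=fvff=trtm=tstmt=ujuun~nuuv.uw.;~nvvw.;=ls'' @
    ''=lc=bm=rar=sjssr~buuv.;=mfmmb~cjjk.;cs=tftt=cwcc=bob=cjcc=rw=bubb~puuv.;bpr=mfmm=pw=bubb'' @
    ''pr=ow=bubb=tw=bubb~tffg.;=off=qjqq=ogg=fuffo=tjttl=ra=sjssr=po=qjqq=aw=sjss~tffg.;=fof=o'' @
    ''boo=gw=fuff~wjjk.;st=fuff=wbwo=wcw=bubb=wfw=fuff=tjttl=bob=cjcc=po=qjqq=ra=pupp=rm=bubbr'' @
    ''~tjjk.;s=wfww=tm=bubb=tfttnn9~9ttu.tv.tw.;~9uuv.uw.;=lc=ls=nq~nvvw.;=pa=pw=qjqqp=rmb=qjq'' @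
    ''q=bw=rtrrb=aw=qjqq=vw=qjqq~vffg.;=aff=qjqq=agg=ftff=asaa=vjvv=po~ottu.;pb=rarr~pttu.;=ow'' @
    ''b=rarr=twb=rarr~tffg.;o=gwf=mbmm=fm=gaggf~tjjk.;jt=tjttpb=rar~rttu.;rr=bw=ptpp=rm=bobb~r'' @
    ''ttu.;pr=rw=ptpprnn=bob=cjcc=ra=sjss=rm=bvbb~rttu.;rr~cvvw.;ln=bo=cjcc~pvvw.;bl~mvvw.;l=b'' @
    ''mbb=oqnl~ovvw.;nlb=cjcc~qttu.;nl~qvvw.;l=nqnn=pa=qjqq~tvvw.;ln~uvvw.;ln~lvvw.;bn~wffg.;='' @
    ''fa=qjqq=gv=ftff~vjjk.;cw=ftff=vrva=vsvav=wjwwl=ls~lvvw.;=nc=nq=pa=pw=qjqqp=bmb=cjccb~cjj'' @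
    ''k.;cq=vfvv=cmcc=po=bmb=cjccb~pttu.;=ofoop=bw=ptpp~rttu.;prb=ofoo=rw=ptpprb=aw=ptpp=vw=pt'' @
    ''pp~vffg.;=aff=sjss=agg=ftff=aqaa=vjvvn=bmb=cjccb=ra=sjss=mw=cjcc~vffg.;=fa=sjss=gw=ftff~'' @
    ''wjjk.;cv=ftff=wpwa=wqwaw=vjvvn=pa=qjqq=bo=ptpp=ra=sjss=bm=rtrrb~vjjk.;c=wfww=vo=cjcc=vfv'' @
    ''vlln=bmb=cjcc=pa=qjqq=po=bvbb~pttu.;pp99~httu.tv.tw.;=bm=bo=pa~puuv.uw.;~ovvw.;=trtt=nq='' @
    ''ofoo~avvw.;=trtt~mvvw.;=trtt=rut=afaa=ust=afaa~uvvw.;=trtt~mffg.;o~mrrs.;t=afaa~9vvw.;gn'' @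
    ''=lsll9~gvvw.;fl=nunngm=mrmmp~ouuv.uw.;p=trtt=nq=ofoo~muuv.uw.;p=trtt~mffg.;o~mrrs.;~luuv'' @
    ''.uw.;ptl=nvnnl~guuv.uw.;ng=fvffgm=mrmm~buuv.uw.;=pa=totp~pvvw.;=trttp~ovvw.;=trtt=nc=ofo'' @
    ''o~avvw.;=trtt~mvvw.;=trtt=rut=mfmm=ust=mfmm~uvvw.;=trtt~affg.;o~arrs.;t=mfmm~9vvw.;9f=nu'' @
    ''nn9~gvvw.;lnga=araa~mvvw.;p=trtt=topt=oqp=trtt~uvvw.;p=trtt=ta~arrs.;tp~avvw.;p=trtt=9q='' @
    ''afaa~trrs.;=ls=mfmm~lvvw.;9ptln=rjrrl~rvvw.;9t~cvvw.;9t~qvvw.;pt=afaa=su=mfmm~svvw.;t=9s'' @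
    ''99~tvvw.;9p~rjjk.;cs=kqjqvk~mffg.;fgwjmrtt=9r99~pvvw.;=trttpb=bo~buuv.uw.;~ovvw.;p=trtt='' @
    ''nq=ofoo=lcn=cjcc=qu=ofoo~uvvw.;p=trtt=pa~avvw.;p=trtt~pvvw.;=mu=trtt~urrs.;t=lrll=rvt=af'' @
    ''aa=vst=afaa~affg.;~arrs.;tl~rjjk.;su9gkra=araapp~trrs.;tl=rjrrtb~buuv.uw.;~uvvw.;bp=trtt'' @
    ''~bvvw.;=topt=oqp=trtt=oup=trtt=ovp=trtt=vwp=trtt=tap~trrs.;t=rjrrt=pw=trttp=ow=trtt=aw=t'' @
    ''rtt=nc=ofoo~muuv.;=trtt~affg.;o~arrs.;t=9w9=nunn9=mgmm~cjjk.;jswca=araabbh~httu.tv.tw.;~'' @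
    ''huuv.uw.;~bm78delnmoprqs.;=bo~mffg.;=fagf~fvvw.;fgf=fag=mrmm=fofg~fvvw.;ff~bvvw.;~mffg.;'' @
    ''=fagf=fofg=fwff=fag=mrmm=fofg=fvf=fwffbb=ta~um78delnmoprqs.;=uou~urrs.;uu~uppq.78delnmop'' @
    ''rqs.78delnmopsqr.;=uruuu~tm78delnmoprqs.;=tot~trrs.;tt~tppq.78delnmoprqs.78delnmopsqr.;='' @
    ''trttthh~fttu.tv.tw.;hgff~gttu.tv.tw.;hgg~irrs.;~rttu.tv.tw.;~ruuv.uw.;~lbbc.;~bvvw.;l=9p'' @
    ''99~cvvw.;l=9p99~hvvw.;l=9p99~tvvw.;l=9p99~uvvw.;l=9p99~lvvw.;=vw=9p99=aw=9p99~9ppq.;9=hs'' @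
    ''=ha=nw=smss=wo=smss=hms~cttu.;a=mcmm~qttu.;m=aqaa=aq~attu.;m~bnno.;~bjjk.;c~uffg.;u=fvff'' @
    ''=ujuub=bjbba=ataah=sv=ataas~qnno.;=nv=ataa~qttu.;a~wffg.;m=fo=pjpp~wjjk.;p=bkbcgk=bnbjkn'' @
    ''o=bobovk=ncnnbw=wjwwq=qtqq~cjjk.;=hmhh=sa=smh~vffg.;m=afaa=fwa=mfmm=wga=mgmm=av~affg.;m~'' @
    ''cttu.;~cnno.;q~bjjk.;b=jpjj=bobbc=cncca=afaas=hq=afaah~cnno.;=nw=mtmm~cttu.;m~vffg.;a=fo'' @
    ''=bjbb~vjjk.;b=ftfjkoqt=fufgqtu=fwfnop=tgttfv=vjvvc=ctcc=hmhs=mtmmh=sms=mfmms=nb=oq=ofoo='' @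
    ''np=ofoo~bjjk.;=kw=ktkk=pj=ktkkp~cttu.;jk=ofooc~offg.;n=wgwwob=co=bjbb=nq=nfnn=po=nfnn=jb'' @
    ''b=kw=ktkk=pj=ktkkp~cttu.;jk=nfnnc~nffg.;o=wgwwnb=jw=jtjj=pk=jtjjp~cttu.;kj=nfnnc~nffg.;o'' @
    ''=wgwwn=ha=hm~hnno.;=sa~sjjk.;s=vfvv=svss=sm~sjjk.;s=wfww=swss=nv=sjss=nw=sjss=sv~vjjk.;s'' @
    ''=bn~jttu.;sbkjnq=ufuu=bjs=jpjjbsj=np=ktkknp~kttu.;q=ufuuk=mc=npnn=co=bjbb~jttu.;sbckmn=u'' @
    ''fuu=bjs=jpjjbsj~cttu.;cmn=tfttc=sjssh~hnno.;h=qtqq=hqhh=hc~cnno.;=hmhh=hm=ctcc=jq=hnhh=q'' @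
    ''k=hnhh=nhhn=va=qtqq~wffg.;o=vjvv~wjjk.;w=ctcc=wm=ctccwho=va=qtqq~wffg.;n=vjvv~wjjk.;w=ct'' @
    ''cc=wm=ctccw=hm=hnhh~hnno.;h=hqhh9ll=9p99rr~ittu.tv.tw.;~ha172d9lambpcq.;=hm~hnno.;=fogf~'' @
    ''fuuv.uw.;fgf~hrrs.;~auuv.uw.;r=mbmm=apaa~huuv.uw.;~fnno.;fg~fvvw.;ffh~hnno.;~hppq.;~auuv'' @
    ''.uw.;p=nbnn=araa~huuv.uw.;=fmgf=fofg~fvvw.;ffh~hppq.;~hrrs.;~ruuv.uw.;a=pnppr~huuv.uw.;~'' @
    ''arrs.;~rvvw.;a=pnpp~uvvw.;a=pnpp~avvw.;=st9=pnpp~pnno.;p=fnfg=nggf~nbbc.;nt=ntnnpaa=pnpp'' @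
    ''h~hrrs.;~huuv.uw.;=smr=apaa=mur=apaa~uvvw.;r=apaa~appq.;~pvvw.;ar~bvvw.;ar9=sjss~cvvw.;a'' @
    ''r9=sjss~avvw.;r~mffg.;~fnno.;fg=fvff=mbmmaarh~fuuv.uw.;h=gngg=fnff~hbbc.172d9lambpcq.172'' @
    ''d9lambqcp.;~hnno.;~hppq.;~buuv.uw.;npb~huuv.uw.;=mub=npnn~uvvw.;b=npnn~nppq.;=pa=uruu~pv'' @
    ''vw.;bn~avvw.;bn=uruu~urrs.;u=afaaunbh~hppq.;~hrrs.;=9q=9s=lc~luuv.uw.;~svvw.;=tntt=rm=sj'' @
    ''ss~cvvw.;=tntt~qvvw.;=tntt=nut=cjcc=uot=cjcc~uvvw.;=tntt~qjjk.;s~qnno.;t=cjcc~bvvw.;kr=p'' @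
    ''oppb~kvvw.;jp=rurrkq=qnqql~suuv.uw.;l=tntt=rm=sjss~quuv.uw.;l=tntt~qjjk.;s~qnno.;~puuv.u'' @
    ''w.;lt=ofoop~kuuv.uw.;rk=jvjjkq=qnqq~9uuv.uw.;=lc=tstl~lvvw.;=tnttl~svvw.;=tntt=ra=sjss~c'' @
    ''vvw.;=tntt~qvvw.;=tntt=nut=qjqq=uot=qjqq~uvvw.;=tntt~cjjk.;s~cnno.;t=qjqq~bvvw.;bj=rurrb'' @
    ''~kvvw.;prkc=cncc~qvvw.;l=tntt=tslt=sml=tntt~uvvw.;l=tntt=tc~cnno.;tl~cvvw.;l=tntt=bm=cjc'' @
    ''c~tnno.;~nvvw.;lt=po=nfnn~pvvw.;bt=nfnnp~avvw.;bt~mvvw.;lt=cjcc=ou=qjqq~ovvw.;t=bobb~tvv'' @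
    ''w.;bl~nffg.;ao=gmfmvg~qjjk.;jkwfqntt=bnbb~lvvw.;=tnttl9=9s~9uuv.uw.;~svvw.;l=tntt=rm=sjs'' @
    ''s=par=afaa=mu=sjss~uvvw.;l=tntt=lc~cvvw.;l=tntt~lvvw.;=qu=tntt~unno.;t=pnpp=nvt=cjcc=vot'' @
    ''=cjcc~cjjk.;~cnno.;tp~nffg.;oubgknc=cnccll~tnno.;t=nfnn=tqtt9~9uuv.uw.;~uvvw.;9l=tntt~9v'' @
    ''vw.;=tslt=sml=tntt=sul=tntt=svl=tntt=vwl=tntt=tcl~tnno.;t=nfnn=tqtt=lw=tnttl=sw=tntt=cw='' @
    ''tntt=ra=sjss~quuv.;=tntt~cjjk.;s~cnno.;t=bw=ofoob=qkqq~affg.;fowac=cncc99~huuv.uw.;=pa~p'' @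
    ''nno.;=bm=uoub~bvvw.;=uruub~avvw.;=uruu~mvvw.;=uruu~nvvw.;=uruu~ovvw.;=uruu~mffg.;=nggo=t'' @
    ''vtt=afgno=tvtt~mrrs.;ua~sjjk.;j=kvkk=sls=stssm=mrmm~avvw.;b=uruu~nvvw.;b=uruu=uobu=9q~9r'' @
    ''rs.;=us=afaa~cvvw.;bu=mfmm=bo~ovvw.;bu~bvvw.;u~rjjk.;=jcjjrbbu~cvvw.;9b~9vvw.;b=nt=tctt='' @
    ''ott=tc=trtt~trrs.;t=twtt9~cvvw.;b=9r99~9rrs.;=us=afaa~uvvw.;bu9u9b~pvvw.;~unno.;ub~urrs.'' @
    '';u=bnbb=uwuup~pnno.;~nvvw.;pb=uruu~pvvw.;=nttb=cjcc=uobu=oc=nfnn=cv=nfnn~nffg.;n=owf=gog'' @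
    ''g=avf=gagg=to=oqt=9r99o=bw=tqttb=fagt=fmfgt=9r99=fwffo=bm=mw=uruu=lc~lrrs.;mu~cjjk.;r=kq'' @
    ''kkclfg~mrrs.;ua9tm=fwgf=lrllfg~mrrs.;l=usuumb=mw=uruu=fag~urrs.;uam9lufg~9rrs.;9lt9npp=u'' @
    ''m=bnbb~unno.;u~urrs.;uuh~hrrs.;~huuv.uw.;=ra=rm~bnno.;~mvvw.;b=upuu=lc=mfmm=9sl=sjss~9vv'' @
    ''w.;l=sjss=9p99b~unno.;=upuu~uppq.;uu~rvvw.;=ls~9ppq.;9=sjss=9w99=mvl=mfmm=lc=lv~vffg.;=v'' @
    ''w=fnff=cw=fnff~cjjk.;v~cnno.;f=kpkkc=cncc~vjjk.;v=jpjj=vwvvl=mu=bnbb=st=9p99~tnno.;=cv=t'' @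
    ''ptt=bob=cjccb~nppq.;9t~uppq.;u=cjcc=uwuu=tpttl~vffg.;=fnff~vjjk.;v=cnccvr=umr=bnbb~uvvw.'' @
    '';r=bnbb=bmr=ls=mfmm=ct=lvll=st=tptt~bnno.;~avvw.;=upuu~nffg.;m=ga=fvff~pvvw.;lua=9p99=vq'' @
    ''lua=9q99=qwlua=9q99=nt~9vvw.;l=tptt~9ppq.;9a=tvtt=9s99~9vvw.;l=tptt~nppq.;u9an~nppq.;n=t'' @
    ''vtt=ntnnb=msr=bnbb~bnno.;~nvvw.;br~avvw.;br=upuu~cvvw.;br=mfmm~ovvw.;br~bvvw.;r=lc=mfmml'' @
    ''~nppq.;u9=tott~uppq.;u9=qjqqubbrh~huuv.uw.;~hvvw.;=bm~bnno.;=fnfg=gafg=gmfg=gng=gofg=gwg'' @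
    ''gb~trrs.;l=9p99~9rrs.;l~ruuv.;=mfmm=rw=mfmm~9ppq.;~pjjk.;rkj~suuv.;u=vnvv~puuv.;=unuu=ua'' @
    ''=vnvv~unno.;u=uquu~rjjk.;rjk=rmr=mfmm9=9p99~bnno.;b=fnfg=nggf~nppq.;nt=ntnnbhh~hnno.;~fu'' @
    ''uv.uw.;hgffgh~hrrs.;~huuv.uw.;~hvvw.;~ra172d9lambpcq.;=rm=9s~lbbc.;l=sjss=lwll=lw=9p99=s'' @
    ''t=lbll~sjjk.;s=9p99=sls=lbllr=ls=9p99=st=9p99=tw=lbll~wppq.;=lbll~tnno.;~nppq.;9=tbtt~tp'' @
    ''pq.;9~affg.;afg=apaa=tbtt~9ppq.;=tbtt=9s99rhhh~fa172d9lambpcq.;=gngg~fnno.;ffi~ippq.78de'' @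
    ''lnmoprqs.78delnmopsqr.;~irrs.;~9ttu.tv.tw.;~9uuv.uw.;~rllm.;~lvvw.;r=pnpp~hvvw.;r=pnpp~m'' @
    ''vvw.;r=pnpp~tvvw.;r=pnpp~uvvw.;r=pnpp~rvvw.;=vw=pnpp=qw=pnpp~pnno.;p=ha=hm=ho=aq=av=qjqq'' @
    ''a~vjjk.;s=qjqq=jwq=sjss=wkq=skss=qv~qjjk.;s~jttu.;~jbbc.;k~vffg.;v=fnffvj=jbjjq=qjqq=asa'' @
    ''=sjssa=bl=co=cjcc=bn=cjcc~lffg.;=gw=gtgg=nf=gtggn~mttu.;fgm=sjssm~cjjk.;b=wfwwcl=bo=bjbb'' @
    ''=nc=bjbb=cm=bjbb=fll=gw=gtgg=nf=gtggn~mttu.;fgm=sjssm~bjjk.;c=wfwwbl=fw=ftff=ng=ftffn~mt'' @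
    ''tu.;gfm=sjssm~bjjk.;c=wgwwbh=aw=stssa~mbbc.;=bw=stss~mttu.;s~vffg.;l=fo=qjqq~vjjk.;q=bkb'' @
    ''cgk=bnbjkno=bobot=uguubv=vjvvm=mtmm=aq=hohh~qjjk.;=hohh=bw=asaa=wc=asaa=aw=wsah=qtqq=ash'' @
    ''~obbc.;=bv=qtqq~ottu.;q~wffg.;n=fm=sjss~wjjk.;s=bkbcgk=blbjklm=bmbmt=uguubw=wjwwo=otooa='' @
    ''hoh=qtqqh~mttu.;q=smss~ottu.;s=qoqq=qo~qttu.;s~tjjk.;~tffg.;u~mbbc.;m=bnbb=mfmmt=tfttq=q'' @
    ''tqq=asaa=aq=as~affg.;=hq~hbbc.;h=otoo=hohh=hs~hbbc.;h=mtmm=hmhh=fm=hbhh=fo=hbhh=hm~mbbc.'' @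
    '';h=lf~bjjk.;hlcbfw=ktkk=blh=bnbb=bnbh=bol=hbhhbhl=fn=cjccfn~cjjk.;w=ktkkc=qv=fnff=gv=fnf'' @
    ''f~bjjk.;hlvc=ktkk=blh=bnbb=bnbh=bol=hbhhbhl~cjjk.;cv=ktkk=cncc=hbhha~affg.;a=vjvv=avaa=a'' @
    ''s~affg.;a=wjww=awaa~vbbc.;=afaa=bw=afaa=wc=afaa~hbbc.;=hm=bnbb=ho=blbbh=av~vffg.;a=lb~ft'' @
    ''tu.;aglfnboq=smss=lfa=fnfflaf=bn=gtggbn~gttu.;oq=smssg=sm=bnbb=cm=bnbb~fttu.;agmoqs=agag'' @
    ''lfafl=bobbn~gttu.;moqsg=afaa~affg.;afh=ava=awaaprr=pnpp99~ittu.tv.tw.;~9rrs.;~9uuv.uw.;~'' @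
    ''pnno.;~pvvw.;=ha=hq=awqha=slssa=hoq=oboohq=ju=ks=kbkk=jv=kbkk~uffg.;=gn=glgg=vf=glggv~nb'' @
    ''bc.;kjn=wlwwn~fllm.;g=rkrrfu=js=jbjj=vk=jbjj=kr=jbjj=fuu=gn=glgg=vf=glggv~nbbc.;jkn=wlww'' @
    ''n~fllm.;g=rjrrfu=fn=flff=vg=flffv~nbbc.;jkn=wlwwn~gllm.;f=rjrrg=ho~hllm.;~nffg.;=fmgf=fu'' @
    ''fg=fwff=fmg=nbnn=fufg=fvf=fwffh~nffg.;~fllm.;fg=fuff=nbnn=hs=ava=slssa~hllm.;sh=fw=hlhh='' @
    ''gw=hlhh~hllm.;h=fnfg=nggf~nbbc.;nw=nwnnh=hq=ho~hbbc.;oq=hw=qaqqh=hs~hbbc.;~rjjk.;=jckj=j'' @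
    ''vjk=jwjj=jck=rlrr=jujk=jvj=jwjjh~rjjk.;~jbbc.;jk=jvjj=rlrr=jw=hbhh=kw=hbhh~hbbc.;h=jrjk='' @
    ''rkkj~rllm.;rw=rwrrh=ho~hbbc.;~hllm.;bo=lrllho=nc=tltt~nffg.;nn=tw=hlhh=ts~sllm.;=tbtt~tb'' @
    ''bc.;~tllm.;h=lfllt=tltt~hllm.;=tbtt=hwhh=hs~hbbc.;~hllm.;ls=bnbbh~tllm.;t=cjcc=tott~rllm'' @
    ''.;h=tbtt=rw=hlhh=rjrr~hbbc.;~bllm.;h=bnb=hlhh=bw=hlhhb=tw=hlhh=ot=tltt~hllm.;ht=cjcc=hwh'' @
    ''h=hlhhpp~tllm.;=ts~tbbc.;=lfllt~lbbc.;=tntt~tbbc.;~tnno.;=bjbbt=tntt~tnno.;=tbtt=ts=tbtt'' @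
    ''t9~tuuv.uw.;9=pnpp~huuv.uw.;9=pnpp~pnno.;~nuuv.uw.;9p~puuv.uw.;9~tbbc.;=to~tllm.;=bjbbt~'' @
    ''bllm.;=trtt~tllm.;~trrs.;=lfllt=trtt=to=tltt~trrs.;=tltttp~9uuv.uw.;p99i~ittu.tv.tw.;~iu'' @
    ''uv.uw.;=ha~hllm.78delnmoprqs.78delomnprqs.;~hrrs.;r=apaa~hnno.;=fmgf=fofg~fvvw.;ff~fvvw.'' @
    '';h=gngg=fnff~hppq.78delnmoprqs.78delnmopsqr.;~hrrs.;a=pnpp~avvw.;h=pnpp=araah~fllm.78del'' @
    ''nmoprqs.78delomnprqs.;=fnfff~hbbc.;~hllm.78delnmoprqs.78delomnprqs.;~hnno.;b=lrll~hrrs.;'' @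
    ''lr~bvvw.;h=lrll=bnbb~hppq.78delnmoprqs.78delnmopsqr.;~hrrs.;~9q78delnmoprqs.;=9s~qjjk.;='' @
    ''jckj~jvvw.;jkj=jck=qnqq=jsjk~jvvw.;jj~9vvw.;~qjjk.;=jckj=jsjk=jwjj=jck=qnqq=jsjk=jvj=jwj'' @
    ''j99=tc~uq78delnmoprqs.;~unno.;u=usuu~ullm.78delnmoprqs.78delomnprqs.;=unuuu~tq78delnmopr'' @
    ''qs.;~tnno.;t=tstt~tllm.78delnmoprqs.78delomnprqs.;=tnttt~hvvw.;=9q~9rrs.;=jrjk=kcjk=kqjk'' @
    ''=krk=ksjk=kwkk9~vnno.;p=blbb~bnno.;p~nttu.;=qjqq=nw=qjqq~bllm.;~lffg.;ngf~ottu.;t=uruu~l'' @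
    ''ttu.;=trtt=tc=uruu=tm=trtt~trrs.;tt~nffg.;nfg=nqnnb=blbb~9rrs.;9=jrjk=rkkj~rllm.;rv=rvrr'' @
    ''9hh~bllm.78delnmoprqs.78delomnprqs.;~bnno.;~fl78delnmoprqs.;fg~fm78delnmoprqs.;fgfbb~hll'' @
    ''m.78delnmoprqs.78delomnprqs.;~hnno.;~fvvw.;hgffg~hrrs.;~hvvw.;r=lbllhh=fa=gngg=fm=fnff~f'' @
    ''nno.;ff~hppq.78delnmoprqs.78delnmopsqr.;~hrrs.;~hvvw.;~9q78delnmoprqs.;=9s=pa~affg.;a=rl'' @
    ''rr=awaa=rw=pnpp=av=rlrr~affg.;a=pnpp=ara=awaa9=ra=afaa=av=pnpp=vw=rlrr~wnno.;=rlrr~vbbc.'' @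
    '';~bnno.;p=vlvv~vnno.;p~qjjk.;qjk=qnqq=vlvv~pnno.;=vlvvp9hh=pa~pnno.;=fn=flff~fllm.;fg=fo'' @
    ''ffp=pnpphii~ittu.tv.tw.;~iuuv.uw.;~ivvw.;~h99a.0312467d8e9bacfjgklpmqnros.0312467d8e9cab'' @
    ''fjgklpmqnros.172d9lambpcq.172d9malbpcq.182e9naobrcs.182e9oanbrcs.031d27468e9paqblcmfjgkn'' @
    ''ros.031d27468e9qapblcmfjgknros.031e28467d9rasbncofjgklpmq.031e28467d9sarbncofjgklpmq.;~h'' @
    ''llm.78delnmoprqs.78delomnprqs.;~hrrs.;r~hnno.;~fa172d9lambpcq.;gf=fof=fwffh~fa172d9lambp'' @
    ''cq.;=gngg~fnno.;ff~hppq.78delnmoprqs.78delnmopsqr.;~9rrs.;9h=9w99hhiiieedd8877'')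
    33 (frame 7 @ [(7, 13), (8, 14)]) ([])"
  by code_simp

lemma split_33: "refutes (
    ''~7llm.ln.lo.lp.lq.lr.ls.lt.lu.lv.lw.;~7mmn.mo.mp.mq.mr.ms.mt.mu.mv.mw.;~8nno.np.nq.nr.ns'' @
    ''.nt.nu.nv.nw.;~8oop.oq.or.os.ot.ou.ov.ow.;~dppq.pr.ps.pt.pu.pv.pw.;~dqqr.qs.qt.qu.qv.qw.'' @
    '';~frrs.rt.ru.rv.rw.;~fsst.su.sv.sw.;~g99a.172d9lambpcq.172d9malbpcq.;~gllm.;~gttu.tv.tw.'' @
    '';~9ppq.;~9uuv.uw.;~lbbc.;~lvvw.;~bhhi.0413567g8f9daehjikmtnrosqu.0413567g8f9daehkijmtnro'' @
    ''squ.0413586f7g9daehniojrksmtqu.0413586f7g9daehoinjrksmtqu.5f68hrisjnko.5f68hsirjnko.;~bn'' @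
    ''no.;=npnh=pii~oc172d9lambpcqhiuv.293gbpcudlethiqv.172l3g9damcvetqu.;=ct=oqooc=oqo=tjtt=o'' @
    ''to=ouooo~pjjk.;~jc172l3g9damcvetqu.;~jrrs.;=cmrvaict=oior=sqss=ouors=ovooj=qa=ioii=qoiq='' @
    ''ocoo=iwiw=ocooi=occo=oto=waww=ovovo=jrjjp~hq172l3g9damcvetqu.;nhhn=poo~ic172l3g9damcvetq'' @
    ''u.;=cm=iqiic=imi=mrmm=iqi=iuii~ia172l3g9damcvetqu.;=imii~iq172l3g9damcvetqu.;ii~prrs.;~r'' @
    ''c172l3g9damcvetqu.;~rjjk.;=ctjveocm=ioij=kqkk=iqijk=iviir=qioq=icii=owow=iciio=icci=imi='' @
    ''weww=ivivi=rjrrp~brrs.;=hp~pnno.;hn~rjjk.;~jq172l3g9damcvetqu.;rjqtoj=eur=kckk=eoeorte=r'' @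
    ''qkt=ruktrr=cioc=iqii=owow=iqiio=iqiq=iuiui=weww=ps~hnno.;~ne293gbpcudletqvrs.;=nt~eu172d'' @
    ''9lambpcqrsuv.;=ev~tc172d9lambpcqrsuv.;o=qaa=aiaa=ow=tjtto=aiaim=aqaim=ava=awaa~ejjk.;=jr'' @
    ''jru=aqaa=uwajvim=skjks=kvjks=vij=mumm=iua=ummiomi=oqoou=rwjmv=iaii=rk=jwkmq=iaiij=swkq=v'' @
    ''avvs=kwmv=iaiik=twoqvt=ciaqv=cwamqvc=mwioqm=ia=io=waww=iwa=oqooiaior=jwkmtj=sckoqtw=swko'' @
    ''qvase=mumio=qjqq=mwmio=qjqqm=tw=ejee=ow=ejee=cw=ejee=qw=ejee~ejjk.;e~jr172d9lambpcqrsuv.'' @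
    '';jrumoj=uouvw=urruwauen=cwai=otoo=qwmi=otoo~wu172d9lambpcqrsuv.;aio=tjtt~eu172d9lambpcqr'' @
    ''suv.;=iq=mumm=iv=mumm=ev=avaio=tjtt=awaimoa~ujjk.;e~ejjk.;=ummuwijo=qkqqmuai=rkc=oqoo=rq'' @
    ''=otoore=ejeenh~ia172d9lambpcqrsuv.;a~inno.;imn=wewwiam~wnno.;n=tjtt~we293gbpcudletqvrs.;'' @
    ''~enno.;n~ejjk.;=jrjje=ejeewp~hnno.;n=csai=ouoo=qsmio=vjvv=suaio=wjww=svmi=oqoo~rq172l3g9'' @
    ''damcvetqu.;=ci=aqaa=ru=aqaio=sjssa=imimo=msmm~qjjk.;r~rjjk.;=qaaisw=coccaqim=skvwj=sw=oc'' @
    ''oosr=rjrrh~hnno.;=nphn~hq172l3g9damcvetqu.;=ne=nt=psqa=pwqa=tc~tjjk.;=jsjcmj=pkekoq=popr'' @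
    ''ikp=cmmqsack=csamqctq=mcmi=mimi=mum=mwmm=qw=tjttqa=ew=tjtt~pjjk.;teosu=ckcc=mi=poppm~tjj'' @
    ''k.;t=jrjj=twtt=nu=rp~pjjk.;ruejk~rjjk.;=pwjuekmp=ekjkuw=ewumqswae=jwukmj=ickum=iwkucmi=v'' @
    ''samqsw=vwamsuv=awou=ckcca=qwmsuq=ows=ukuuo=ck=cm=wkww=cwk=msmmcckmrp=ovoioi~ejjk.;c=ukuu'' @
    ''e=vs=asaavaq~sjjk.;jk=sms=mumm=qw=rjrr=ow=rjrr=cw=rjrr=sw=rjrr~rjjk.;r=jpj=jujje=tc=kpkk'' @
    ''toc=qsm=pippq=asa=skss=ava=ukuu=awaarn=twqa=psqa=aqaq~vjjk.;sto=vev=opoi=ouoio~tjjk.;c=s'' @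
    ''ksst=mi=vovv=ou=ejee=ovvoivm~sjjk.;=jejjsq=piam=ejee=pwaimo=scaim=opoo=suaim=opoo=too~tj'' @
    ''jk.;cprt~pjjk.;tsac=imii=pop=prpp=ntnqan=po=rjrr=ps=rjrr~pjjk.;prp=qs=mummqa~ujjk.;rsue='' @
    ''ummu=wjwwuh=pww~ne172l3g9damcvetqu.;=nt=pr~rjjk.;=jejjr=po=piio~ejjk.;ptoveijkeo~pjjk.;c'' @
    ''i=jrjjp~pjjk.;pjspamw~sjjk.;=jejjsn=mw=ujuu~pjjk.;eu=popio=psmppm~rjjk.;juekrn=po=rjrr=p'' @
    ''s=rjrr~pjjk.;prp~qjjk.;ruwa=qtqwmq=rp=pi~rjjk.;~hq172l3g9damcvetqu.;=hu~je172l3g9damcvet'' @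
    ''qu.;=jt~ic172l3g9damcvetqu.;k=vaa=asaa=kw=iniik=asa=vnvv=avas=cncc=awaaj=kvk=iniik~cnno.'' @
    '';cmtucjhj=aqaskm=asaskm=ava=awaahrh~sa172l3g9damcvetqu.;a~sjjk.;swj=smssam~qnno.;n=tjtt~'' @
    ''unno.;no=sjss~wjjk.;jkq=qsuw~sjjk.;scjksqwu~sjjk.;svjk=svss~jq172l3g9damcvetqu.;hpr=qkhp'' @
    ''r=kuhpr~pjjk.;rhj=cskc=sqss=kwkw=sqssk=sqqs=susus=wewwph=qs=mimm=us=aiaa~sc172l3g9damcve'' @
    ''tqu.;=aiaa~jc172l3g9damcvetqu.;rs=mimm=jsrkj=jwrsjs=aiakm=aqak=mimm=avaa=cwh=rjrr=vwh=rj'' @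
    ''rr~rjjk.;=jpjr~jq172l3g9damcvetqu.;hr=jwhrj~kq172l3g9damcvetqu.;hr=kwhr~rq172l3g9damcvet'' @
    ''qu.;hqa=icksc=mumm~inno.;iirh=wpwwam~inno.;i=nenn=ipii~hq172l3g9damcvetqu.;rh=hwhhb=hp~p'' @
    ''nno.;h~hnno.;n~qrrs.;pmi=ovoo=rupai=ocoo=uspai=ocoo~prrs.;~sc172l3g9damcvetqu.;aio=ujuu~'' @
    ''rc172l3g9damcvetqu.;=iq=mcmm=iv=mcmm=rv=asaimo=avaio=sjssa~cjjk.;r~rjjk.;=cmmswacjkcmai='' @
    ''skuwj=sw=oqoosr=rjrrph~hnno.;=nph~hq172l3g9damcvetqu.;=eo=ntnn=ne=nt~qrrs.;qaqn=ov=ejee~'' @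
    ''pjjk.;eu=ev~vjjk.;e~ejjk.;u=pot=piio=pw=krkkp=oco=ckcco=tj=wkwwt~jrrs.;jkmp=jwjje=ejee=n'' @
    ''tnnhh=qa~qrrs.;a=qt~arrs.;a=rm=mim=iniim~rjjk.;sw=rw=sjssr~rjjk.;rw=rwrra~qnno.;~arrs.;a'' @
    ''n=tjtt=avaaq~qnno.;qn=tjtt~prrs.;q=mimm=ic=araa=qt~qrrs.;=sv=mimm=um=ara=inii=asa=inii=a'' @
    ''vaam=asaa~unno.;iun=ejeeu~cjjk.;srj~cnno.;cino=wjww=ctccq=qrqqbll~phhi.0413567g8f9daehji'' @
    ''kmtnrosqu.0413567g8f9daehkijmtnrosqu.0413586f7g9daehniojrksmtqu.0413586f7g9daehoinjrksmt'' @
    ''qu.5f68hrisjnko.5f68hsirjnko.;~pnno.;~hbbc.;~bvvw.;h=oc=nvnn~crrs.;=nvnn~cvvw.;h=ncnn~hv'' @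
    ''vw.;n=cm=cii=mrmm=bobo=tjtt=ct=brbb~cjjk.;~mrrs.;bjr=sqssmi~brrs.;bjrsvw=btbbc~cjjk.;ctc'' @
    ''=imi=mrmm=iq=tjtt=iuiih=hvhh~prrs.;~hnno.;~hbbc.;=ne=nt=bmbm=as=bvbb=qim=sjss=qsmi=ovoo='' @
    ''ic=avaa=iu=avaa~ivvw.;b=mcmmi=oq=avaa=oum=sjss~ovvw.;aboo~evvw.;n=ou=ejee~nvvw.;=va~qjjk'' @
    ''.;evaiqs=bsaiqmo=bwbbm~vjjk.;e=sassv=bsaio=tjtt=bwbbm~ejjk.;esuvak=eueen=ntn~nvvw.;nn~nv'' @
    ''vw.;h~hvvw.;=nen=vaav=ms=vbvv=qi=mbmm~ibbc.;a=sjss=iua=sjss=iw=mbmmi~obbc.;mvo=qjqq=oqao'' @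
    ''=qjqq=ou=mbmm=owoo=to=nbnn=vaav~qjjk.;seo=rw~wjjk.;seo~rbbc.;w~ujjk.;rsue~ejjk.;j=kbkk=e'' @
    ''oeo=euee~obbc.;n=rjrr~rbbc.;n~rjjk.;sb=ckccr=rjrr~ibbc.;anv=bsaino=ujuu=scaino=ujuu=vev='' @
    ''iq=mbmm=iu=asaa=iw=mbmmi=eoo=ujuu~ejjk.;e=umuu=euee=ms=vbvv~rbbc.;nv=iq=mbmm=iua=rjrr=iw'' @
    ''=mbmmi~obbc.;mnvo=qjqq=oqa=rjrr=ou=mbmm=ow=rjrroh~hbbc.;~bvvw.;h~hvvw.;=bmm=bt~ujjk.;sr='' @
    ''cicc=sa~sjjk.;=awrc=jcrjk=qnqq=jej=enee=jq=aiaa=jwjjs=sjss~bnno.;=ntn=tjttn~rjjk.;rscjkq'' @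
    ''rb=bt~bnno.;=nq=tjttn~rjjk.;rcmrb=avaa~tnno.;vin~inno.;ivnoi~bnno.;b=bsbbh=hvhhpp9~tuuv.'' @
    ''uw.;9=lbll~lbbc.;~buuv.uw.;9l~cuuv.uw.;9l~luuv.uw.;9~bhhi.5f68hrisjnko.5f68hsirjnko.;~bn'' @
    ''no.;~hppq.;~pvvw.;h=oq=nvnn~qrrs.;=nvnn~qvvw.;h=nqnn~hvvw.;n=pa=qiiq=tjtt~qjjk.;qt=qtqq='' @
    ''popo=tjtt=qt=prpp=qiqi=araa=pt~prrs.;~tjjk.;qrj=kckkto=immv=iui=uruuip=prpph=hvhh~brrs.;'' @
    ''~hnno.;~hppq.;=ne=nt=paap=ms=pvpp=cia=pvpp=csai=ovoo=iq=mvmm=iu=mvmm~ivvw.;imi=co=cjcc=o'' @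
    ''ua=pvpp~ovvw.;mopo~evvw.;n=ou=ejee~nvvw.;=vm~cjjk.;evmsu=psmicop=pwppa~vjjk.;e=sjssv=psm'' @
    ''iop=pwppa~ejjk.;esuvkm=eueen=ntn~nvvw.;nn~nvvw.;h~hvvw.;=nen=vmmv=as=vpvv=ci=apaa~ippq.;'' @
    ''m=sjss=ium=sjss=iw=apaai=oc=cjcc~oppq.;ao=pjpp=ou=apaa=owoo=to=npnn=vmmv~cjjk.;seo=aic=n'' @
    ''pnn=rw~wjjk.;seo~rppq.;w~ujjk.;rs=apaa~ejjk.;j=kpkk=eoeo=euee~oppq.;n=rjrr~rjjk.;s~rppq.'' @
    '';a=ktkkr=rprr~ippq.;mnv=psmnio=ujuu=sqmnio=ujuu=vev=ic=apaa=iu=msmm=iw=apaai=eoo=ujuu~ej'' @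
    ''jk.;e=uauu=euee=as=vpvv~rppq.;nv=ic=apaa=ium=rjrr=iw=apaai=ocm=rjrr~oppq.;ano=pjpp=ou=ap'' @
    ''aa=owm=rjrroh~hppq.;~pvvw.;h~hvvw.;=paa=pt~ujjk.;sr=kckk=sm~sjjk.;=jej=enee=jqrj=mimm=jw'' @
    ''j=mimmjs=sjss~pnno.;=ntn=tjttn~rjjk.;rsqjk=mvmm=rqrrp=pt~pnno.;=nc=tjttn~rjjk.;rqa=rqrrp'' @
    ''=mvmm~tnno.;vin~inno.;vnoi~pnno.;p=pspph=hvhhb~bjjk.5f68hrisjnko.5f68hrisjokn.;~bnno.;~j'' @
    ''rrs.;~jppq.;=rar=ptpt=eo=pvpp=ck=evee=kq=evee=kut=ohoo~kvvw.;kp=tottk=sc=chcc=su=evee~sv'' @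
    ''vw.;epss=ms=rvrr=pttp~chhi.;oas=ekc=rvrr=nq~qhhi.;oas~nvvw.;q~uhhi.;noua~ahhi.;h=ivii=as'' @
    ''as=auaa~svvw.;r=nhnn~nhhi.;o~nvvw.;e=imiin=nvnn~kvvw.;rtp~ovvw.;rtks=uhuu=pap=kc=evee=kq'' @
    ''=evee=ku=tottk=ass=uhuu~ahhi.;a=ueuu=auaa=eo=pvpp~nvvw.;pr=kc=evee=kq=evee=kuktuk=sct=nh'' @
    ''nn=sq=nhnn=su=evee~svvw.;rss~rvvw.;j~jvvw.;=ra=rm=veev=to=vpvv=cke=ohoo=coek=spss~kppq.;'' @
    ''e=ohoo=ku=tptt=kw=tpttk=cs=chcc~sppq.;tvs=uhuu=sue=ohoo=swss~appq.;r=su=ahaa~rppq.;=pt~c'' @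
    ''hhi.;aptu=votkces=vqvve~phhi.;a=ohoop=votksv=vqvve~ahhi.;aopuwikqt=auaar=rmr~rppq.;rrj~j'' @
    ''ppq.;~pvvw.;j~jvvw.;=ptt=pa~chhi.;on=qhqq=oe~ohhi.;=ewnq=hmh=mrmm=hqnhi=uruu=hu=ekee=hwh'' @
    ''ho=ohoo~prrs.;=rar=ahaar~nhhi.;noqhik=mcmm=nqnnp=pa~prrs.;=ru=ahaar~nhhi.;nqt=nqnnp=evee'' @
    ''~arrs.;vkr~krrs.;vrs=ktkk=pop~prrs.;ppj=jvjjbbl~9uuv.uw.;l99g~gttu.tv.tw.;~guuv.uw.;~9pp'' @
    ''q.;~9vvw.;~phhi.5f68hrisjnko.5f68hsirjnko.;~pnno.;~hbbc.;hn=hwhh~prrs.;~hnno.;~hbbc.;~rj'' @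
    ''jk.;=rc~bllm.;=bsai~cttu.;cmov=ejeec~lttu.;blnacim=otoo=bwalsve=mvlmsai=qtqq~bttu.;=mslm'' @
    ''nsa=cicc=lwmncl=swmncs=ciakv=enee=awcmia=iwk=nenni=kevk=nenn=kukq=kwkkb=bsa=qo=ilii=ow=i'' @
    ''lii~ottu.;onqsbk=ovo=ejeeo=aw=btbba=iw=btbb=nw=btbb=qo=ilii=eo=ntnn~ottu.;noq=slsso~illm'' @
    ''.;s=qtqqir=eo=ntnn=vi=asaa~bllm.;~lttu.;blntvaimo=bsalsv=ejee=lslsv=ejeel=asasi=qtqqai=w'' @
    ''ee=vovv~wttu.;bmn=ouoow=as=btbba=qo=ilii~ottu.;nobo=je=enee=ev=ntnne~illm.;vkmir=eo=ntnn'' @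
    ''~bllm.;~lttu.;bnai=otoo=mv=lsll=bsail~mttu.;=ouoom~bttu.;n=awai=otooa=io=otoo=iwilmib=as'' @
    ''=btbba=oq=ilii~ottu.;no=ovooh=vs=aiaa~sbbc.;=aiaa~rjjk.;~jbbc.;r=ek=jtjj~rbbc.;=bia=qk=s'' @
    ''lss~bllm.;s~kttu.;jk=mumm=kvik=mtmmk~kttu.;jkbk=ne=ejee=ev=jtjje~sllm.;vms~bllm.;~lttu.;'' @
    ''b=liliv=eneel=aiaisveas=wee=vivv~wttu.;bjmquw=btbbr=rbrr=rw=hbhh=jw=hbhh=kw=hbhh~sbbc.;a'' @
    ''=hbhh~rjjk.;~jbbc.;r=ek=jtjj~kbbc.;hr~rbbc.;h=bia=kq=slss~kttu.;jk=kvkk~bllm.;~lttu.;b~b'' @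
    ''ttu.;j=awas=ktkka=sk=ktkk=ktkkb=btbbr=rbrrp~ibbc.;=araa=iv=araa~hnno.;=iqi=araa~nbbc.;h='' @
    ''eo=ntnn~hbbc.;~bllm.;i=oq=araa~bttu.;n=ov=ejee=oco=wjwwo=tq=araa=mc=wjww~mrrs.;alm=qjqq='' @
    ''mum=mv=lrllm~lrrs.;b~lttu.;l=lvll~crrs.;a=btbb~brrs.;a=qo=ilii~bttu.;n=ov=ejee=oco=wjwwo'' @
    ''~ejjk.;equwk=eveeb=btbbh=hbhh~pjjk.5f68hrisjnko.5f68hrisjokn.;~pnno.;~jrrs.;~jbbc.;~nhhi'' @
    ''.;=nc=boe=vs=ktkk=sw=ktkk~sllm.;srva=ilii=sqs=ahaas=cke=vi=otoo=iw=otoo~illm.;ihvk=slss='' @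
    ''ioi=araa=iqii~bttu.;~tllm.;bcekrtu=slss=bwetoq=rlrr=out=clcc=uqtukoqei~bllm.;=twcut=owcu'' @
    ''o=ewcuehie=iaqr=skss=imiq=rmrr=iwiib=ew=blbbe=kw=blbb=rw=blbb=vs=ktkk=as=rlrr~sllm.;rs=b'' @
    ''lbbs~kttu.;o=vlvvkn=as=rlrr=qk=eoee=boe=vs=ktkk~bttu.;k~sllm.;s=umuu=sqos=uluus~sllm.;rs'' @
    ''bs=ha=aqaa=aq=rlrra~kttu.;quk~bttu.;~tllm.;b=totoq=rlrrt=eoeok=vlvvek=waa=qoqq~wllm.;bru'' @
    ''vahw=blbbn=as=rlrr=boe~sllm.;=skss=sq=skss=sv=ktkks~bttu.;~tllm.;b~bllm.;r=ewek=slsse=ks'' @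
    ''=slss=slssb=blbbj=qo=ekee~obbc.;=ekee~nhhi.;~hbbc.;n=ai=hlhh~nbbc.;=bke=vi=otoo~bttu.;o~'' @
    ''illm.;hi=umuu=iqik=uluui~illm.;hibi=qa=hlhh~qttu.;o=tkttq~bttu.;~tllm.;b=tktkq=araat=eke'' @
    ''koqs=uluueo=waa=qiqq~wllm.;bhuvaiw=blbbn=nbnn=nw=jbjj=hw=jbjj=iw=jbjj~obbc.;e=jbjj~nhhi.'' @
    '';~hbbc.;n=ai=hlhh~ibbc.;jn~nbbc.;j=bke~illm.;h=ioii=ioi=iqi=ivii~bttu.;~tllm.;b~bllm.;h='' @
    ''eweo=iliie=oi=ilii=iliib=blbbn=nbnnp~kbbc.;=enee=kq=enee~jrrs.;=kvk=enee~rbbc.;j=as=rlrr'' @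
    ''~jbbc.;~bttu.;k=sv=enee~bllm.;r=sq=ahaa=scs=whwws=lv=enee~mhhi.;alw=cncc=uc=whww~unno.;e'' @
    ''tu=vhvv=uqm=tnttu~tnno.;b=tqt=tltt~cnno.;e=blbb~bllm.;r=sq=ahaa~bnno.;e=sv=ktkk=scs=whww'' @
    ''s~ahhi.;avwi=aqaab=bnbbj=jbjjp99~ahhi.5f68hrisjnko.5f68hsirjnko.;~hppq.;=araa~arrs.;~rpp'' @
    ''q.;a~appq.;~rllm.;=im=hnhh~rjjk.;=hm~hnno.;=pk=po~jbbc.;=evee=jq=evee~jvvw.;je~nbbc.;=ev'' @
    ''ee=nq=evee~nvvw.;ne~qvvw.;eq=sbss=je~kvvw.;ew=vlvv~evvw.;ev=wlwwe=evee~kttu.;p~pttu.;=qo'' @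
    ''=tbtt=ou=tbtt~ovvw.;=tbtt~obbc.;oto~ivvw.;ew=vlvv~kbbc.;t=ilii~evvw.;ek=qiqqep=eo=ptpp=o'' @
    ''q=ptpp=po~ottu.;p~pttu.;=qk=tbtt=ku=tbtt~kvvw.;=tbtt~kbbc.;ktk~svvw.;ew=vmvv~obbc.;t=sms'' @
    ''s~evvw.;eo=qjqqep=ptpph=hnhhr=rjrra=apaaagg~ejjk.5f68hrisjnko.5f68hrisjokn.;~enno.;~ettu'' @
    ''.tv.tw.;g~nhhi.;~nuuv.uw.;~jrrs.;~jvvw.;~r99a.172d9lambpcq.172d9malbpcq.;~rllm.;~h9172d9'' @
    ''lambpcq.;~9ppq.;h~pk5f68hrisjnkolmuv.;=po=uk~ubbc.;kbl=ul=ks=li=qvqq=qvqa=ibii=qwqa=ibii'' @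
    ''q~lbbc.;bikc=sqssl=qvqa=sbss=qwqa=sbssqut=aiaq=aqaq=asaa=ul~ubbc.;lbkut=aiaq=aqaq=asaa=u'' @
    ''atu=aiaa=vq=ubuu=qw=ubuu=ksqa=ibii~kbbc.;kuoqst=kwkkp=uat=kbkk=avt=kbkk~vbbc.;kw=bibb=wo'' @
    ''=vmvv~kbbc.;kwstai=quqq=kskkp9=hm=tat=apaat~wppq.;p=kbkk~wk5f68hrisjnkolmuv.;~kppq.;p~kb'' @
    ''bc.;=blbbk=kbkkw~hppq.;p=vaa=vo=wq=qiqq=qiqa=qkqwa=quqq~vbbc.;=bmmbi=bobobvh~ha172d9lamb'' @
    ''pcq.;=hmt=li~ibbc.;lb=opooi~wbbc.;b=kpkk=lu~9ppq.;9pqa=9w99~sbbc.;lc=kpkk~lbbc.;bcms~kpp'' @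
    ''q.;uvkl=lu~ubbc.;lu~vbbc.;lc=opoo~wbbc.;bm~lbbc.;bcmv~ippq.;opil=9w=lbll~mbbc.;lcwbm=mw='' @
    ''lbllm~appq.;apq9=awaa~appq.;h~hppq.;=as=pvpp=ava=awaah~hbbc.172d9lambpcq.172d9lambqcp.;='' @
    ''blbl~hppq.;=9p9p=bv=bmmpsa=bspab=psbm=pvpab=msmm=pwb=mtmmphh~9ppq.;r~rppq.;=php9=uqq=kbk'' @
    ''k=waa=tltt=haa=vqqi=oboo=qi=qoqq=qk=qoqq=qoq=qsqq=bs=ataa=sc=ataa~hbbc.;~bllm.;bl=mimm=b'' @
    ''vbbh=pwp=9h99p9=uaa~hllm.;=uk=wq=qoqq=qoqwa=qsqa=qvqq~ubbc.;=bkkbm=bmblm=bsbbuhq=asai=tl'' @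
    ''tt=ata=avaar~rbbc.172d9lambpcq.172d9lambqcp.;~rppq.;=ph~h99a.;p9~vllm.;lbcim=vqqov=waa=t'' @
    ''ltt=wcoq=ataawk~cllm.;l=mbmm=cocch=uq=ovoo=vq=kukk=qi=kukk=qs=ovoo~p99a.;9q=kuka=ilii=kw'' @
    ''koakp=kwkk~q99a.;qw9a=qoq=ovoo=pu~u99a.;9p=hcuk=vcuk=cwuk~p99a.;9=kwukqao~hllm.;itawb=uc'' @
    ''k=hahhuk=oq=hahh~sllm.;cbhqa~vllm.;lmqwa=owov=wlwwo~cllm.;ilmcp=ukk~sllm.;cb=mtmm~vllm.;'' @
    ''lmb~cllm.;c=bhlm=bmb=lhll=bwbbcu=oi=ovoo=oq=ovoo=ovo=owoo~p99a.;=9h9p=9u9p=9wp9io9p~illm'' @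
    ''.;iwk=ioiip=owo=uc=oioo=cs=oioo=wkk~w99a.;=9h99w=oq=i9iio~cllm.;=lhllc~w99a.;w9=tlttw~i9'' @
    ''9a.;io=ioiirrj=jvjjn~nuuv.uw.;nne~ettu.tv.tw.;gee~ettu.tv.tw.;geeffdd8877'')
    33 (frame 7 @ [(7, 13), (8, 15)]) ([])"
  by code_simp

lemma nine_33: "refutes (
    ''~9ffg.;~9llm.;~9rrs.rt.ru.rv.rw.;~fsst.su.sv.sw.;~fttu.tv.tw.;~auuv.uw.;la=gvggaff9~9rrs'' @
    ''.rt.ru.rv.rw.;~9sst.su.sv.sw.;~fllm.;~fttu.tv.tw.;~guuv.uw.;lg=mrmmgf~fttu.tv.tw.;~fuuv.'' @
    ''uw.;=la=agg=ltlla=glg=gm=gvgg~gvvw.;gg~bvvw.;ag~cvvw.;ag~mrrs.;a=glgg~lttu.;l=mgmm~pvvw.'' @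
    '';ag~qvvw.;ag~rvvw.;ag~svvw.;ag=lg=agag=ama=gvgg~avvw.;aa~mttu.;ga~mvvw.;=lrllmff99~9llm.'' @
    '';~9rrs.rt.ru.rv.rw.;~9sst.su.sv.sw.;~lffg.;~lttu.tv.tw.;~muuv.uw.;fm=avaaml~lttu.tv.tw.;'' @
    ''~luuv.uw.;=fa=ammaa=fmf~fttu.;ff~bvvw.;am~cvvw.;am~grrs.;a=mfmm~fttu.;f=gmgg~pvvw.;a=frf'' @
    ''f~qvvw.;a=frff~rvvw.;a=frff~svvw.;a=frff=fm=aga=frff=ama=frff~avvw.;aa~gttu.;ma~gvvw.;=f'' @
    ''rffgll99~9rrs.rt.ru.rv.rw.;~9sst.su.sv.sw.;~9ttu.tv.tw.;~affg.;~allm.;~fuuv.uw.;laf~guuv'' @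
    ''.uw.;a=flff~grrs.rt.;=glggg~allm.;~muuv.uw.;a=lfll~mrrs.rt.;=mfmmma~bhhi.;=bnbb~bnno.;bb'' @
    ''999'')
    33 (frame 9) (bars_at 9 4)"
  by code_simp

lemma eleven_33: "refutes (
    ''~bhhi.;=brbb~brrs.;bb'')
    33 (frame 11) (bars_at 11 4 @ bars_at 11 5)"
  by code_simp

lemma tight_33: "refutes (
    ''=l8=8r8=8t8=8v8=lc=crc=cs8c=ctc=cu8c=cvc=cwccl=ds8br=du8bt=dw8bv=js8b=ju8b=jw8b=sk8bjk=b'' @
    ''r8j=ktkk=r78br=uk8bjk=bt8j=krkk=t78bt=7ode7=8s88=7qde7=8s88=kw8bjk=bvj=krkk=7v8bv=ocde7='' @
    ''oh=odoo=n9n=odoo=nan=odoo=7pnp=7s87d=euee=7u87d=esee=7w78d=esee7=la=ara=ata=ava=mjl=mkl='' @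
    ''dm=mhmm=lk=krk=ksak=ktk=kuak=kvk=kwkkl=hsajr=huajt=hwajv=bsaj=buaj=bwaj=s7ajs=t8tt=s8ajb'' @
    ''=dudd=scajs=jrab=ctcc=r9ajr=8uajb=dsdd=u7aju=v8vv=ucaju=jtab=crcc=t9ajt=9ohijv=asaa=9qhi'' @
    ''jv=asaa=cwajbc=jvb=crcc=9vajv=okhij=do=ohoo=n7n=ohoo=n8n=ohoo=9pnp=9sa9h=iuii=9ua9h=isii'' @
    ''=9w9ah=isii9=lc=crc=ctc=cvc=dsced=duced=dwced=bodec=bqdec=bsced=buced=bwced=rj=bnbb=tj=b'' @
    ''nbb=vj=bnbb=jsc=bnbb=juc=bnbb=jwc=bnbb=bnjln=p9pp=bpjlp=n9nn=brb=btb=bvbb=mj=l7ll=ljl=md'' @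
    ''m=n7nmp=oeoo=n8n=m7mm=m7mnp=mcmnpm=nanp=qeqq=ncn=p7pp=nknn=lkl=krk=ktk=kvk=hsk9=huk9=hwk'' @
    ''9h=iski=iuik=iwii=l9ll=mhm=n9nmp=odoo=nan=m9mm=m9mnp=mkmnpm=n8np=qdqq=ncn=p8pp=nknn'')
    33 (frame 7 @ tight_edges) (tight_bars)"
  by code_simp

section \<open>Shortest odd cycles\<close>


context girth6_quartic
begin

lemma adj_in2: "adj x y \<Longrightarrow> y \<in> V"
  using adj_in sym by blast

lemma finite_nbrs: "finite {y. adj x y}"
  using finite_subset[OF _ finite_V] adj_in2 by blast

text \<open>
Around an edge \<open>u v\<close> the 2 ends, their 3 + 3 further neighbours and the 9 + 9
vertices beyond are all different, for a coincidence would close a cycle of length at most 5.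
\<close>
lemma moore_bound:
  assumes "V \<noteq> {}"
  shows "26 \<le> card V"
proof -
  let ?N = "\<lambda>x. {y. adj x y}"
  obtain u where u: "u \<in> V" using assms by blast
  have "?N u \<noteq> {}" using degree[OF u] by force
  then obtain v where uv: "adj u v" by blast
  have v: "v \<in> V" using adj_in2[OF uv] .
  define A where "A = ?N u - {v}"
  define B where "B = ?N v - {u}"
  define L where "L = (\<Union>x\<in>A. ?N x - {u})"
  define M where "M = (\<Union>y\<in>B. ?N y - {v})"
  have three: "card (?N x - {y}) = 3" if "adj x y" for x y
    using degree[OF adj_in[OF that]] that by simp
  have nine: "card (\<Union>x\<in>S. ?N x - {w}) = 9" if S: "S \<subseteq> ?N w" "card S = 3" for S w
  proof -
    have fin: "finite S" using S finite_nbrs finite_subset by blast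
    have "card (\<Union>x\<in>S. ?N x - {w}) = (\<Sum>x\<in>S. card (?N x - {w}))"
    proof (rule card_UN_disjoint)
      show "\<forall>x\<in>S. \<forall>y\<in>S. x \<noteq> y \<longrightarrow> (?N x - {w}) \<inter> (?N y - {w}) = {}"
      proof (intro ballI impI equals0I)
        fix x y z assume xy: "x \<in> S" "y \<in> S" "x \<noteq> y" and z: "z \<in> (?N x - {w}) \<inter> (?N y - {w})"
        then have "adj w x" "adj x z" "adj z y" "adj y w" using S sym by auto
        from no_square[OF this] xy z show False by auto
      qed
    qed (use fin finite_nbrs in auto)
    also have "\<dots> = (\<Sum>x\<in>S. 3)" using S(1) sym by (intro sum.cong refl three) auto
    also have "\<dots> = 9" using S by simp
    finally show ?thesis .
  qed
  have A: "card A = 3" "A \<subseteq> ?N u" and B: "card B = 3" "B \<subseteq> ?N v"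
    using three[OF uv] three[OF sym[OF uv]] by (auto simp: A_def B_def)
  have LM: "card L = 9" "card M = 9" using nine[OF A(2,1)] nine[OF B(2,1)] by (simp_all add: L_def M_def)
  have mem: "x \<in> A \<longleftrightarrow> adj u x \<and> x \<noteq> v" "x \<in> B \<longleftrightarrow> adj v x \<and> x \<noteq> u"
    "x \<in> L \<longleftrightarrow> (\<exists>y. adj u y \<and> y \<noteq> v \<and> adj y x \<and> x \<noteq> u)"
    "x \<in> M \<longleftrightarrow> (\<exists>y. adj v y \<and> y \<noteq> u \<and> adj y x \<and> x \<noteq> v)" for x
    by (auto simp: A_def B_def L_def M_def)
  have dAB: "A \<inter> B = {}"
  proof (rule equals0I)
    fix z assume "z \<in> A \<inter> B"
    then show False using no_triangle[OF uv, of z] sym[of u z] by (auto simp: mem)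
  qed
  have dAL: "A \<inter> L = {}"
  proof (rule equals0I)
    fix z assume "z \<in> A \<inter> L"
    then obtain y where "adj u z" "adj u y" "adj y z" by (auto simp: mem)
    then show False using no_triangle[of u y z] sym[of u z] by blast
  qed
  have dBM: "B \<inter> M = {}"
  proof (rule equals0I)
    fix z assume "z \<in> B \<inter> M"
    then obtain y where "adj v z" "adj v y" "adj y z" by (auto simp: mem)
    then show False using no_triangle[of v y z] sym[of v z] by blast
  qed
  have dBL: "B \<inter> L = {}"
  proof (rule equals0I)
    fix z assume "z \<in> B \<inter> L"
    then obtain y where "adj v z" "z \<noteq> u" "adj u y" "y \<noteq> v" "adj y z" by (auto simp: mem)
    then show False using no_square[of u y z v] sym[of v z] sym[OF uv] by blast
  qed
  have dAM: "A \<inter> M = {}"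
  proof (rule equals0I)
    fix z assume "z \<in> A \<inter> M"
    then obtain y where "adj u z" "z \<noteq> v" "adj v y" "y \<noteq> u" "adj y z" by (auto simp: mem)
    then show False using no_square[of v y z u] sym[of u z] uv by blast
  qed
  have dLM: "L \<inter> M = {}"
  proof (rule equals0I)
    fix z assume "z \<in> L \<inter> M"
    then obtain x y where "adj u x" "adj x z" "adj v y" "adj y z" by (auto simp: mem)
    then show False using no_pentagon[of u x z y v] sym[of y z] sym[of v y] sym[OF uv] by blast
  qed
  have duv: "u \<notin> A" "u \<notin> B" "u \<notin> L" "v \<notin> A" "v \<notin> B" "v \<notin> M" "u \<noteq> v"
    using irrefl uv by (auto simp: mem)
  have dvL: "v \<notin> L"
  proof
    assume "v \<in> L"
    then obtain y where "adj u y" "adj y v" by (auto simp: mem)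
    then show False using no_triangle[of u y v] sym[OF uv] by blast
  qed
  have duM: "u \<notin> M"
  proof
    assume "u \<in> M"
    then obtain y where "adj v y" "adj y u" by (auto simp: mem)
    then show False using no_triangle[of v y u] uv by blast
  qed
  have fin: "finite A" "finite B" "finite L" "finite M" using A B LM by (auto intro: card_ge_0_finite)
  have "card ({u, v} \<union> (A \<union> (B \<union> (L \<union> M)))) = 2 + (3 + (3 + (9 + 9)))"
  proof -
    have "card (L \<union> M) = 9 + 9" using card_Un_disjoint[OF fin(3,4) dLM] LM by simp
    moreover have "card (B \<union> (L \<union> M)) = card B + card (L \<union> M)"
      by (rule card_Un_disjoint) (use fin dBL dBM in auto)
    moreover have "card (A \<union> (B \<union> (L \<union> M))) = card A + card (B \<union> (L \<union> M))"
      by (rule card_Un_disjoint) (use fin dAB dAL dAM in auto)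
    moreover have "card ({u, v} \<union> (A \<union> (B \<union> (L \<union> M)))) = card {u, v} + card (A \<union> (B \<union> (L \<union> M)))"
      by (rule card_Un_disjoint) (use fin duv dvL duM in auto)
    ultimately show ?thesis using A B duv by simp
  qed
  moreover have "{u, v} \<union> (A \<union> (B \<union> (L \<union> M))) \<subseteq> V"
    using u v adj_in2 by (auto simp: mem)
  from card_mono[OF finite_V this]
  have "card ({u, v} \<union> (A \<union> (B \<union> (L \<union> M)))) \<le> card V" .
  ultimately show ?thesis by simp
qed

definition arcs :: "('a \<times> 'a) set" where
  "arcs = {(x, y). adj x y}"

lemma walk_sym: "(x, y) \<in> arcs ^^ k \<Longrightarrow> (y, x) \<in> arcs ^^ k"
proof (induction k arbitrary: y)
  case (Suc k)
  then obtain z where z: "(x, z) \<in> arcs ^^ k" "(z, y) \<in> arcs" by auto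
  then have "(y, z) \<in> arcs" using sym by (simp add: arcs_def)
  then show ?case using Suc.IH[OF z(1)] by (rule relpow_Suc_I2)
qed simp

lemma walk_add: "(x, y) \<in> arcs ^^ k \<Longrightarrow> (y, z) \<in> arcs ^^ l \<Longrightarrow> (x, z) \<in> arcs ^^ (k + l)"
  by (auto simp: relpow_add)

text \<open>
Otherwise the parity of the walks from a root splits \<open>V\<close> into two classes with all
edges between them. Counting edges from both sides, the classes have equal size, and the order is
even.
\<close>
lemma odd_closed_walk:
  assumes conn: "\<And>x y. x \<in> V \<Longrightarrow> y \<in> V \<Longrightarrow> adj\<^sup>*\<^sup>* x y" and odd: "odd (card V)"
  shows "\<exists>k x. odd k \<and> (x, x) \<in> arcs ^^ k"
proof (rule ccontr)
  assume no: "\<not> ?thesis"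
  have "V \<noteq> {}" using odd by auto
  then obtain r where r: "r \<in> V" by blast
  define P where "P = {v \<in> V. \<exists>k. even k \<and> (r, v) \<in> arcs ^^ k}"
  define Q where "Q = V - P"
  have one: "b \<in> P \<longleftrightarrow> a \<notin> P" if ab: "adj a b" for a b
  proof
    have ar: "(a, b) \<in> arcs ^^ 1" using ab by (simp add: arcs_def)
    show "a \<notin> P" if bP: "b \<in> P"
    proof
      assume aP: "a \<in> P"
      then obtain k l where kl: "even k" "(r, a) \<in> arcs ^^ k" "even l" "(r, b) \<in> arcs ^^ l"
        using aP bP by (auto simp: P_def)
      have "(r, r) \<in> arcs ^^ (k + 1 + l)" using walk_add[OF walk_add[OF kl(2) ar] walk_sym[OF kl(4)]] .
      then show False using no kl by (metis even_add odd_one)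
    qed
    show "b \<in> P" if "a \<notin> P"
    proof -
      have a: "a \<in> V" using adj_in[OF ab] .
      have "(r, a) \<in> arcs\<^sup>*" using conn[OF r a] by (simp add: arcs_def rtranclp_rtrancl_eq)
      then obtain k where k: "(r, a) \<in> arcs ^^ k" using rtrancl_imp_relpow by blast
      then have "odd k" using that a by (auto simp: P_def)
      then show ?thesis using walk_add[OF k ar] adj_in2[OF ab] by (auto simp: P_def intro!: exI[of _ "k + 1"])
    qed
  qed
  have fin: "finite P" "finite Q" using finite_V by (auto simp: P_def Q_def)
  have S: "card (SIGMA a:X. {b. adj a b}) = 4 * card X" if "X \<subseteq> V" for X
  proof -
    have "card (SIGMA a:X. {b. adj a b}) = (\<Sum>a\<in>X. card {b. adj a b})"
      by (rule card_SigmaI) (use that finite_V finite_nbrs finite_subset in blast)+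
    also have "\<dots> = (\<Sum>a\<in>X. 4)" using that degree by (intro sum.cong) auto
    finally show ?thesis by simp
  qed
  have "bij_betw prod.swap (SIGMA a:P. {b. adj a b}) (SIGMA a:Q. {b. adj a b})"
  proof (rule bij_betwI[where g = prod.swap])
    show "prod.swap \<in> (SIGMA a:P. {b. adj a b}) \<rightarrow> (SIGMA a:Q. {b. adj a b})"
      using one adj_in2 sym by (auto simp: Q_def)
    show "prod.swap \<in> (SIGMA a:Q. {b. adj a b}) \<rightarrow> (SIGMA a:P. {b. adj a b})"
      using one sym by (auto simp: Q_def)
  qed auto
  then have "4 * card P = 4 * card Q"
    using S[of P] S[of Q] bij_betw_same_card by (metis (no_types, lifting) Diff_subset P_def Q_def mem_Collect_eq subsetI)
  moreover have "card V = card P + card Q"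
  proof -
    have PV: "P \<subseteq> V" by (auto simp: P_def)
    show ?thesis
      unfolding Q_def using card_Diff_subset[OF fin(1) PV] card_mono[OF finite_V PV] by simp
  qed
  ultimately show False using odd by simp
qed

end

text \<open>
A shortest closed walk of odd length, wound around periodically so that indices need no reduction
and the cycle can be rotated by shifting them.
\<close>
locale odd_cycle = girth6_quartic +
  fixes c :: "nat \<Rightarrow> 'a" and g :: nat
  assumes odd_g: "odd g"
    and periodic: "c (i + g) = c i"
    and step: "adj (c i) (c (Suc i))"
    and minimal: "odd k \<Longrightarrow> (x, x) \<in> arcs ^^ k \<Longrightarrow> g \<le> k"

lemma (in girth6_quartic) obtain_odd_cycle:
  assumes "odd k" "(x, x) \<in> arcs ^^ k"
  obtains c g where "odd_cycle V adj c g"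
proof -
  define g where "g = (LEAST k. odd k \<and> (\<exists>x. (x, x) \<in> arcs ^^ k))"
  have g: "odd g \<and> (\<exists>x. (x, x) \<in> arcs ^^ g)"
    unfolding g_def by (rule LeastI[of _ k]) (use assms in blast)
  have min: "g \<le> k" if "odd k" "(x, x) \<in> arcs ^^ k" for k x
    unfolding g_def by (rule Least_le) (use that in blast)
  obtain y where "(y, y) \<in> arcs ^^ g" using g by blast
  then obtain f where "f 0 = y" "f g = y" and step: "\<forall>i<g. (f i, f (Suc i)) \<in> arcs"
    unfolding relpow_fun_conv by blast
  then have f: "f 0 = f g" "\<And>i. i < g \<Longrightarrow> (f i, f (Suc i)) \<in> arcs" by auto
  have g0: "0 < g" using g by (auto intro: Nat.gr0I)
  have "odd_cycle V adj (\<lambda>i. f (i mod g)) g"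
  proof
    fix i
    have "f (Suc (i mod g)) = f (Suc i mod g)" using f(1) by (simp add: mod_Suc)
    then show "adj (f (i mod g)) (f (Suc i mod g))"
      using f(2)[of "i mod g"] g0 by (simp add: arcs_def)
  qed (use g min in auto)
  then show ?thesis by (rule that)
qed

context odd_cycle
begin

lemma rotate: "odd_cycle V adj (\<lambda>i. c (i + j)) g"
proof
  show "c (i + g + j) = c (i + j)" for i using periodic[of "i + j"] by (simp add: add_ac)
  show "adj (c (i + j)) (c (Suc i + j))" for i using step[of "i + j"] by simp
qed (use odd_g minimal in auto)

lemma arc_walk: "(c i, c (i + d)) \<in> arcs ^^ d"
  by (induction d) (use step in \<open>auto simp: arcs_def intro: relpow_Suc_I\<close>)

text \<open>
A walk between two cycle vertices, joined with that one of the two arcs of the cycle for which the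
total is odd, is a closed walk of odd length; so it has length at least \<open>g\<close>. This is
the only way in which minimality enters below.
\<close>
lemma gap:
  assumes "d < g" and t: "(c i, c (i + d)) \<in> arcs ^^ t"
  shows "even (d + t) \<and> d \<le> t \<or> odd (d + t) \<and> g \<le> d + t"
proof (cases "even (d + t)")
  case True
  have "(c (i + d), c i) \<in> arcs ^^ (g - d)"
    using arc_walk[of "i + d" "g - d"] assms(1) periodic[of i] by simp
  then have "(c i, c i) \<in> arcs ^^ (t + (g - d))" using walk_add t by blast
  moreover have "odd (t + (g - d))" using True odd_g assms(1) by auto
  ultimately have "g \<le> t + (g - d)" using minimal by blast
  then show ?thesis using True assms(1) by simp
next
  case False
  have "(c i, c i) \<in> arcs ^^ (d + t)" using walk_add[OF arc_walk walk_sym[OF t]] .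
  then show ?thesis using False minimal by blast
qed

lemma g_ge: "7 \<le> g"
proof (rule ccontr)
  assume "\<not> 7 \<le> g"
  then have "g = 1 \<or> g = 3 \<or> g = 5" using odd_g by (auto elim!: oddE)
  moreover have w: "(c 0, c 0) \<in> arcs ^^ g" using arc_walk[of 0 g] periodic[of 0] by simp
  ultimately consider "(c 0, c 0) \<in> arcs ^^ 1" | "(c 0, c 0) \<in> arcs ^^ 3" | "(c 0, c 0) \<in> arcs ^^ 5" by blast
  then show False
  proof cases
    case 1 then show ?thesis using irrefl by (auto simp: arcs_def)
  next
    case 2
    then obtain x y where "adj (c 0) x" "adj x y" "adj y (c 0)"
      by (auto simp: eval_nat_numeral relcomp_unfold arcs_def)
    then show ?thesis by (rule no_triangle)
  next
    case 3
    then obtain x y z w where "adj (c 0) x" "adj x y" "adj y z" "adj z w" "adj w (c 0)"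
      by (auto simp: eval_nat_numeral relcomp_unfold arcs_def)
    then show ?thesis by (rule no_pentagon)
  qed
qed

lemma c_eqD: "c i = c (i + d) \<Longrightarrow> d < g \<Longrightarrow> d = 0"
  using gap[of d i 0] by auto

lemma c_in: "c i \<in> V"
  using adj_in[OF step] .

lemma c_inj: "inj_on c {..<g}"
proof (rule linorder_inj_onI)
  fix i j assume ij: "i < j" "i \<in> {..<g}" "j \<in> {..<g}"
  then have "c j = c (i + (j - i))" "j - i < g" by auto
  then show "c i \<noteq> c j" using c_eqD[of i "j - i"] ij by auto
qed auto

lemma c_pred: "c (Suc (i + (g - 1))) = c i" "adj (c i) (c (i + (g - 1)))"
proof -
  show eq: "c (Suc (i + (g - 1))) = c i" using periodic[of i] g_ge by simp
  show "adj (c i) (c (i + (g - 1)))" using step[of "i + (g - 1)"] eq sym by simp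
qed

text \<open>The two neighbours of a cycle vertex off the cycle.\<close>
definition outer :: "nat \<Rightarrow> 'a set" where
  "outer i = {y. adj (c i) y} - {c (Suc i), c (i + (g - 1))}"

lemma outer_adj: "y \<in> outer i \<Longrightarrow> adj (c i) y"
  by (simp add: outer_def)

lemma outer_in: "outer i \<subseteq> V"
  using outer_adj adj_in2 by blast

lemma finite_outer: "finite (outer i)"
  using finite_nbrs by (simp add: outer_def)

lemma outer_periodic: "outer (i + g) = outer i"
  using periodic[of i] periodic[of "Suc i"] periodic[of "i + (g - 1)"] by (simp add: outer_def add_ac)

lemma nbrs_c: "{y. adj (c i) y} = {c (Suc i), c (i + (g - 1))} \<union> outer i"
  using step c_pred by (auto simp: outer_def)

lemma card_outer: "card (outer i) = 2"
proof -
  have "c (Suc i) \<noteq> c (Suc i + (g - 2))" using c_eqD[of "Suc i" "g - 2"] g_ge by auto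
  moreover have "Suc i + (g - 2) = i + (g - 1)" using g_ge by simp
  ultimately have ne: "c (Suc i) \<noteq> c (i + (g - 1))" by metis
  have "{c (Suc i), c (i + (g - 1))} \<subseteq> {y. adj (c i) y}" using step c_pred by blast
  then have "card (outer i) = card {y. adj (c i) y} - card {c (Suc i), c (i + (g - 1))}"
    unfolding outer_def by (intro card_Diff_subset) auto
  then show ?thesis using ne degree[OF c_in] by simp
qed

lemma outer_not_c:
  assumes "y \<in> outer i" shows "y \<noteq> c (i + d)"
proof -
  have main: "y \<noteq> c (i + d)" if d: "d < g" for d
  proof
    assume y: "y = c (i + d)"
    have "(c i, c (i + d)) \<in> arcs ^^ 1" using outer_adj[OF assms] y by (simp add: arcs_def)
    from gap[OF d this] have "d \<le> 1 \<and> odd d \<or> g - 1 \<le> d" by auto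
    then have "d = 1 \<or> d = g - 1" using d by (auto simp: le_Suc_eq)
    then show False using assms y by (auto simp: outer_def)
  qed
  have "c (i + d) = c (i + d mod g)"
  proof -
    have "c (i + d mod g + k * g) = c (i + d mod g)" for k
    proof (induction k)
      case (Suc k)
      then show ?case using periodic[of "i + d mod g + k * g"] by (simp add: add_ac)
    qed simp
    from this[of "d div g"] show ?thesis by (simp add: add.assoc)
  qed
  moreover have "d mod g < g" using g_ge by simp
  ultimately show ?thesis using main by simp
qed

lemma outer_not_cycle:
  assumes y: "y \<in> outer i" shows "y \<noteq> c j"
proof -
  have per: "c (j + k * g) = c j" for k
  proof (induction k)
    case (Suc k)
    then show ?case using periodic[of "j + k * g"] by (simp add: add_ac)
  qed simp
  have "i + (j + i * (g - 1)) = j + i * g" using g_ge by (cases g) (simp_all add: algebra_simps)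
  then show ?thesis using outer_not_c[OF y, of "j + i * (g - 1)"] per[of i] by metis
qed

lemma outer_walk:
  assumes "x \<in> outer i" "y \<in> outer (i + d)" "(x, y) \<in> arcs ^^ t"
  shows "(c i, c (i + d)) \<in> arcs ^^ (t + 2)"
proof -
  have "(c i, x) \<in> arcs ^^ 1" "(y, c (i + d)) \<in> arcs ^^ 1"
    using outer_adj[OF assms(1)] sym[OF outer_adj[OF assms(2)]] by (auto simp: arcs_def)
  then show ?thesis using walk_add[OF walk_add[OF _ assms(3)]] by fastforce
qed

text \<open>
A common element of two outer sets joins their cycle vertices by a walk of length 2, so these are
two steps apart on the cycle, and there a square closes.
\<close>
lemma outer_disjoint:
  assumes d: "0 < d" "d < g" shows "outer i \<inter> outer (i + d) = {}"
proof (rule equals0I)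
  fix y assume "y \<in> outer i \<inter> outer (i + d)"
  then have y: "y \<in> outer i" "y \<in> outer (i + d)" by auto
  have "(y, y) \<in> arcs ^^ 0" by simp
  from gap[OF d(2) outer_walk[OF y this]] have "d = 2 \<or> d = g - 2"
    using d odd_g by (auto elim!: oddE evenE)
  then show False
  proof
    assume d2: "d = 2"
    have "adj (c i) (c (Suc i))" "adj (c (Suc i)) (c (i + 2))" using step[of i] step[of "Suc i"] by auto
    moreover have "adj (c (i + 2)) y" "adj y (c i)" using outer_adj y d2 sym by auto
    ultimately have "c i = c (i + 2) \<or> c (Suc i) = y" by (rule no_square)
    then show False using c_eqD[of i 2] g_ge y(1) by (auto simp: outer_def)
  next
    assume d2: "d = g - 2"
    let ?j = "i + d"
    have "?j + 2 = i + g" using d2 g_ge by simp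
    then have j: "c (?j + 2) = c i" using periodic[of i] by metis
    have "adj (c ?j) (c (Suc ?j))" "adj (c (Suc ?j)) (c (?j + 2))" using step[of ?j] step[of "Suc ?j"] by auto
    moreover have "adj (c (?j + 2)) y" "adj y (c ?j)" using outer_adj y j sym by auto
    ultimately have "c ?j = c (?j + 2) \<or> c (Suc ?j) = y" by (rule no_square)
    then show False using c_eqD[of ?j 2] g_ge y(2) by (auto simp: outer_def)
  qed
qed

text \<open>
An edge between outer vertices joins their cycle vertices by a walk of length 3. Distance 1 along
the cycle is excluded by squares, and only distance 3 remains.
\<close>
lemma outer_outer:
  assumes d: "d < g" and x: "x \<in> outer i" and y: "y \<in> outer (i + d)" and xy: "adj x y"
  shows "d = 3 \<or> d = g - 3"
proof -
  have "(x, y) \<in> arcs ^^ 1" using xy by (simp add: arcs_def)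
  from gap[OF d outer_walk[OF x y this]] have "d = 1 \<or> d = 3 \<or> d = g - 1 \<or> d = g - 3"
    using d odd_g by (auto elim!: oddE evenE)
  moreover have "d \<noteq> 1"
  proof
    assume "d = 1"
    then have "adj (c i) x" "adj x y" "adj y (c (Suc i))" "adj (c (Suc i)) (c i)"
      using outer_adj[OF x] outer_adj[OF y] xy sym[OF step] sym by auto
    then have "c i = y \<or> x = c (Suc i)" by (rule no_square)
    then show False using x outer_not_cycle y by blast
  qed
  moreover have "d \<noteq> g - 1"
  proof
    assume "d = g - 1"
    then have "adj (c i) x" "adj x y" "adj y (c (i + (g - 1)))" "adj (c (i + (g - 1))) (c i)"
      using outer_adj[OF x] outer_adj[OF y] xy sym[OF c_pred(2)] sym by auto
    then have "c i = y \<or> x = c (i + (g - 1))" by (rule no_square)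
    then show False using x outer_not_cycle y by blast
  qed
  ultimately show ?thesis by blast
qed

end

section \<open>Applying the certificates\<close>


lemma pairs_list:
  "length (concat (map (\<lambda>i. [a i, b i]) [0..<n])) = 2 * n"
  "i < n \<Longrightarrow> concat (map (\<lambda>i. [a i, b i]) [0..<n]) ! (2 * i) = a i"
  "i < n \<Longrightarrow> concat (map (\<lambda>i. [a i, b i]) [0..<n]) ! (2 * i + 1) = b i"
proof -
  show len: "length (concat (map (\<lambda>i. [a i, b i]) [0..<n])) = 2 * n" for n
    by (induction n) auto
  show "i < n \<Longrightarrow> concat (map (\<lambda>i. [a i, b i]) [0..<n]) ! (2 * i) = a i"
    by (induction n) (auto simp: nth_append len less_Suc_eq)
  show "i < n \<Longrightarrow> concat (map (\<lambda>i. [a i, b i]) [0..<n]) ! (2 * i + 1) = b i"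
    by (induction n) (auto simp: nth_append len less_Suc_eq)
qed

lemma frameD:
  assumes "(x, y) \<in> set (frame g)"
  shows "x < g \<and> (y = Suc x \<and> Suc x < g \<or> y = 0 \<and> Suc x = g \<or> y = g + 2 * x \<or> y = g + 2 * x + 1)"
  using assms by (auto simp: frame_def split: if_splits)

lemma bars_atD:
  assumes "(x, y) \<in> set (bars_at g d)"
  shows "\<exists>i j. i < g \<and> j = (if i + d < g then i + d else i + d - g)
    \<and> (x = g + 2 * i \<or> x = g + 2 * i + 1) \<and> (y = g + 2 * j \<or> y = g + 2 * j + 1)"
proof -
  obtain i where i: "i < g" "(x, y) \<in> set (let j = (if i + d < g then i + d else i + d - g) in
     [(g + 2 * i, g + 2 * j), (g + 2 * i, g + 2 * j + 1), (g + 2 * i + 1, g + 2 * j), (g + 2 * i + 1, g + 2 * j + 1)])"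
    using assms unfolding bars_at_def by auto
  define j where "j = (if i + d < g then i + d else i + d - g)"
  have "(x, y) \<in> {(g + 2 * i, g + 2 * j), (g + 2 * i, g + 2 * j + 1), (g + 2 * i + 1, g + 2 * j), (g + 2 * i + 1, g + 2 * j + 1)}"
    using i(2) unfolding Let_def j_def[symmetric] by simp
  then show ?thesis using i(1) j_def by blast
qed

lemma sum_card_swap:
  assumes "finite A" "finite B"
  shows "(\<Sum>x\<in>A. card {z \<in> B. P x z}) = (\<Sum>z\<in>B. card {x \<in> A. P x z})"
proof -
  have "(\<Sum>x\<in>A. card {z \<in> B. P x z}) = (\<Sum>x\<in>A. \<Sum>z\<in>B. if P x z then 1 else 0)"
    using assms(2) by (intro sum.cong refl) (simp add: sum.If_cases Int_def)
  also have "\<dots> = (\<Sum>z\<in>B. \<Sum>x\<in>A. if P x z then 1 else 0)" by (rule sum.swap)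
  also have "\<dots> = (\<Sum>z\<in>B. card {x \<in> A. P x z})"
    using assms(1) by (intro sum.cong refl) (simp add: sum.If_cases Int_def)
  finally show ?thesis .
qed

lemma sum_shift:
  fixes h :: "nat \<Rightarrow> nat"
  assumes "\<And>i. h (i + n) = h i"
  shows "(\<Sum>i<n. h (i + k)) = (\<Sum>i<n. h i)"
proof (induction k)
  case (Suc k)
  have "(\<Sum>i<n. h (i + Suc k)) + h k = (\<Sum>i<n. h (i + k)) + h (n + k)"
    using sum.lessThan_Suc_shift[of "\<lambda>i. h (i + k)" n] sum.lessThan_Suc[of "\<lambda>i. h (i + k)" n] by simp
  moreover have "h (n + k) = h k" using assms[of k] by (simp add: add.commute)
  ultimately show ?case using Suc.IH by simp
qed simp

context odd_cycle
begin

text \<open>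
Transports the graph to an initial segment of the natural numbers, with the labels that the
certificates assume: the cycle, its outer vertices in any chosen order \<open>a i, b i\<close>,
then the vertices of \<open>xs\<close>, then all others in some order.
\<close>
lemma embedding:
  assumes ab: "\<And>i. i < g \<Longrightarrow> outer i = {a i, b i}"
    and xs: "set xs \<subseteq> V - c ` {..<g} - (\<Union>i<g. outer i)" "distinct xs"
  obtains f R where "girth6_quartic {..<card V} R" "bij_betw f {..<card V} V"
    "\<And>x y. R x y \<longleftrightarrow> x < card V \<and> y < card V \<and> adj (f x) (f y)"
    "\<And>i. i < g \<Longrightarrow> f i = c i" "\<And>i. i < g \<Longrightarrow> f (g + 2 * i) = a i" "\<And>i. i < g \<Longrightarrow> f (g + 2 * i + 1) = b i"
    "\<And>i. i < length xs \<Longrightarrow> f (3 * g + i) = xs ! i" "3 * g + length xs \<le> card V"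
    "\<And>x y. (x, y) \<in> set (frame g) \<Longrightarrow> R x y"
proof -
  define ps where "ps n = concat (map (\<lambda>i. [a i, b i]) [0..<n])" for n
  define ys where "ys = map c [0..<g] @ ps g @ xs"
  have ne: "a i \<noteq> b i" if "i < g" for i using card_outer[of i] ab[OF that] by auto
  have "distinct (ps n) \<and> set (ps n) = (\<Union>i<n. outer i)" if "n \<le> g" for n
    using that
  proof (induction n)
    case (Suc n)
    have "outer i \<inter> outer n = {}" if "i < n" for i
      using outer_disjoint[of "n - i" i] that Suc.prems by auto
    then have "(\<Union>i<n. outer i) \<inter> outer n = {}" by blast
    moreover have "ps (Suc n) = ps n @ [a n, b n]" by (simp add: ps_def)
    ultimately show ?case using Suc ab[of n] ne[of n] by (auto simp: lessThan_Suc)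
  qed (simp add: ps_def)
  then have ps: "distinct (ps g)" "set (ps g) = (\<Union>i<g. outer i)" by auto
  have dc: "distinct (map c [0..<g])" using c_inj by (simp add: distinct_map atLeast0LessThan)
  have sc: "set (map c [0..<g]) = c ` {..<g}" by (simp add: atLeast0LessThan)
  have "c ` {..<g} \<inter> (\<Union>i<g. outer i) = {}" using outer_not_cycle by blast
  then have dy: "distinct ys" unfolding ys_def distinct_append set_append ps(2) sc
    using dc ps(1) xs by blast
  have sy: "set ys \<subseteq> V" unfolding ys_def set_append ps(2) sc using c_in outer_in xs by blast
  have ly: "length ys = 3 * g + length xs" by (simp add: ys_def ps_def pairs_list(1))
  have "finite (V - set ys)" using finite_V by simp
  then obtain zs where zs: "set zs = V - set ys" "distinct zs" using finite_distinct_list by blast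
  define L where "L = ys @ zs"
  have L: "distinct L" "set L = V" using dy sy zs by (auto simp: L_def)
  have lL: "length L = card V" using distinct_card[OF L(1)] L(2) by simp
  have Lys: "L ! k = ys ! k" if "k < length ys" for k using that by (simp add: L_def nth_append)
  define f where "f = (!) L"
  define R where "R = (\<lambda>x y. x \<in> {..<card V} \<and> y \<in> {..<card V} \<and> adj (f x) (f y))"
  have bij: "bij_betw f {..<card V} V"
    unfolding f_def by (rule bij_betw_nth[OF L(1)]) (simp_all add: lL L(2))
  have gi: "girth6_quartic {..<card V} R" unfolding R_def by (rule pullback[OF bij])
  have R: "R x y \<longleftrightarrow> x < card V \<and> y < card V \<and> adj (f x) (f y)" for x y by (simp add: R_def)
  have lp: "length (ps g) = 2 * g" by (simp add: ps_def pairs_list(1))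
  have fc: "f i = c i" if "i < g" for i
    using that Lys[of i] ly by (simp add: f_def ys_def nth_append)
  have fa: "f (g + 2 * i) = a i" if "i < g" for i
    using that Lys[of "g + 2 * i"] ly lp pairs_list(2)[OF that, of a b]
    by (simp add: f_def ys_def nth_append flip: ps_def)
  have fb: "f (g + 2 * i + 1) = b i" if "i < g" for i
    using that Lys[of "g + 2 * i + 1"] ly lp pairs_list(3)[OF that, of a b]
    by (simp add: f_def ys_def nth_append flip: ps_def)
  have fx: "f (3 * g + i) = xs ! i" if "i < length xs" for i
    using that Lys[of "3 * g + i"] ly lp by (simp add: f_def ys_def nth_append)
  have le: "3 * g + length xs \<le> card V" using ly lL by (simp add: L_def)
  have fr: "R x y" if xy: "(x, y) \<in> set (frame g)" for x y
  proof -
    have x: "x < g" using frameD[OF xy] by simp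
    have ac: "adj (c x) (a x)" "adj (c x) (b x)" using outer_adj ab[OF x] by blast+
    from frameD[OF xy] consider "y = Suc x" "Suc x < g" | "y = 0" "Suc x = g" | "y = g + 2 * x" | "y = g + 2 * x + 1"
      by blast
    then show "R x y"
    proof cases
      case 1 then show ?thesis using R fc x step le by simp
    next
      case 2
      then have "adj (c x) (c 0)" using step[of x] periodic[of 0] by simp
      then show ?thesis using R fc x 2 le g_ge by simp
    next
      case 3 then show ?thesis using R fc[OF x] fa[OF x] ac x le by simp
    next
      case 4 then show ?thesis using R fc[OF x] fb[OF x] ac x le by simp
    qed
  qed
  show ?thesis by (rule that[OF gi bij R fc fa fb fx le fr])
qed

lemma labels: "\<exists>a b. \<forall>i. outer i = {a i, b i}"
proof -
  have "\<forall>i. \<exists>x y. outer i = {x, y}" using card_outer by (metis card_2_iff)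
  then show ?thesis by metis
qed

lemma three_g_le: "3 * g \<le> card V"
proof -
  obtain a b where ab: "\<And>i. outer i = {a i, b i}" using labels by metis
  show ?thesis by (rule embedding[of a b "[]"]) (use ab in auto)
qed

lemma bars_hold:
  assumes f: "\<And>i. i < g \<Longrightarrow> f (g + 2 * i) \<in> outer i" "\<And>i. i < g \<Longrightarrow> f (g + 2 * i + 1) \<in> outer i"
    and d: "3 < d" "d < g - 3" and xy: "(x, y) \<in> set (bars_at g d)"
  shows "x < 3 * g \<and> y < 3 * g \<and> \<not> adj (f x) (f y)"
proof -
  obtain i j where ij: "i < g" "j = (if i + d < g then i + d else i + d - g)"
    "x = g + 2 * i \<or> x = g + 2 * i + 1" "y = g + 2 * j \<or> y = g + 2 * j + 1"
    using bars_atD[OF xy] by blast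
  have j: "j < g" using ij d by (auto split: if_splits)
  have o: "f x \<in> outer i" "f y \<in> outer j" using ij(3,4) f[OF ij(1)] f[OF j] by blast+
  have "\<not> adj (f x) (f y)"
  proof (cases "i + d < g")
    case True
    then have "f y \<in> outer (i + d)" using o ij by simp
    moreover have "d < g" using d by simp
    ultimately show ?thesis using outer_outer[of d "f x" i "f y"] o(1) d by fastforce
  next
    case False
    then have "i = j + (g - d)" using ij d by simp
    then have "f x \<in> outer (j + (g - d))" using o by simp
    moreover have "g - d < g" "g - d \<noteq> 3" "g - d \<noteq> g - 3" using d by simp_all
    ultimately show ?thesis using outer_outer[of "g - d" "f y" j "f x"] o(2) sym by blast
  qed
  then show ?thesis using ij j by auto
qed

text \<open>
Minimality of the cycle bars the edges between outer sets that are 4 or more apart, and with these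
bars the frame cannot be completed. For length 11 the frame exhausts all 33 vertices.
\<close>
lemma nine_or_eleven:
  assumes g: "g = 9 \<or> g = 11" and n: "card V \<in> {27, 29, 31, 33}"
  shows False
proof -
  obtain a b where ab: "\<And>i. outer i = {a i, b i}" using labels by metis
  obtain f R where R: "girth6_quartic {..<card V} R"
    "\<And>x y. R x y \<longleftrightarrow> x < card V \<and> y < card V \<and> adj (f x) (f y)"
    and f: "\<And>i. i < g \<Longrightarrow> f (g + 2 * i) = a i" "\<And>i. i < g \<Longrightarrow> f (g + 2 * i + 1) = b i"
    and le: "3 * g \<le> card V" and fr: "\<And>x y. (x, y) \<in> set (frame g) \<Longrightarrow> R x y"
    by (rule embedding[of a b "[]"]) (use ab in auto)
  have fo: "\<And>i. i < g \<Longrightarrow> f (g + 2 * i) \<in> outer i" "\<And>i. i < g \<Longrightarrow> f (g + 2 * i + 1) \<in> outer i"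
    using f ab by auto
  have bars: "x < card V \<and> y < card V \<and> \<not> R x y" if "(x, y) \<in> set (bars_at g d)" "3 < d" "d < g - 3" for x y d
    using bars_hold[OF fo that(2,3,1)] le R(2) by auto
  from g show False
  proof
    assume g: "g = 9"
    have r: False if m: "card V = m" and cert: "refutes xs m (frame 9) (bars_at 9 4)" for m xs
    proof (rule refutes_sound[OF cert, of R])
      show "m \<le> 36" using m n by auto
      show "girth6_quartic {..<m} R" using R(1) m by simp
      show "R p q" if "(p, q) \<in> set (frame 9)" for p q using that fr[of p q] g by simp
      show "p < m \<and> q < m \<and> \<not> R p q" if "(p, q) \<in> set (bars_at 9 4)" for p q using that bars[of p q 4] g m by simp
    qed
    from n consider "card V = 27" | "card V = 29" | "card V = 31" | "card V = 33" by blast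
    then show False
    proof cases
      case 1 show False by (rule r[OF 1 nine_27])
    next
      case 2 show False by (rule r[OF 2 nine_29])
    next
      case 3 show False by (rule r[OF 3 nine_31])
    next
      case 4 show False by (rule r[OF 4 nine_33])
    qed
  next
    assume g: "g = 11"
    then have 33: "card V = 33" using le n by auto
    have r: False if m: "card V = m" and cert: "refutes xs m (frame 11) (bars_at 11 4 @ bars_at 11 5)" for m xs
    proof (rule refutes_sound[OF cert, of R])
      show "m \<le> 36" using m n by auto
      show "girth6_quartic {..<m} R" using R(1) m by simp
      show "R p q" if "(p, q) \<in> set (frame 11)" for p q using that fr[of p q] g by simp
      show "p < m \<and> q < m \<and> \<not> R p q" if "(p, q) \<in> set (bars_at 11 4 @ bars_at 11 5)" for p q using that bars[of p q 4] bars[of p q 5] g m by auto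
    qed
    show False by (rule r[OF 33 eleven_33])
  qed
qed

lemma relabel:
  assumes "\<And>i. i < g \<Longrightarrow> a i \<in> outer i"
  obtains b where "\<And>i. i < g \<Longrightarrow> outer i = {a i, b i} \<and> a i \<noteq> b i"
proof -
  have "\<exists>y. outer i = {a i, y} \<and> a i \<noteq> y" if "i < g" for i
    using card_outer[of i] assms[OF that] by (auto simp: card_2_iff doubleton_eq_iff) 
  then show ?thesis using that by metis
qed

lemma rotated_outer:
  "odd_cycle.outer adj (\<lambda>k. c (k + j)) g i = outer (i + j)"
proof -
  interpret r: odd_cycle V adj "\<lambda>k. c (k + j)" g by (rule rotate)
  show ?thesis by (simp add: r.outer_def outer_def add_ac)
qed

text \<open>
The labels of the certificates fix the position on the cycle: here and in
\<open>no_split_0\<close> the configuration sits at cycle vertex 0. Other positions follow by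
rotating the cycle.
\<close>
lemma no_wide_0:
  assumes g: "g = 7" and n: "card V \<in> {27, 29, 31, 33}"
    and x: "outer 0 = {x, x'}" and y: "outer 3 = {y, y'}" and adj: "adj x y" "adj x' y'"
  shows False
proof -
  obtain a b where ab: "\<And>i. outer i = {a i, b i}" using labels by metis
  define a' where "a' = a(0 := x, 3 := y)"
  define b' where "b' = b(0 := x', 3 := y')"
  have ab': "outer i = {a' i, b' i}" for i using ab x y by (simp add: a'_def b'_def)
  obtain f R where R: "girth6_quartic {..<card V} R"
    "\<And>x y. R x y \<longleftrightarrow> x < card V \<and> y < card V \<and> adj (f x) (f y)"
    and f: "\<And>i. i < g \<Longrightarrow> f (g + 2 * i) = a' i" "\<And>i. i < g \<Longrightarrow> f (g + 2 * i + 1) = b' i"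
    and fr: "\<And>x y. (x, y) \<in> set (frame g) \<Longrightarrow> R x y"
    by (rule embedding[of a' b' "[]"]) (use ab' in auto)
  have "f 7 = x" "f 8 = x'" "f 13 = y" "f 14 = y'"
    using f(1)[of 0] f(2)[of 0] f(1)[of 3] f(2)[of 3] g by (simp_all add: a'_def b'_def)
  then have e: "R 7 13" "R 8 14" using R(2) adj n by auto
  have r: False if m: "card V = m" and cert: "refutes xs m (frame 7 @ [(7, 13), (8, 14)]) ([])" for m xs
  proof (rule refutes_sound[OF cert, of R])
    show "m \<le> 36" using m n by auto
    show "girth6_quartic {..<m} R" using R(1) m by simp
    show "R p q" if "(p, q) \<in> set (frame 7 @ [(7, 13), (8, 14)])" for p q using that fr[of p q] g e by auto
    show "p < m \<and> q < m \<and> \<not> R p q" if "(p, q) \<in> set ([])" for p q using that by simp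
  qed
  from n consider "card V = 27" | "card V = 29" | "card V = 31" | "card V = 33" by blast
  then show False
  proof cases
    case 1 show False by (rule r[OF 1 wide_27])
  next
    case 2 show False by (rule r[OF 2 wide_29])
  next
    case 3 show False by (rule r[OF 3 wide_31])
  next
    case 4 show False by (rule r[OF 4 wide_33])
  qed
qed

lemma no_split_0:
  assumes g: "g = 7" and n: "card V \<in> {27, 29, 31, 33}"
    and x: "outer 0 = {x, x'}" and y: "y \<in> outer 3" and z: "z \<in> outer 4" and adj: "adj x y" "adj x' z"
  shows False
proof -
  obtain a b where ab: "\<And>i. outer i = {a i, b i}" using labels by metis
  obtain y' where y': "outer 3 = {y, y'}" using ab[of 3] y by (metis insertE insert_commute singletonD)
  obtain z' where z': "outer 4 = {z, z'}" using ab[of 4] z by (metis insertE insert_commute singletonD)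
  define a' where "a' = a(0 := x, 3 := y, 4 := z)"
  define b' where "b' = b(0 := x', 3 := y', 4 := z')"
  have ab': "outer i = {a' i, b' i}" for i using ab x y' z' by (simp add: a'_def b'_def)
  obtain f R where R: "girth6_quartic {..<card V} R"
    "\<And>x y. R x y \<longleftrightarrow> x < card V \<and> y < card V \<and> adj (f x) (f y)"
    and f: "\<And>i. i < g \<Longrightarrow> f (g + 2 * i) = a' i" "\<And>i. i < g \<Longrightarrow> f (g + 2 * i + 1) = b' i"
    and fr: "\<And>x y. (x, y) \<in> set (frame g) \<Longrightarrow> R x y"
    by (rule embedding[of a' b' "[]"]) (use ab' in auto)
  have "f 7 = x" "f 8 = x'" "f 13 = y" "f 15 = z"
    using f(1)[of 0] f(2)[of 0] f(1)[of 3] f(1)[of 4] g by (simp_all add: a'_def b'_def)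
  then have e: "R 7 13" "R 8 15" using R(2) adj n by auto
  have r: False if m: "card V = m" and cert: "refutes xs m (frame 7 @ [(7, 13), (8, 15)]) ([])" for m xs
  proof (rule refutes_sound[OF cert, of R])
    show "m \<le> 36" using m n by auto
    show "girth6_quartic {..<m} R" using R(1) m by simp
    show "R p q" if "(p, q) \<in> set (frame 7 @ [(7, 13), (8, 15)])" for p q using that fr[of p q] g e by auto
    show "p < m \<and> q < m \<and> \<not> R p q" if "(p, q) \<in> set ([])" for p q using that by simp
  qed
  from n consider "card V = 27" | "card V = 29" | "card V = 31" | "card V = 33" by blast
  then show False
  proof cases
    case 1 show False by (rule r[OF 1 split_27])
  next
    case 2 show False by (rule r[OF 2 split_29])
  next
    case 3 show False by (rule r[OF 3 split_31])
  next
    case 4 show False by (rule r[OF 4 split_33])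
  qed
qed

end

section \<open>Counting around a cycle of length 7\<close>


context odd_cycle
begin

lemma no_wide:
  assumes g: "g = 7" and n: "card V \<in> {27, 29, 31, 33}"
    and x: "outer i = {x, x'}" and y: "outer (i + 3) = {y, y'}" and adj: "adj x y" "adj x' y'"
  shows False
proof -
  interpret r: odd_cycle V adj "\<lambda>k. c (k + i)" g by (rule rotate)
  show False
    by (rule r.no_wide_0[OF g n _ _ adj]) (use x y in \<open>simp_all add: rotated_outer add.commute\<close>)
qed

lemma no_split:
  assumes g: "g = 7" and n: "card V \<in> {27, 29, 31, 33}"
    and x: "outer i = {x, x'}" and y: "y \<in> outer (i + 3)" and z: "z \<in> outer (i + 4)"
    and adj: "adj x y" "adj x' z"
  shows False
proof -
  interpret r: odd_cycle V adj "\<lambda>k. c (k + i)" g by (rule rotate)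
  show False
    by (rule r.no_split_0[OF g n _ _ _ adj]) (use x y z in \<open>simp_all add: rotated_outer add.commute\<close>)
qed

text \<open>
For \<open>g = 7\<close>, all edges between outer vertices belong to one of these sets, by
\<open>outer_outer\<close>: a distance of \<open>g - 3 = 4\<close> in one direction is a distance
of 3 in the other.
\<close>
definition links :: "nat \<Rightarrow> ('a \<times> 'a) set" where
  "links i = {(x, y). x \<in> outer i \<and> y \<in> outer (i + 3) \<and> adj x y}"

lemma outer_common:
  assumes "x \<in> outer i" "x' \<in> outer i" "adj x y" "adj x' y" "y \<noteq> c i"
  shows "x = x'"
proof -
  have "adj (c i) x" "adj x y" "adj y x'" "adj x' (c i)" using assms outer_adj sym by blast+
  from no_square[OF this] show ?thesis using assms(5) by blast
qed

text \<open>
Two edges between the same outer sets that share an end close a square with the cycle vertex; two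
disjoint ones are excluded by \<open>no_wide\<close>.
\<close>
lemma links_unique:
  assumes g: "g = 7" and n: "card V \<in> {27, 29, 31, 33}" and p: "p \<in> links i" "p' \<in> links i"
  shows "p = p'"
proof -
  obtain x y x' y' where p: "p = (x, y)" "p' = (x', y')" "x \<in> outer i" "x' \<in> outer i" "y \<in> outer (i + 3)"
    "y' \<in> outer (i + 3)" "adj x y" "adj x' y'"
    using p by (auto simp: links_def)
  have nc: "y \<noteq> c i" "x \<noteq> c (i + 3)" using p(3,5) outer_not_cycle by blast+
  have "x = x' \<longleftrightarrow> y = y'"
    using outer_common[OF p(3,4,7), of] outer_common[OF p(5,6), of x] p nc sym by blast
  moreover have False if "x \<noteq> x'" "y \<noteq> y'"
  proof -
    have "outer i = {x, x'}" "outer (i + 3) = {y, y'}"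
      using card_outer[of i] card_outer[of "i + 3"] p that by (auto simp: card_2_iff)
    then show False using no_wide[OF g n] p by blast
  qed
  ultimately show ?thesis using p by blast
qed

text \<open>
The sets \<open>links i\<close> and \<open>links (i + 4)\<close> both have ends in \<open>outer
i\<close>, since \<open>i + 4 + 3\<close> is \<open>i\<close> modulo 7. If the ends coincide, a
pentagon runs through the cycle vertices \<open>i + 3\<close> and \<open>i + 4\<close>; if not,
\<open>no_split\<close> applies.
\<close>
lemma links_disjoint:
  assumes g: "g = 7" and n: "card V \<in> {27, 29, 31, 33}"
  shows "links i = {} \<or> links (i + 4) = {}"
proof (rule ccontr)
  assume "\<not> ?thesis"
  then obtain x y z x' where p: "x \<in> outer i" "y \<in> outer (i + 3)" "adj x y"
    "z \<in> outer (i + 4)" "x' \<in> outer (i + 4 + 3)" "adj z x'"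
    by (auto simp: links_def)
  have "i + 4 + 3 = i + g" using g by simp
  then have x': "x' \<in> outer i" using p(5) outer_periodic[of i] by metis
  show False
  proof (cases "x = x'")
    case True
    have "adj x y" "adj y (c (i + 3))" "adj (c (i + 3)) (c (i + 4))" "adj (c (i + 4)) z" "adj z x"
      using p True outer_adj sym step[of "i + 3"] by (auto simp: eval_nat_numeral)
    then show False by (rule no_pentagon)
  next
    case False
    then have "outer i = {x, x'}" using card_outer[of i] p(1) x' by (auto simp: card_2_iff)
    then show False using no_split[OF g n _ p(2,4,3) sym[OF p(6)]] by blast
  qed
qed

lemma outer_disjoint':
  assumes "i < g" "j < g" "i \<noteq> j" shows "outer i \<inter> outer j = {}"
proof (cases "i < j")
  case True
  then have "outer i \<inter> outer (i + (j - i)) = {}" using assms by (intro outer_disjoint) auto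
  then show ?thesis using True by simp
next
  case False
  then have "outer j \<inter> outer (j + (i - j)) = {}" using assms by (intro outer_disjoint) auto
  then show ?thesis using False by (simp add: Int_commute)
qed

text \<open>The vertices at distance 1 from the cycle, and those beyond.\<close>
definition ring :: "'a set" where "ring = (\<Union>i<g. outer i)"
definition rest :: "'a set" where "rest = V - c ` {..<g} - ring"

lemma finite_ring: "finite ring" "finite rest" "ring \<subseteq> V"
  using finite_outer finite_V outer_in by (auto simp: ring_def rest_def)

lemma ring_sum: "(\<Sum>x\<in>ring. h x) = (\<Sum>i<g. \<Sum>x\<in>outer i. h x)" for h :: "'a \<Rightarrow> nat"
  unfolding ring_def
proof (rule sum.UNION_disjoint)
  show "\<forall>i\<in>{..<g}. \<forall>j\<in>{..<g}. i \<noteq> j \<longrightarrow> outer i \<inter> outer j = {}"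
    using outer_disjoint' by simp
qed (use finite_outer in auto)

lemma card_ring: "card ring = 2 * g"
  using ring_sum[of "\<lambda>_. 1"] card_outer by simp

lemma card_rest: "card rest + 3 * g = card V"
proof -
  have d: "c ` {..<g} \<inter> ring = {}" using outer_not_cycle by (auto simp: ring_def)
  have sub: "c ` {..<g} \<union> ring \<subseteq> V" using c_in finite_ring by auto
  have "card (c ` {..<g} \<union> ring) = g + 2 * g"
    using card_Un_disjoint[OF _ finite_ring(1) d] card_image[OF c_inj] card_ring by simp
  moreover have "rest = V - (c ` {..<g} \<union> ring)" by (auto simp: rest_def)
  ultimately show ?thesis
    using card_Diff_subset[OF finite_subset[OF sub finite_V] sub] card_mono[OF finite_V sub] by simp
qed

lemma outer_nbrs:
  assumes x: "x \<in> outer i" and i: "i < g"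
  shows "card {y \<in> ring. adj x y} + card {y \<in> rest. adj x y} = 3"
proof -
  have "{y. adj x y} \<inter> c ` {..<g} = {c i}"
  proof (intro set_eqI iffI)
    fix y assume "y \<in> {y. adj x y} \<inter> c ` {..<g}"
    then obtain j where j: "j < g" "y = c j" "adj x (c j)" by auto
    then have "x \<in> {y. adj (c j) y}" using sym by simp
    then have "x \<in> outer j" using outer_not_cycle[OF x] unfolding nbrs_c by blast
    then have "i = j" using outer_disjoint'[of i j] x i j(1) by blast
    then show "y \<in> {c i}" using j by simp
  qed (use outer_adj[OF x] sym i in auto)
  moreover have "{y. adj x y} \<subseteq> V" using adj_in2 by blast
  ultimately have eq: "{y. adj x y} = insert (c i) ({y \<in> ring. adj x y} \<union> {y \<in> rest. adj x y})"
    using finite_ring(3) unfolding rest_def by blast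
  have fin: "finite {y \<in> ring. adj x y}" "finite {y \<in> rest. adj x y}" using finite_ring by auto
  have nc: "c i \<notin> {y \<in> ring. adj x y} \<union> {y \<in> rest. adj x y}"
    using outer_not_cycle i by (auto simp: ring_def rest_def)
  have "card ({y \<in> ring. adj x y} \<union> {y \<in> rest. adj x y}) =
      card {y \<in> ring. adj x y} + card {y \<in> rest. adj x y}"
    by (rule card_Un_disjoint[OF fin]) (auto simp: rest_def)
  moreover have "card (insert (c i) ({y \<in> ring. adj x y} \<union> {y \<in> rest. adj x y}))
      = Suc (card ({y \<in> ring. adj x y} \<union> {y \<in> rest. adj x y}))"
    by (rule card_insert_disjoint[OF _ nc]) (use fin in simp)
  moreover have "card {y. adj x y} = 4" using degree outer_in x by blast
  ultimately show ?thesis using arg_cong[OF eq, of card] by linarith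
qed

lemma rest_nbrs:
  assumes z: "z \<in> rest"
  shows "card {y \<in> ring. adj z y} + card {y \<in> rest. adj z y} = 4"
proof -
  have "\<not> adj z (c j)" if "j < g" for j
  proof
    assume "adj z (c j)"
    then have "z \<in> {y. adj (c j) y}" using sym by simp
    then consider "z = c (Suc j)" | "z = c (j + (g - 1))" | "z \<in> outer j" unfolding nbrs_c by blast
    moreover have "c k \<in> c ` {..<g}" for k
    proof -
      have "c (k mod g + m * g) = c (k mod g)" for m
      proof (induction m)
        case (Suc m) then show ?case using periodic[of "k mod g + m * g"] by (simp add: add_ac)
      qed simp
      from this[of "k div g"] have "c k = c (k mod g)" by simp
      moreover have "k mod g < g" using g_ge by simp
      ultimately show ?thesis by blast
    qed
    ultimately show False using z that by cases (auto simp: rest_def ring_def)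
  qed
  moreover have "{y. adj z y} \<subseteq> V" using adj_in2 by blast
  ultimately have eq: "{y. adj z y} = {y \<in> ring. adj z y} \<union> {y \<in> rest. adj z y}"
    using finite_ring(3) unfolding rest_def by blast
  have "card ({y \<in> ring. adj z y} \<union> {y \<in> rest. adj z y}) =
      card {y \<in> ring. adj z y} + card {y \<in> rest. adj z y}"
    by (rule card_Un_disjoint) (use finite_ring in \<open>auto simp: rest_def\<close>)
  moreover have "card {y. adj z y} = 4" using degree z by (simp add: rest_def)
  ultimately show ?thesis using arg_cong[OF eq, of card] by linarith
qed

text \<open>
A vertex off the cycle has at most one neighbour in two consecutive outer sets together, and an
independent set of a 7-cycle has at most 3 elements.
\<close>
lemma rest_ring_le:
  assumes g: "g = 7" and z: "z \<in> rest"
  shows "card {y \<in> ring. adj z y} \<le> 3"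
proof -
  define k where "k i = card {y \<in> outer i. adj z y}" for i
  have zc: "z \<noteq> c i" if "i < g" for i using z that by (auto simp: rest_def)
  have per: "k (i + g) = k i" for i by (simp add: k_def outer_periodic)
  have le1: "k i + k (i + 1) \<le> 1" if i: "i < g" for i
  proof -
    let ?S = "{y \<in> outer i \<union> outer (i + 1). adj z y}"
    have "a = b" if ab: "a \<in> ?S" "b \<in> ?S" for a b
    proof -
      have mixed: False if "a \<in> outer i" "b \<in> outer (i + 1)" "adj z a" "adj z b" for a b
        using no_pentagon[of z a "c i" "c (Suc i)" b] that sym outer_adj[of a i] outer_adj[of b "i + 1"] step[of i]
        by simp
      have eq1: "a = b" if "a \<in> outer i" "b \<in> outer i" "adj z a" "adj z b" for a b
        using outer_common[of a i b z] that sym zc[OF i] by blast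
      have "z \<noteq> c (i + 1)"
      proof (cases "i + 1 = g")
        case True
        then have "c (i + 1) = c 0" using periodic[of 0] by simp
        then show ?thesis using zc[of 0] g_ge by simp
      next
        case False
        then show ?thesis using zc[of "i + 1"] i by simp
      qed
      then have eq2: "a = b" if "a \<in> outer (i + 1)" "b \<in> outer (i + 1)" "adj z a" "adj z b" for a b
        using outer_common[of a "i + 1" b z] that sym by blast
      show ?thesis using ab mixed eq1 eq2 by blast
    qed
    moreover have fin: "finite ?S" using finite_outer by auto
    ultimately have "card ?S \<le> 1" using card_le_Suc0_iff_eq[OF fin] by (simp only: One_nat_def) blast
    moreover have "card ?S = k i + k (i + 1)"
    proof -
      have "?S = {y \<in> outer i. adj z y} \<union> {y \<in> outer (i + 1). adj z y}" by blast
      moreover have "outer i \<inter> outer (i + 1) = {}" using outer_disjoint[of 1 i] g_ge by simp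
      ultimately show ?thesis unfolding k_def
        using card_Un_disjoint[of "{y \<in> outer i. adj z y}" "{y \<in> outer (i + 1). adj z y}"] finite_outer by auto
    qed
    ultimately show ?thesis by simp
  qed
  have tot: "card {y \<in> ring. adj z y} = (\<Sum>i<g. k i)"
  proof -
    have "card {y \<in> ring. adj z y} = (\<Sum>y\<in>ring. if adj z y then 1 else 0)"
      using finite_ring by (simp add: sum.If_cases Int_def)
    also have "\<dots> = (\<Sum>i<g. \<Sum>y\<in>outer i. if adj z y then 1 else 0)" by (rule ring_sum)
    also have "\<dots> = (\<Sum>i<g. k i)"
      unfolding k_def using finite_outer by (intro sum.cong refl) (simp add: sum.If_cases Int_def)
    finally show ?thesis .
  qed
  have "(\<Sum>i<g. k i) + (\<Sum>i<g. k (i + 1)) = (\<Sum>i<g. k i + k (i + 1))" by (simp add: sum.distrib)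
  also have "\<dots> \<le> (\<Sum>i<g. 1)" using le1 by (intro sum_mono) simp
  finally have "2 * card {y \<in> ring. adj z y} \<le> 7"
    using sum_shift[of k g 1, OF per] tot g by simp
  then show ?thesis by simp
qed

lemma ring_ring_sum:
  assumes g: "g = 7"
  shows "(\<Sum>x\<in>ring. card {y \<in> ring. adj x y}) = (\<Sum>i<g. card (links i) + card (links (i + 4)))"
proof -
  have "(\<Sum>x\<in>outer i. card {y \<in> ring. adj x y}) = card (links i) + card (links (i + 4))" if i: "i < g" for i
  proof -
    have per: "outer (i + 4 + 3) = outer i" using outer_periodic[of i] g by (simp add: add_ac)
    have inring: "outer j \<subseteq> ring" for j
    proof -
      have "outer (j mod g + m * g) = outer (j mod g)" for m
      proof (induction m)
        case (Suc m) then show ?case using outer_periodic[of "j mod g + m * g"] by (simp add: add_ac)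
      qed simp
      from this[of "j div g"] have "outer j = outer (j mod g)" by simp
      moreover have "j mod g < g" using g_ge by simp
      ultimately show ?thesis by (auto simp: ring_def)
    qed
    have split: "card {y \<in> ring. adj x y} = card {y \<in> outer (i + 3). adj x y} + card {y \<in> outer (i + 4). adj x y}"
      if x: "x \<in> outer i" for x
    proof -
      have "{y \<in> ring. adj x y} = {y \<in> outer (i + 3). adj x y} \<union> {y \<in> outer (i + 4). adj x y}"
      proof (intro set_eqI iffI)
        fix y assume "y \<in> {y \<in> ring. adj x y}"
        then obtain j where j: "j < g" "y \<in> outer j" "adj x y" by (auto simp: ring_def)
        define d where "d = (if i \<le> j then j - i else j + g - i)"
        have d: "d < g" "i + d = j \<or> i + d = j + g" using i j(1) by (auto simp: d_def)
        then have y: "y \<in> outer (i + d)" using j(2) outer_periodic[of j] by auto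
        from outer_outer[OF d(1) x y j(3)] have "d = 3 \<or> d = 4" using g by simp
        then show "y \<in> {y \<in> outer (i + 3). adj x y} \<union> {y \<in> outer (i + 4). adj x y}" using y j(3) by blast
      qed (use inring in blast)
      moreover have "outer (i + 3) \<inter> outer (i + 4) = {}" using outer_disjoint[of 1 "i + 3"] g_ge by (simp add: add_ac)
      ultimately show ?thesis
        using card_Un_disjoint[of "{y \<in> outer (i + 3). adj x y}" "{y \<in> outer (i + 4). adj x y}"] finite_outer by auto
    qed
    have l1: "(\<Sum>x\<in>outer i. card {y \<in> outer (i + 3). adj x y}) = card (links i)"
    proof -
      have "links i = (SIGMA x:outer i. {y \<in> outer (i + 3). adj x y})" by (auto simp: links_def)
      then show ?thesis using finite_outer by (simp add: card_SigmaI)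
    qed
    have l2: "(\<Sum>x\<in>outer i. card {y \<in> outer (i + 4). adj x y}) = card (links (i + 4))"
    proof -
      have "links (i + 4) = (SIGMA y:outer (i + 4). {x \<in> outer i. adj y x})" using per by (auto simp: links_def)
      then have "card (links (i + 4)) = (\<Sum>y\<in>outer (i + 4). card {x \<in> outer i. adj y x})"
        using finite_outer by (simp add: card_SigmaI)
      also have "\<dots> = (\<Sum>x\<in>outer i. card {y \<in> outer (i + 4). adj y x})"
        by (rule sum_card_swap) (rule finite_outer)+
      also have "\<dots> = (\<Sum>x\<in>outer i. card {y \<in> outer (i + 4). adj x y})"
        using sym by (intro sum.cong refl arg_cong[where f = card]) blast
      finally show ?thesis by simp
    qed
    have "(\<Sum>x\<in>outer i. card {y \<in> ring. adj x y})
        = (\<Sum>x\<in>outer i. card {y \<in> outer (i + 3). adj x y} + card {y \<in> outer (i + 4). adj x y})"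
      by (rule sum.cong[OF refl split])
    then show ?thesis using l1 l2 by (simp add: sum.distrib)
  qed
  then show ?thesis unfolding ring_sum by (intro sum.cong) auto
qed

lemma links_periodic: "links (i + g) = links i"
  using outer_periodic[of i] outer_periodic[of "i + 3"] by (simp add: links_def add_ac)

text \<open>
There are at most three edges inside the ring, because no two consecutive members of \<open>links
0, links 4, links 8, ...\<close>, a circle of seven, are occupied. The 14 ring vertices have 42
edges that do not lead to the cycle, counted at the ring. So at least 36 of them leave the ring,
and the vertices beyond absorb at most three each: there are at least 12 of these. With 33 as
largest order, equality holds throughout.
\<close>
lemma tight_counts:
  assumes g: "g = 7" and n: "card V \<in> {27, 29, 31, 33}"
  shows "card V = 33" "(\<Sum>i<g. card (links i)) = 3" "\<And>z. z \<in> rest \<Longrightarrow> card {y \<in> ring. adj z y} = 3"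
proof -
  define q where "q i = card (links i)" for i
  have q1: "q i \<le> 1" for i
  proof (cases "links i = {}")
    case False
    then obtain p where "p \<in> links i" by blast
    then have "links i = {p}" using links_unique[OF g n] by blast
    then show ?thesis by (simp add: q_def)
  qed (simp add: q_def)
  have q2: "q i + q (i + 4) \<le> 1" for i
    using links_disjoint[OF g n, of i] q1[of i] q1[of "i + 4"] by (auto simp: q_def)
  have s4: "(\<Sum>i<g. q (i + 4)) = (\<Sum>i<g. q i)" by (rule sum_shift) (simp add: q_def links_periodic)
  have "(\<Sum>i<g. q i + q (i + 4)) \<le> (\<Sum>i<g. 1)" using q2 by (intro sum_mono)
  then have le: "(\<Sum>i<g. q i) \<le> 3" using s4 g by (simp add: sum.distrib)
  have "(\<Sum>x\<in>ring. card {y \<in> ring. adj x y} + card {y \<in> rest. adj x y}) = (\<Sum>x\<in>ring. 3)"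
    using outer_nbrs by (intro sum.cong refl) (auto simp: ring_def)
  then have tot: "2 * (\<Sum>i<g. q i) + (\<Sum>x\<in>ring. card {y \<in> rest. adj x y}) = 42"
    using ring_ring_sum[OF g] s4 card_ring g by (simp add: sum.distrib q_def)
  have sw: "(\<Sum>x\<in>ring. card {y \<in> rest. adj x y}) = (\<Sum>z\<in>rest. card {y \<in> ring. adj z y})"
  proof -
    have "(\<Sum>x\<in>ring. card {y \<in> rest. adj x y}) = (\<Sum>z\<in>rest. card {x \<in> ring. adj x z})"
      by (rule sum_card_swap) (rule finite_ring)+
    also have "\<dots> = (\<Sum>z\<in>rest. card {y \<in> ring. adj z y})"
      using sym by (intro sum.cong refl arg_cong[where f = card]) blast
    finally show ?thesis .
  qed
  have up: "(\<Sum>z\<in>rest. card {y \<in> ring. adj z y}) \<le> (\<Sum>z\<in>rest. 3)"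
    using rest_ring_le[OF g] by (intro sum_mono)
  have cr: "card rest + 21 = card V" using card_rest g by simp
  have "36 \<le> 3 * card rest" using tot sw up le by simp
  then show 33: "card V = 33" using n cr by auto
  then have r: "card rest = 12" using cr by simp
  have sum36: "(\<Sum>z\<in>rest. card {y \<in> ring. adj z y}) = 36" using tot sw up le r by simp
  then show "(\<Sum>i<g. card (links i)) = 3" using tot sw by (simp add: q_def)
  show "card {y \<in> ring. adj z y} = 3" if z: "z \<in> rest" for z
  proof (rule ccontr)
    assume "card {y \<in> ring. adj z y} \<noteq> 3"
    then have "card {y \<in> ring. adj z y} < 3" using rest_ring_le[OF g z] by simp
    then have "(\<Sum>z\<in>rest. card {y \<in> ring. adj z y}) < (\<Sum>z\<in>rest. 3)"
      using rest_ring_le[OF g] z finite_ring by (intro sum_strict_mono_ex1) auto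
    then show False using sum36 r by simp
  qed
qed

text \<open>
In the circle of the indices modulo 7 in steps of 4, three pairwise non-consecutive ones have gaps
of 2, 2 and 3 steps. Two steps of 4 amount to 1 modulo 7, so the three indices are consecutive.
\<close>
lemma tight_pattern:
  assumes g: "g = 7" and n: "card V \<in> {27, 29, 31, 33}"
  obtains j where "links j \<noteq> {}" "links (j + 6) \<noteq> {}" "links (j + 5) \<noteq> {}"
proof -
  define q where "q i = card (links i)" for i
  have per: "q (i + 7) = q i" for i using links_periodic[of i] g by (simp add: q_def)
  have q1: "q i \<le> 1" for i
  proof (cases "links i = {}")
    case False
    then obtain p where "p \<in> links i" by blast
    then have "links i = {p}" using links_unique[OF g n] by blast
    then show ?thesis by (simp add: q_def)
  qed (simp add: q_def)
  have q01: "q i = 0 \<or> q i = 1" for i using q1[of i] by linarith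
  have q2: "q i = 0 \<or> q (i + 4) = 0" for i using links_disjoint[OF g n, of i] by (auto simp: q_def)
  have s: "q 0 + q 1 + q 2 + q 3 + q 4 + q 5 + q 6 = 3"
    using tight_counts(2)[OF g n] g by (simp add: q_def eval_nat_numeral)
  have d: "q 0 = 0 \<or> q 4 = 0" "q 1 = 0 \<or> q 5 = 0" "q 2 = 0 \<or> q 6 = 0" "q 3 = 0 \<or> q 0 = 0"
    "q 4 = 0 \<or> q 1 = 0" "q 5 = 0 \<or> q 2 = 0" "q 6 = 0 \<or> q 3 = 0"
    using q2[of 0] q2[of 1] q2[of 2] q2[of 3] q2[of 4] q2[of 5] q2[of 6] per[of 0] per[of 1] per[of 2] per[of 3]
    by simp_all
  have "(q 0 \<noteq> 0 \<and> q 6 \<noteq> 0 \<and> q 5 \<noteq> 0) \<or> (q 1 \<noteq> 0 \<and> q 0 \<noteq> 0 \<and> q 6 \<noteq> 0) \<or> (q 2 \<noteq> 0 \<and> q 1 \<noteq> 0 \<and> q 0 \<noteq> 0)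
    \<or> (q 3 \<noteq> 0 \<and> q 2 \<noteq> 0 \<and> q 1 \<noteq> 0) \<or> (q 4 \<noteq> 0 \<and> q 3 \<noteq> 0 \<and> q 2 \<noteq> 0) \<or> (q 5 \<noteq> 0 \<and> q 4 \<noteq> 0 \<and> q 3 \<noteq> 0)
    \<or> (q 6 \<noteq> 0 \<and> q 5 \<noteq> 0 \<and> q 4 \<noteq> 0)"
    using q01[of 0] q01[of 1] q01[of 2] q01[of 3] q01[of 4] q01[of 5] q01[of 6]
    by (elim disjE; insert s d; simp)
  then have "\<exists>j. q j \<noteq> 0 \<and> q (j + 6) \<noteq> 0 \<and> q (j + 5) \<noteq> 0"
  proof (elim disjE)
    show ?thesis if "q 0 \<noteq> 0 \<and> q 6 \<noteq> 0 \<and> q 5 \<noteq> 0" using that by (intro exI[of _ 0]) simp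
    show ?thesis if "q 1 \<noteq> 0 \<and> q 0 \<noteq> 0 \<and> q 6 \<noteq> 0" using that per[of 0] by (intro exI[of _ 1]) simp
    show ?thesis if "q 2 \<noteq> 0 \<and> q 1 \<noteq> 0 \<and> q 0 \<noteq> 0" using that per[of 0] per[of 1] by (intro exI[of _ 2]) simp
    show ?thesis if "q 3 \<noteq> 0 \<and> q 2 \<noteq> 0 \<and> q 1 \<noteq> 0" using that per[of 1] per[of 2] by (intro exI[of _ 3]) simp
    show ?thesis if "q 4 \<noteq> 0 \<and> q 3 \<noteq> 0 \<and> q 2 \<noteq> 0" using that per[of 2] per[of 3] by (intro exI[of _ 4]) simp
    show ?thesis if "q 5 \<noteq> 0 \<and> q 4 \<noteq> 0 \<and> q 3 \<noteq> 0" using that per[of 3] per[of 4] by (intro exI[of _ 5]) simp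
    show ?thesis if "q 6 \<noteq> 0 \<and> q 5 \<noteq> 0 \<and> q 4 \<noteq> 0" using that per[of 4] per[of 5] by (intro exI[of _ 6]) simp
  qed
  then obtain j where j: "q j \<noteq> 0" "q (j + 6) \<noteq> 0" "q (j + 5) \<noteq> 0" by blast
  have ne: "links i \<noteq> {}" if "q i \<noteq> 0" for i using that by (auto simp: q_def)
  show ?thesis by (rule that[OF ne[OF j(1)] ne[OF j(2)] ne[OF j(3)]])
qed

end

section \<open>The extremal configuration and the missing orders\<close>


lemma tight_barsD:
  assumes "(p, q) \<in> set tight_bars"
  shows "(p, q) \<notin> set tight_edges" "p < q" "7 \<le> p \<and> q < 21 \<or> 21 \<le> p \<and> q < 33"
proof -
  have set: "set (concat (map (\<lambda>a. map (Pair a) [a+1..<h]) [l..<h])) \<subseteq> {(p, q). l \<le> p \<and> p < q \<and> q < h}"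
    for l h :: nat by auto
  have "(p, q) \<notin> set tight_edges \<and> p < q \<and> (7 \<le> p \<and> q < 21 \<or> 21 \<le> p \<and> q < 33)"
    using assms set[of 21 7] set[of 33 21] unfolding tight_bars_def set_filter concat_append set_append by blast
  then show "(p, q) \<notin> set tight_edges" "p < q" "7 \<le> p \<and> q < 21 \<or> 21 \<le> p \<and> q < 33" by blast+
qed

context odd_cycle
begin

text \<open>
Equality in the count leaves each vertex beyond the ring with one neighbour of its own kind, which
gives the perfect matching. Cycle vertex 4 has no outer vertex on a link, so its two outer
vertices have six neighbours \<open>z1, ..., w3\<close> beyond the ring. Two of these matched with
each other would close a triangle or a pentagon; so they and their partners are all the twelve
vertices, and the whole graph carries the labels of the extremal certificate.
\<close>
lemma no_tight_0:
  assumes g: "g = 7" and n: "card V \<in> {27, 29, 31, 33}"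
    and l: "links 0 \<noteq> {}" "links 6 \<noteq> {}" "links 5 \<noteq> {}"
  shows False
proof -
  note counts = tight_counts[OF g n]
  have per: "outer (i + 7) = outer i" for i using outer_periodic[of i] g by simp
  obtain x0 y3 where l0: "(x0, y3) \<in> links 0" using l(1) by fastforce
  obtain x6 y2 where l6: "(x6, y2) \<in> links 6" using l(2) by fastforce
  obtain x5 y1 where l5: "(x5, y1) \<in> links 5" using l(3) by fastforce
  obtain x4 y4 where o4: "outer 4 = {x4, y4}" "x4 \<noteq> y4" using card_outer[of 4] by (auto simp: card_2_iff)
  have none: "links 1 = {}" "links 2 = {}" "links 3 = {}" "links 4 = {}"
  proof -
    have s: "card (links 0) + card (links 1) + card (links 2) + card (links 3) + card (links 4)
        + card (links 5) + card (links 6) = 3"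
      using counts(2) g by (simp add: eval_nat_numeral)
    have fin: "finite (links i)" for i
      by (rule finite_subset[of _ "outer i \<times> outer (i + 3)"]) (auto simp: links_def finite_outer)
    have "card (links 0) \<ge> 1" "card (links 6) \<ge> 1" "card (links 5) \<ge> 1"
      using l fin by (simp_all add: Suc_le_eq card_gt_0_iff)
    then have "card (links 1) = 0" "card (links 2) = 0" "card (links 3) = 0" "card (links 4) = 0"
      using s by linarith+
    then show "links 1 = {}" "links 2 = {}" "links 3 = {}" "links 4 = {}" using fin by simp_all
  qed
  have single: "links 0 = {(x0, y3)}" "links 6 = {(x6, y2)}" "links 5 = {(x5, y1)}"
    using l0 l5 l6 links_unique[OF g n] by blast+
  define a where "a i = [x0, y1, y2, y3, x4, x5, x6] ! i" for i
  have av: "a 0 = x0" "a 1 = y1" "a 2 = y2" "a 3 = y3" "a 4 = x4" "a 5 = x5" "a 6 = x6"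
    by (simp_all add: a_def)
  have mem: "x0 \<in> outer 0" "y3 \<in> outer 3" "x6 \<in> outer 6" "y2 \<in> outer 2" "x5 \<in> outer 5" "y1 \<in> outer 1" "x4 \<in> outer 4"
    using l0 l6 l5 o4 per[of 2] per[of 1] by (auto simp: links_def)
  have ladj: "adj x0 y3" "adj x6 y2" "adj x5 y1" using l0 l6 l5 by (auto simp: links_def)
  have seven: "i = 0 \<or> i = 1 \<or> i = 2 \<or> i = 3 \<or> i = 4 \<or> i = 5 \<or> i = 6" if "i < g" for i
    using that g by linarith
  have ao: "a i \<in> outer i" if "i < g" for i
    using seven[OF that] mem av by (elim disjE) simp_all
  obtain b' where b': "\<And>i. i < g \<Longrightarrow> outer i = {a i, b' i} \<and> a i \<noteq> b' i"
    using relabel[of a] ao by metis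
  define b where "b = b'"
  have ab: "outer i = {a i, b i}" if "i < g" for i using b'[OF that] by (simp add: b_def)
  have b4: "b 4 = y4" using b'[of 4] o4 av g by (auto simp: b_def doubleton_eq_iff)
  \<comment> \<open>four steps forward on the cycle are three steps back\<close>
  have up: "(x, y) = (x0, y3) \<or> (y, x) = (x5, y1) \<or> (y, x) = (x6, y2)"
    if ij: "i < g" "j < g" "i \<le> j" and x: "x \<in> outer i" and y: "y \<in> outer j" and xy: "adj x y" for i j x y
  proof -
    have "y \<in> outer (i + (j - i))" using y ij by simp
    from outer_outer[OF _ x this xy] have "j - i = 3 \<or> j - i = 4" using ij g by simp
    then consider "j = i + 3" | "j = i + 4" using ij by linarith
    then show ?thesis
    proof cases
      case 1
      then have lk: "(x, y) \<in> links i" using x y xy by (simp add: links_def)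
      have "i \<le> 3" using 1 ij g by simp
      then have "i = 0 \<or> i = 1 \<or> i = 2 \<or> i = 3" by linarith
      then show ?thesis using lk none single by (elim disjE) simp_all
    next
      case 2
      then have "j + 3 = i + 7" by simp
      then have "outer (j + 3) = outer i" using per[of i] by metis
      then have "x \<in> outer (j + 3)" using x by simp
      then have lk: "(y, x) \<in> links j" using y sym[OF xy] by (simp add: links_def)
      have "j = 4 \<or> j = 5 \<or> j = 6" using 2 ij g by linarith
      then show ?thesis using lk none single by (elim disjE) simp_all
    qed
  qed
  have ringring: "(x, y) \<in> {(x0, y3), (y3, x0), (x5, y1), (y1, x5), (x6, y2), (y2, x6)}"
    if "x \<in> ring" "y \<in> ring" and xy: "adj x y" for x y
  proof -
    obtain i j where ij: "i < g" "x \<in> outer i" "j < g" "y \<in> outer j" using \<open>x \<in> ring\<close> \<open>y \<in> ring\<close> by (auto simp: ring_def)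
    show ?thesis
    proof (cases "i \<le> j")
      case True then show ?thesis using up[of i j x y] ij xy by auto
    next
      case False then show ?thesis using up[of j i y x] ij sym[OF xy] by auto
    qed
  qed
  \<comment> \<open>three of the four neighbours lie in the ring, so exactly one remains\<close>
  have "\<exists>w. {y \<in> rest. adj z y} = {w}" if "z \<in> rest" for z
  proof -
    have "card {y \<in> rest. adj z y} = 1" using rest_nbrs[OF that] counts(3)[OF that] by simp
    then show ?thesis by (simp add: card_1_singleton_iff)
  qed
  then obtain m where m: "\<And>z. z \<in> rest \<Longrightarrow> {y \<in> rest. adj z y} = {m z}" by metis
  have m1: "m z \<in> rest" "adj z (m z)" if "z \<in> rest" for z using m[OF that] by blast+
  have m2: "w = m z" if "z \<in> rest" "w \<in> rest" "adj z w" for z w using m[OF that(1)] that by blast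
  have mm: "m (m z) = z" if "z \<in> rest" for z using m2[of "m z" z] m1[OF that] sym that by simp
  have three: "\<exists>z1 z2 z3. {y \<in> rest. adj x y} = {z1, z2, z3} \<and> distinct [z1, z2, z3]" if x: "x \<in> outer 4" for x
  proof -
    have k: "x \<notin> outer k" if "k < g" "k \<noteq> 4" for k using outer_disjoint'[of 4 k] that x g by auto
    have "x \<noteq> x0" using k[of 0] mem(1) g by auto
    moreover have "x \<noteq> y3" using k[of 3] mem(2) g by auto
    moreover have "x \<noteq> x6" using k[of 6] mem(3) g by auto
    moreover have "x \<noteq> y2" using k[of 2] mem(4) g by auto
    moreover have "x \<noteq> x5" using k[of 5] mem(5) g by auto
    moreover have "x \<noteq> y1" using k[of 1] mem(6) g by auto
    moreover have four: "4 < g" using g by simp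
    then have "x \<in> ring" using x unfolding ring_def by blast
    ultimately have "{y \<in> ring. adj x y} = {}" using ringring[of x] by blast
    then have "card {y \<in> ring. adj x y} = 0" by (simp only: card.empty)
    then have "card {y \<in> rest. adj x y} = 3" using outer_nbrs[OF x four] by linarith
    then show ?thesis by (auto simp: card_3_iff)
  qed
  obtain z1 z2 z3 where z: "{y \<in> rest. adj x4 y} = {z1, z2, z3}" "distinct [z1, z2, z3]" using three[of x4] o4 by blast
  obtain w1 w2 w3 where w: "{y \<in> rest. adj y4 y} = {w1, w2, w3}" "distinct [w1, w2, w3]" using three[of y4] o4 by blast
  have zr: "z1 \<in> rest" "z2 \<in> rest" "z3 \<in> rest" "adj x4 z1" "adj x4 z2" "adj x4 z3" using z(1) by blast+
  have wr: "w1 \<in> rest" "w2 \<in> rest" "w3 \<in> rest" "adj y4 w1" "adj y4 w2" "adj y4 w3" using w(1) by blast+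
  have c4: "adj (c 4) x4" "adj (c 4) y4" using o4 outer_adj by blast+
  define ss where "ss = [z1, z2, z3, w1, w2, w3]"
  have ssr: "s \<in> rest" if "s \<in> set ss" for s using that zr wr by (auto simp: ss_def)
  have ssa: "adj x4 s \<or> adj y4 s" if "s \<in> set ss" for s using that zr wr by (auto simp: ss_def)
  have both: False if "s \<in> rest" "adj x4 s" "adj y4 s" for s
  proof -
    have "c 4 = s \<or> x4 = y4" using no_square[OF c4(1) that(2) sym[OF that(3)] sym[OF c4(2)]] .
    moreover have "4 < g" using g by simp
    then have "c 4 \<notin> rest" unfolding rest_def by blast
    ultimately show False using that(1) o4(2) by blast
  qed
  have dss: "distinct ss"
    using z(2) w(2) both zr wr by (auto simp: ss_def)
  have apart: "m s \<noteq> t" if st: "s \<in> set ss" "t \<in> set ss" for s t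
  proof
    assume "m s = t"
    then have st': "adj s t" using m1(2)[OF ssr[OF st(1)]] by simp
    from ssa[OF st(1)] ssa[OF st(2)]
    consider "adj x4 s" "adj x4 t" | "adj y4 s" "adj y4 t" | "adj x4 s" "adj y4 t" | "adj y4 s" "adj x4 t" by blast
    then show False
    proof cases
      case 1 show False by (rule no_triangle[OF 1(1) st' sym[OF 1(2)]])
    next
      case 2 show False by (rule no_triangle[OF 2(1) st' sym[OF 2(2)]])
    next
      case 3 show False by (rule no_pentagon[OF c4(1) 3(1) st' sym[OF 3(2)] sym[OF c4(2)]])
    next
      case 4 show False by (rule no_pentagon[OF c4(2) 4(1) st' sym[OF 4(2)] sym[OF c4(1)]])
    qed
  qed
  have minj: "s = t" if st: "s \<in> set ss" "t \<in> set ss" "m s = m t" for s t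
  proof -
    have "s = m (m s)" by (rule mm[OF ssr[OF st(1)], symmetric])
    also have "\<dots> = m (m t)" by (rule arg_cong[OF st(3)])
    also have "\<dots> = t" by (rule mm[OF ssr[OF st(2)]])
    finally show ?thesis .
  qed
  define xs where "xs = concat (map (\<lambda>s. [s, m s]) ss)"
  have xs_eq: "xs = [z1, m z1, z2, m z2, z3, m z3, w1, m w1, w2, m w2, w3, m w3]" by (simp add: xs_def ss_def)
  have dxs: "distinct xs"
  proof -
    have "distinct (concat (map (\<lambda>s. [s, m s]) ts))" if "set ts \<subseteq> set ss" "distinct ts" for ts
      using that
    proof (induction ts)
      case (Cons t ts)
      then have t: "t \<in> set ss" "t \<notin> set ts" "set ts \<subseteq> set ss" by auto
      have "m t \<noteq> u" "t \<noteq> m u" "m t \<noteq> m u" if "u \<in> set ts" for u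
      proof -
        have u: "u \<in> set ss" "t \<noteq> u" using that t by blast+
        show "m t \<noteq> u" by (rule apart[OF t(1) u(1)])
        show "t \<noteq> m u" using apart[OF u(1) t(1)] by metis
        show "m t \<noteq> m u" using minj[OF t(1) u(1)] u(2) by blast
      qed
      moreover have "m t \<noteq> t" by (rule apart[OF t(1) t(1)])
      ultimately show ?case using Cons.IH[OF t(3)] Cons.prems(2) t(2) by auto
    qed simp
    then show ?thesis using dss by (simp add: xs_def)
  qed
  have xsr: "set xs \<subseteq> rest" using ssr m1(1) by (auto simp: xs_def)
  then have sub: "set xs \<subseteq> V - c ` {..<g} - (\<Union>i<g. outer i)" by (simp add: rest_def ring_def)
  obtain f R where R: "girth6_quartic {..<card V} R" and bij: "bij_betw f {..<card V} V"
    and Radj: "\<And>x y. R x y \<longleftrightarrow> x < card V \<and> y < card V \<and> adj (f x) (f y)"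
    and fa: "\<And>i. i < g \<Longrightarrow> f (g + 2 * i) = a i" and fb: "\<And>i. i < g \<Longrightarrow> f (g + 2 * i + 1) = b i"
    and fx: "\<And>i. i < length xs \<Longrightarrow> f (3 * g + i) = xs ! i"
    and fr: "\<And>x y. (x, y) \<in> set (frame g) \<Longrightarrow> R x y"
    by (rule embedding[OF ab sub dxs]) blast+
  have V33: "card V = 33" by (rule counts(1))
  have finj: "p = q" if "f p = f q" "p < 33" "q < 33" for p q
    using bij that V33 by (auto simp: bij_betw_def inj_on_def)
  have fo: "f 7 = x0" "f 9 = y1" "f 11 = y2" "f 13 = y3" "f 15 = x4" "f 17 = x5" "f 19 = x6" "f 16 = y4"
    using fa[of 0] fa[of 1] fa[of 2] fa[of 3] fa[of 4] fa[of 5] fa[of 6] fb[of 4] g av b4 by simp_all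
  have lx: "length xs = 12" by (simp add: xs_eq)
  have fX: "f 21 = z1" "f 22 = m z1" "f 23 = z2" "f 24 = m z2" "f 25 = z3" "f 26 = m z3"
    "f 27 = w1" "f 28 = m w1" "f 29 = w2" "f 30 = m w2" "f 31 = w3" "f 32 = m w3"
    using fx[of 0] fx[of 1] fx[of 2] fx[of 3] fx[of 4] fx[of 5] fx[of 6] fx[of 7] fx[of 8] fx[of 9] fx[of 10] fx[of 11] g lx
    by (simp_all add: xs_eq)
  have edges: "R p q" if "(p, q) \<in> set tight_edges" for p q
    using that unfolding tight_edges_def
    by (auto simp: Radj V33 fo fX ladj sym[OF ladj(2)] sym[OF ladj(3)] zr wr m1(2))
  have inring: "f p \<in> ring" if "7 \<le> p" "p < 21" for p
  proof -
    define i where "i = (p - 7) div 2"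
    have i: "i < g" "p = g + 2 * i \<or> p = g + 2 * i + 1" using that g by (auto simp: i_def)
    then have "f p \<in> outer i" using fa[OF i(1)] fb[OF i(1)] ab[OF i(1)] by auto
    then show ?thesis using i by (auto simp: ring_def)
  qed
  have bars: "\<not> R p q" if pq: "(p, q) \<in> set tight_bars" for p q
  proof
    assume "R p q"
    then have adj: "adj (f p) (f q)" by (simp add: Radj)
    note D = tight_barsD[OF pq]
    from D(3) show False
    proof
      assume r: "7 \<le> p \<and> q < 21"
      have P: "p = k" if "f p = f k" "k < 21" for k using finj[OF that(1)] that(2) r D(2) by simp
      have Q: "q = k" if "f q = f k" "k < 21" for k using finj[OF that(1)] that(2) r D(2) by simp
      have "f p \<in> ring" "f q \<in> ring" using inring r D(2) by simp_all
      from ringring[OF this adj]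
      consider "f p = f 7" "f q = f 13" | "f p = f 13" "f q = f 7" | "f p = f 17" "f q = f 9" | "f p = f 9" "f q = f 17" | "f p = f 19" "f q = f 11" | "f p = f 11" "f q = f 19"
        unfolding fo by blast
      then show False
      proof cases
        case 1 then have "p = 7" "q = 13" by (auto intro: P Q)
        then show False using D(1,2) by (simp add: tight_edges_def)
      next
        case 2 then have "p = 13" "q = 7" by (auto intro: P Q)
        then show False using D(1,2) by (simp add: tight_edges_def)
      next
        case 3 then have "p = 17" "q = 9" by (auto intro: P Q)
        then show False using D(1,2) by (simp add: tight_edges_def)
      next
        case 4 then have "p = 9" "q = 17" by (auto intro: P Q)
        then show False using D(1,2) by (simp add: tight_edges_def)
      next
        case 5 then have "p = 19" "q = 11" by (auto intro: P Q)
        then show False using D(1,2) by (simp add: tight_edges_def)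
      next
        case 6 then have "p = 11" "q = 19" by (auto intro: P Q)
        then show False using D(1,2) by (simp add: tight_edges_def)
      qed
    next
      assume r: "21 \<le> p \<and> q < 33"
      have "21 \<le> p" "p < 32" using r D(2) by auto
      then have "p \<in> set [21..<32]" by (simp only: set_upt atLeastLessThan_iff simp_thms)
      moreover have "[21..<32] = [21,22,23,24,25,26,27,28,29,30,31]" by code_simp
      ultimately have "p \<in> set [21,22,23,24,25,26,27,28,29,30,31]" by (simp only:)
      then have p: "p = 21 \<or> p = 22 \<or> p = 23 \<or> p = 24 \<or> p = 25 \<or> p = 26 \<or> p = 27 \<or> p = 28 \<or> p = 29 \<or> p = 30 \<or> p = 31" by simp
      have rest: "f k \<in> rest" if "21 \<le> k" "k < 33" for k
        using fx[of "k - 21"] lx that g xsr nth_mem[of "k - 21" xs] by auto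
      have fq: "f q = m (f p)" using m2[OF rest rest adj] r D(2) by simp
      have mate: "f q = f (if odd p then p + 1 else p - 1)"
        unfolding fq using p by (elim disjE) (simp_all add: fX mm zr wr)
      have "q = (if odd p then p + 1 else p - 1)"
        by (rule finj[OF mate]) (use p r in \<open>auto\<close>)
      then have "odd p" "q = p + 1" using D(2) by (simp_all split: if_splits)
      then show False using p D(1) by (elim disjE) (simp_all add: tight_edges_def)
    qed
  qed
  show False
  proof (rule refutes_sound[OF tight_33, of R])
    show "girth6_quartic {..<33} R" using R V33 by simp
    show "R p q" if "(p, q) \<in> set (frame 7 @ tight_edges)" for p q using that edges fr[of p q] g by auto
    show "p < 33 \<and> q < 33 \<and> \<not> R p q" if "(p, q) \<in> set tight_bars" for p q
      using bars[OF that] tight_barsD[OF that] by auto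
  qed simp
qed

lemma no_seven:
  assumes g: "g = 7" and n: "card V \<in> {27, 29, 31, 33}"
  shows False
proof -
  obtain j where j: "links j \<noteq> {}" "links (j + 6) \<noteq> {}" "links (j + 5) \<noteq> {}"
    by (rule tight_pattern[OF g n])
  interpret r: odd_cycle V adj "\<lambda>k. c (k + j)" g by (rule rotate)
  have "r.links i = links (i + j)" for i
    by (simp add: r.links_def links_def rotated_outer add_ac)
  then show False using r.no_tight_0[OF g n] j by (simp add: add.commute)
qed

end

text \<open>
A shortest odd cycle of length \<open>g\<close> has \<open>2 * g\<close> outer vertices, so
\<open>3 * g \<le> 33\<close>.
\<close>
lemma (in girth6_quartic) odd_order:
  assumes conn: "\<And>x y. x \<in> V \<Longrightarrow> y \<in> V \<Longrightarrow> adj\<^sup>*\<^sup>* x y" and n: "card V \<in> {27, 29, 31, 33}"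
  shows False
proof -
  have "odd (card V)" using n by auto
  then obtain k x where "odd k" "(x, x) \<in> arcs ^^ k" using odd_closed_walk[OF conn] by blast
  then obtain c g where "odd_cycle V adj c g" by (rule obtain_odd_cycle)
  then interpret o: odd_cycle V adj c g .
  have "7 \<le> g" "3 * g \<le> 33" using o.g_ge o.three_g_le n by auto
  then have "g = 7 \<or> g = 9 \<or> g = 11" using o.odd_g by (auto elim!: oddE)
  then show False using o.no_seven[OF _ n] o.nine_or_eleven[OF _ n] by blast
qed

lemma spectrum_lower:
  assumes "n \<in> kg_spectrum 4 6"
  shows "26 \<le> n" "n \<notin> {27, 29, 31, 33}"
proof -
  obtain G :: "nat pair_pre_digraph" where G: "kg_graph 4 6 G" "Digraph_Component.connected (with_proj G)"
    "card (pverts G) = n"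
    using assms by (auto simp: kg_spectrum_def)
  interpret girth6_quartic "pverts G" "\<lambda>x y. (x, y) \<in> parcs G" by (rule kg_graph_girth6_quartic[OF G(1)])
  have pg: "pair_graph G" using G(1) by (simp add: kg_graph_def)
  have c: "pverts G \<noteq> {}" "\<And>u v. u \<in> pverts G \<Longrightarrow> v \<in> pverts G \<Longrightarrow> (u, v) \<in> (parcs G)\<^sup>*"
    using G(2) connected_pair[OF pg] by auto
  show "26 \<le> n" using moore_bound[OF c(1)] G(3) by simp
  have conn: "(\<lambda>x y. (x, y) \<in> parcs G)\<^sup>*\<^sup>* u v" if "u \<in> pverts G" "v \<in> pverts G" for u v
    using c(2)[OF that] by (simp add: rtranclp_rtrancl_eq)
  show "n \<notin> {27, 29, 31, 33}" using odd_order[OF conn] G(3) by blast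
qed

theorem mainTheorem11:
  fixes S A :: "nat set"
  assumes "S = kg_spectrum 4 6"
    and "A = {n. even n \<and> 26 \<le> n} \<union> {35} \<union> {n. odd n \<and> 39 \<le> n}"
  shows "A = {26, 28, 30, 32, 34, 35, 36} \<union> {38..}
    \<and> A \<subseteq> S \<and> S \<subseteq> A \<union> {37}
    \<and> spectrum_threshold 4 6 \<le> 38"
proof -
  have A: "n \<in> A \<longleftrightarrow> even n \<and> 26 \<le> n \<or> n = 35 \<or> odd n \<and> 39 \<le> n" for n
    using assms(2) by auto
  have "n \<in> A \<longleftrightarrow> n \<in> {26, 28, 30, 32, 34, 35, 36} \<union> {38..}" for n
    unfolding A Un_iff insert_iff empty_iff atLeast_iff by presburger
  then have list: "A = {26, 28, 30, 32, 34, 35, 36} \<union> {38..}" by (rule set_eqI)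
  have AS: "A \<subseteq> S"
  proof
    fix n assume "n \<in> A"
    then have "even n \<and> 26 \<le> n \<or> n = 35 \<or> n = 39 \<or> odd n \<and> 41 \<le> n"
      unfolding A by presburger
    then consider "even n" "26 \<le> n" | "n = 35" | "n = 39" | "odd n" "41 \<le> n" by blast
    then show "n \<in> S"
    proof cases
      case 1
      then show ?thesis using even_spectrum[of "n div 2"] assms(1) by simp
    next
      case 4
      then show ?thesis using odd_spectrum[of "n div 2"] assms(1) by simp
    qed (use spectrum_35 spectrum_39 assms(1) in auto)
  qed
  have "S \<subseteq> A \<union> {37}"
  proof
    fix n assume "n \<in> S"
    then have "26 \<le> n" "n \<noteq> 27" "n \<noteq> 29" "n \<noteq> 31" "n \<noteq> 33"
      using spectrum_lower[of n] assms(1) by auto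
    then show "n \<in> A \<union> {37}" unfolding Un_iff A insert_iff empty_iff by presburger
  qed
  moreover have "spectrum_threshold 4 6 \<le> 38"
    unfolding spectrum_threshold_def using AS by (intro Least_le) (auto simp: list assms(1))
  ultimately show ?thesis using list AS by blast
qed

end
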